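(* Let $R$ be a ring with unity, let $\mathcal{X}$ be a semibrick of left $R$-modules and let $Y$ be a left $R$-module. Then all $\mathcal{X}$-universal short exact sequences starting from $Y$ are isomorphic: if $0\to Y\xrightarrow{\alpha}Z\xrightarrow{\beta}\bigoplus_{X\in\mathcal{X}}X^{(I_X)}\to0$ and $0\to Y\xrightarrow{\alpha'}Z'\xrightarrow{\beta'}\bigoplus_{X\in\mathcal{X}}X^{(I_X)}\to0$ are $\mathcal{X}$-universal, then there exist isomorphisms $f:Z'\to Z$ and $g:\bigoplus_{X\in\mathcal{X}}X^{(I_X)}\to\bigoplus_{X\in\mathcal{X}}X^{(I_X)}$ which together with the identity of $Y$ form a commutative diagram between the two sequences.
   Context: A brick is a finitely presented left $R$-module whose endomorphism ring is a division ring. A semibrick is a class $\mathcal{X}$ of pairwise non-isomorphic bricks with $\mathrm{Hom}(X,X')=0$ for distinct $X,X'\in\mathcal{X}$. $\mathcal{X}$-universal sequences: for each $X\in\mathcal{X}$, $\mathrm{Ext}^1(X,Y)$ is a left $\mathrm{End}(X)$-module (endomorphisms act by pull-back; compositions are written from left to right). Choose a basis $(0\to Y\to M_{X,i}\to X\to 0)_{i\in I_X}$ of it over the division ring $\mathrm{End}(X)$. The $\mathcal{X}$-universal short exact sequence $0\to Y\to M\to\bigoplus_{X\in\mathcal{X}}X^{(I_X)}\to 0$ starting from $Y$ (for this choice of bases) is the push-out of the direct sum sequence $0\to\bigoplus_{X}Y^{(I_X)}\to\bigoplus_{X,i}M_{X,i}\to\bigoplus_{X}X^{(I_X)}\to 0$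 along the summation map $\bigoplus_X Y^{(I_X)}\to Y$. The two bases of $\mathrm{Ext}^1(X,Y)$ used for the two sequences are indexed by the same set $I_X$ (all bases have the same cardinality). *)

theory Defs
  imports "HOL-Algebra.Module" "HOL-Algebra.AbelCoset"
begin

text \<open>The library locale \<open>module\<close> requires a commutative ring of scalars. Here the ring is
  arbitrary, with unity. The module record of the library is reused; its ring operations \<open>mult\<close>
  and \<open>one\<close> carry no meaning for a module and are left undefined.\<close>

locale left_module = R?: ring R + M?: abelian_group M
  for R :: "('r, 'k) ring_scheme" (structure) and M :: "('r, 'a, 'm) module_scheme" (structure) +
  assumes smult_closed [simp, intro]:
      "\<lbrakk> a \<in> carrier R; x \<in> carrier M \<rbrakk> \<Longrightarrow> a \<odot>\<^bsub>M\<^esub> x \<in> carrier M"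
    and smult_l_distr:
      "\<lbrakk> a \<in> carrier R; b \<in> carrier R; x \<in> carrier M \<rbrakk> \<Longrightarrow>
        (a \<oplus>\<^bsub>R\<^esub> b) \<odot>\<^bsub>M\<^esub> x = (a \<odot>\<^bsub>M\<^esub> x) \<oplus>\<^bsub>M\<^esub> (b \<odot>\<^bsub>M\<^esub> x)"
    and smult_r_distr:
      "\<lbrakk> a \<in> carrier R; x \<in> carrier M; y \<in> carrier M \<rbrakk> \<Longrightarrow>
        a \<odot>\<^bsub>M\<^esub> (x \<oplus>\<^bsub>M\<^esub> y) = (a \<odot>\<^bsub>M\<^esub> x) \<oplus>\<^bsub>M\<^esub> (a \<odot>\<^bsub>M\<^esub> y)"
    and smult_assoc:
      "\<lbrakk> a \<in> carrier R; b \<in> carrier R; x \<in> carrier M \<rbrakk> \<Longrightarrow>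
        (a \<otimes>\<^bsub>R\<^esub> b) \<odot>\<^bsub>M\<^esub> x = a \<odot>\<^bsub>M\<^esub> (b \<odot>\<^bsub>M\<^esub> x)"
    and smult_one [simp]: "x \<in> carrier M \<Longrightarrow> \<one>\<^bsub>R\<^esub> \<odot>\<^bsub>M\<^esub> x = x"

definition mod_hom ::
  "('r, 'k) ring_scheme \<Rightarrow> ('r, 'a) module \<Rightarrow> ('r, 'b) module \<Rightarrow> ('a \<Rightarrow> 'b) set" where
  "mod_hom R M N = {f \<in> carrier M \<rightarrow> carrier N.
     (\<forall>x\<in>carrier M. \<forall>y\<in>carrier M. f (x \<oplus>\<^bsub>M\<^esub> y) = f x \<oplus>\<^bsub>N\<^esub> f y) \<and>
     (\<forall>r\<in>carrier R. \<forall>x\<in>carrier M. f (r \<odot>\<^bsub>M\<^esub> x) = r \<odot>\<^bsub>N\<^esub> f x)}"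

definition mod_iso ::
  "('r, 'k) ring_scheme \<Rightarrow> ('r, 'a) module \<Rightarrow> ('r, 'b) module \<Rightarrow> ('a \<Rightarrow> 'b) set" where
  "mod_iso R M N = {f \<in> mod_hom R M N. bij_betw f (carrier M) (carrier N)}"

definition regular_module :: "('r, 'k) ring_scheme \<Rightarrow> ('r, 'r) module" where
  "regular_module R = \<lparr>carrier = carrier R, mult = undefined, one = undefined,
     zero = \<zero>\<^bsub>R\<^esub>, add = add R, smult = mult R\<rparr>"

definition prod_module :: "('r, 'a) module \<Rightarrow> ('r, 'b) module \<Rightarrow> ('r, 'a \<times> 'b) module" where
  "prod_module M N = \<lparr>carrier = carrier M \<times> carrier N, mult = undefined, one = undefined,
     zero = (\<zero>\<^bsub>M\<^esub>, \<zero>\<^bsub>N\<^esub>),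
     add = (\<lambda>(a, b) (a', b'). (a \<oplus>\<^bsub>M\<^esub> a', b \<oplus>\<^bsub>N\<^esub> b')),
     smult = (\<lambda>r (a, b). (r \<odot>\<^bsub>M\<^esub> a, r \<odot>\<^bsub>N\<^esub> b))\<rparr>"

definition direct_sum :: "'j set \<Rightarrow> ('j \<Rightarrow> ('r, 'a) module) \<Rightarrow> ('r, 'j \<Rightarrow> 'a) module" where
  "direct_sum J M = \<lparr>carrier = {x \<in> (\<Pi>\<^sub>E j\<in>J. carrier (M j)). finite {j \<in> J. x j \<noteq> \<zero>\<^bsub>M j\<^esub>}},
     mult = undefined, one = undefined,
     zero = (\<lambda>j\<in>J. \<zero>\<^bsub>M j\<^esub>),
     add = (\<lambda>x y. \<lambda>j\<in>J. x j \<oplus>\<^bsub>M j\<^esub> y j),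
     smult = (\<lambda>r x. \<lambda>j\<in>J. r \<odot>\<^bsub>M j\<^esub> x j)\<rparr>"

definition quotient_module :: "('r, 'a) module \<Rightarrow> 'a set \<Rightarrow> ('r, 'a set) module" where
  "quotient_module M N = \<lparr>carrier = a_rcosets\<^bsub>M\<^esub> N, mult = undefined, one = undefined,
     zero = N, add = set_add M,
     smult = (\<lambda>r C. \<Union>m\<in>C. N +>\<^bsub>M\<^esub> (r \<odot>\<^bsub>M\<^esub> m))\<rparr>"

definition pushout_submodule ::
  "('r, 'a) module \<Rightarrow> ('r, 'b) module \<Rightarrow> ('r, 'c) module \<Rightarrow> ('a \<Rightarrow> 'b) \<Rightarrow> ('a \<Rightarrow> 'c) \<Rightarrow> ('b \<times> 'c) set" where
  "pushout_submodule A B C f g = (\<lambda>a. (f a, \<ominus>\<^bsub>C\<^esub> g a)) ` carrier A"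

text \<open>The push-out of \<open>f : A \<rightarrow> B\<close> and \<open>g : A \<rightarrow> C\<close> as the usual quotient of \<open>B \<oplus> C\<close>.\<close>

definition pushout_module ::
  "('r, 'a) module \<Rightarrow> ('r, 'b) module \<Rightarrow> ('r, 'c) module \<Rightarrow> ('a \<Rightarrow> 'b) \<Rightarrow> ('a \<Rightarrow> 'c) \<Rightarrow>
    ('r, ('b \<times> 'c) set) module" where
  "pushout_module A B C f g = quotient_module (prod_module B C) (pushout_submodule A B C f g)"

definition pullback_module ::
  "('r, 'a) module \<Rightarrow> ('r, 'b) module \<Rightarrow> ('a \<Rightarrow> 'c) \<Rightarrow> ('b \<Rightarrow> 'c) \<Rightarrow> ('r, 'a \<times> 'b) module" where
  "pullback_module A B f g =
     (prod_module A B)\<lparr>carrier := {(a, b). a \<in> carrier A \<and> b \<in> carrier B \<and> f a = g b}\<rparr>"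

definition finitely_presented :: "('r, 'k) ring_scheme \<Rightarrow> ('r, 'a) module \<Rightarrow> bool" where
  "finitely_presented R M \<longleftrightarrow> left_module R M \<and>
     (\<exists>(m::nat) (n::nat).
        let F = direct_sum {..<m} (\<lambda>_. regular_module R);
            G = direct_sum {..<n} (\<lambda>_. regular_module R)
        in \<exists>f g. f \<in> mod_hom R F G \<and> g \<in> mod_hom R G M \<and>
             f ` carrier F = {x \<in> carrier G. g x = \<zero>\<^bsub>M\<^esub>} \<and> g ` carrier G = carrier M)"

text \<open>Endomorphisms are taken extensional, so that distinct elements of the ring are distinct maps
  on the carrier. Composition is written from left to right: \<open>f \<otimes> g\<close> is first \<open>f\<close>, then \<open>g\<close>.\<close>

definition End_ring :: "('r, 'k) ring_scheme \<Rightarrow> ('r, 'a) module \<Rightarrow> ('a \<Rightarrow> 'a) ring" where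
  "End_ring R M = \<lparr>carrier = mod_hom R M M \<inter> extensional (carrier M),
     mult = (\<lambda>f g. compose (carrier M) g f),
     one = (\<lambda>x\<in>carrier M. x),
     zero = (\<lambda>x\<in>carrier M. \<zero>\<^bsub>M\<^esub>),
     add = (\<lambda>f g. \<lambda>x\<in>carrier M. f x \<oplus>\<^bsub>M\<^esub> g x)\<rparr>"

definition skew_field :: "('a, 'k) ring_scheme \<Rightarrow> bool" where
  "skew_field K \<longleftrightarrow> ring K \<and> Units K = carrier K - {\<zero>\<^bsub>K\<^esub>}"

definition brick :: "('r, 'k) ring_scheme \<Rightarrow> ('r, 'a) module \<Rightarrow> bool" where
  "brick R X \<longleftrightarrow> finitely_presented R X \<and> skew_field (End_ring R X)"

definition semibrick :: "('r, 'k) ring_scheme \<Rightarrow> ('r, 'a) module set \<Rightarrow> bool" where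
  "semibrick R \<X> \<longleftrightarrow> (\<forall>X\<in>\<X>. brick R X) \<and>
     (\<forall>X\<in>\<X>. \<forall>X'\<in>\<X>. X \<noteq> X' \<longrightarrow>
        mod_iso R X X' = {} \<and> (\<forall>h\<in>mod_hom R X X'. \<forall>x\<in>carrier X. h x = \<zero>\<^bsub>X'\<^esub>))"

text \<open>A sequence \<open>0 \<rightarrow> Y \<rightarrow> Mid \<rightarrow> X \<rightarrow> 0\<close>; the end terms are passed separately.\<close>

record ('r, 'y, 'm, 'x) ses =
  Mid :: "('r, 'm) module"
  Incl :: "'y \<Rightarrow> 'm"
  Proj :: "'m \<Rightarrow> 'x"

definition short_exact ::
  "('r, 'k) ring_scheme \<Rightarrow> ('r, 'y) module \<Rightarrow> ('r, 'x) module \<Rightarrow> ('r, 'y, 'm, 'x) ses \<Rightarrow> bool" where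
  "short_exact R Y X S \<longleftrightarrow> left_module R Y \<and> left_module R (Mid S) \<and> left_module R X \<and>
     Incl S \<in> mod_hom R Y (Mid S) \<and> Proj S \<in> mod_hom R (Mid S) X \<and>
     inj_on (Incl S) (carrier Y) \<and>
     Incl S ` carrier Y = {m \<in> carrier (Mid S). Proj S m = \<zero>\<^bsub>X\<^esub>} \<and>
     Proj S ` carrier (Mid S) = carrier X"

text \<open>Isomorphism with identities on both end terms.\<close>

definition ses_equiv ::
  "('r, 'k) ring_scheme \<Rightarrow> ('r, 'y) module \<Rightarrow> ('r, 'y, 'm, 'x) ses \<Rightarrow> ('r, 'y, 'n, 'x) ses \<Rightarrow> bool" where
  "ses_equiv R Y S T \<longleftrightarrow> (\<exists>f \<in> mod_iso R (Mid S) (Mid T).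
     (\<forall>y\<in>carrier Y. f (Incl S y) = Incl T y) \<and>
     (\<forall>m\<in>carrier (Mid S). Proj T (f m) = Proj S m))"

definition split_ses :: "('r, 'y) module \<Rightarrow> ('r, 'x) module \<Rightarrow> ('r, 'y, 'y \<times> 'x, 'x) ses" where
  "split_ses Y X = \<lparr>Mid = prod_module Y X, Incl = (\<lambda>y. (y, \<zero>\<^bsub>X\<^esub>)), Proj = snd\<rparr>"

text \<open>Pull-back of \<open>0 \<rightarrow> Y \<rightarrow> Mid S \<rightarrow> X \<rightarrow> 0\<close> along \<open>h : X' \<rightarrow> X\<close>.\<close>

definition pullback_ses ::
  "('r, 'w) module \<Rightarrow> ('w \<Rightarrow> 'x) \<Rightarrow> ('r, 'y, 'm, 'x) ses \<Rightarrow> ('r, 'y, 'm \<times> 'w, 'w) ses" where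
  "pullback_ses X' h S = \<lparr>Mid = pullback_module (Mid S) X' (Proj S) h,
     Incl = (\<lambda>y. (Incl S y, \<zero>\<^bsub>X'\<^esub>)), Proj = snd\<rparr>"

text \<open>Push-out of \<open>0 \<rightarrow> Y \<rightarrow> Mid S \<rightarrow> X \<rightarrow> 0\<close> along \<open>h : Y \<rightarrow> Y'\<close>. The projection sends the coset of
  \<open>(y', m)\<close> to \<open>Proj S m\<close>, which does not depend on the representative.\<close>

definition pushout_ses ::
  "('r, 'y) module \<Rightarrow> ('r, 'w) module \<Rightarrow> ('y \<Rightarrow> 'w) \<Rightarrow> ('r, 'y, 'm, 'x) ses \<Rightarrow>
    ('r, 'w, ('w \<times> 'm) set, 'x) ses" where
  "pushout_ses Y Y' h S = \<lparr>Mid = pushout_module Y Y' (Mid S) h (Incl S),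
     Incl = (\<lambda>y'. pushout_submodule Y Y' (Mid S) h (Incl S) +>\<^bsub>prod_module Y' (Mid S)\<^esub>
                  (y', \<zero>\<^bsub>Mid S\<^esub>)),
     Proj = (\<lambda>C. the_elem ((\<lambda>(y', m). Proj S m) ` C))\<rparr>"

definition prod_ses ::
  "('r, 'y, 'm, 'x) ses \<Rightarrow> ('r, 'v, 'n, 'w) ses \<Rightarrow> ('r, 'y \<times> 'v, 'm \<times> 'n, 'x \<times> 'w) ses" where
  "prod_ses S T = \<lparr>Mid = prod_module (Mid S) (Mid T),
     Incl = map_prod (Incl S) (Incl T), Proj = map_prod (Proj S) (Proj T)\<rparr>"

definition direct_sum_ses ::
  "'j set \<Rightarrow> ('j \<Rightarrow> ('r, 'y, 'm, 'x) ses) \<Rightarrow> ('r, 'j \<Rightarrow> 'y, 'j \<Rightarrow> 'm, 'j \<Rightarrow> 'x) ses" where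
  "direct_sum_ses J S = \<lparr>Mid = direct_sum J (\<lambda>j. Mid (S j)),
     Incl = (\<lambda>y. \<lambda>j\<in>J. Incl (S j) (y j)), Proj = (\<lambda>m. \<lambda>j\<in>J. Proj (S j) (m j))\<rparr>"

text \<open>Push-out along the codiagonal of \<open>Y\<close> of the pull-back along the diagonal of \<open>X\<close> of the direct
  sum of two sequences.\<close>

definition baer_sum ::
  "('r, 'y) module \<Rightarrow> ('r, 'x) module \<Rightarrow> ('r, 'y, 'm, 'x) ses \<Rightarrow> ('r, 'y, 'n, 'x) ses \<Rightarrow>
    ('r, 'y, ('y \<times> (('m \<times> 'n) \<times> 'x)) set, 'x) ses" where
  "baer_sum Y X S T =
     pushout_ses (prod_module Y Y) Y (\<lambda>(y, y'). y \<oplus>\<^bsub>Y\<^esub> y')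
       (pullback_ses X (\<lambda>x. (x, x)) (prod_ses S T))"

text \<open>The middle term of a short exact sequence \<open>0 \<rightarrow> Y \<rightarrow> M \<rightarrow> X \<rightarrow> 0\<close> is in bijection with
  \<open>Y \<times> X\<close>, so every such sequence, whatever the type of its middle term, is equivalent to one whose
  middle term has type \<open>'y \<times> 'x\<close>. The elements of \<open>Ext\<^sup>1 (X, Y)\<close> are the equivalence classes within
  that type.\<close>

definition ext_class ::
  "('r, 'k) ring_scheme \<Rightarrow> ('r, 'x) module \<Rightarrow> ('r, 'y) module \<Rightarrow> ('r, 'y, 'm, 'x) ses \<Rightarrow>
    ('r, 'y, 'y \<times> 'x, 'x) ses set" where
  "ext_class R X Y S = {T. short_exact R Y X T \<and> ses_equiv R Y S T}"

text \<open>Because composition in \<open>End_ring\<close> is written from left to right, the pull-back action satisfies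
  \<open>(f \<otimes> g) \<odot> A = f \<odot> (g \<odot> A)\<close>, so that this is a left module over \<open>End_ring R X\<close>. The unions
  below are unions of one and the same class, since Baer sum and pull-back respect equivalence.\<close>

definition Ext1 ::
  "('r, 'k) ring_scheme \<Rightarrow> ('r, 'x) module \<Rightarrow> ('r, 'y) module \<Rightarrow>
    ('x \<Rightarrow> 'x, ('r, 'y, 'y \<times> 'x, 'x) ses set) module" where
  "Ext1 R X Y = \<lparr>carrier = ext_class R X Y ` {S :: ('r, 'y, 'y \<times> 'x, 'x) ses. short_exact R Y X S},
     mult = undefined, one = undefined,
     zero = ext_class R X Y (split_ses Y X),
     add = (\<lambda>A B. \<Union>S\<in>A. \<Union>T\<in>B. ext_class R X Y (baer_sum Y X S T)),
     smult = (\<lambda>h A. \<Union>S\<in>A. ext_class R X Y (pullback_ses X h S))\<rparr>"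

definition module_basis ::
  "('k, 'l) ring_scheme \<Rightarrow> ('k, 'v) module \<Rightarrow> 'i set \<Rightarrow> ('i \<Rightarrow> 'v) \<Rightarrow> bool" where
  "module_basis K V I b \<longleftrightarrow> b \<in> I \<rightarrow> carrier V \<and>
     (\<forall>F c. finite F \<and> F \<subseteq> I \<and> c \<in> F \<rightarrow> carrier K \<and> (\<Oplus>\<^bsub>V\<^esub>i\<in>F. c i \<odot>\<^bsub>V\<^esub> b i) = \<zero>\<^bsub>V\<^esub>
        \<longrightarrow> (\<forall>i\<in>F. c i = \<zero>\<^bsub>K\<^esub>)) \<and>
     (\<forall>v\<in>carrier V. \<exists>F c. finite F \<and> F \<subseteq> I \<and> c \<in> F \<rightarrow> carrier K \<and>
        v = (\<Oplus>\<^bsub>V\<^esub>i\<in>F. c i \<odot>\<^bsub>V\<^esub> b i))"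

text \<open>The module \<open>\<Oplus>\<^bsub>X \<in> \<X>\<^esub> X\<^bsup>(I\<^sub>X)\<^esup>\<close>, indexed by the pairs \<open>(X, i)\<close> with \<open>i \<in> I\<^sub>X\<close>.\<close>

definition semibrick_sum ::
  "('r, 'x) module set \<Rightarrow> (('r, 'x) module \<Rightarrow> 'i set) \<Rightarrow> ('r, ('r, 'x) module \<times> 'i \<Rightarrow> 'x) module" where
  "semibrick_sum \<X> I = direct_sum (Sigma \<X> I) fst"

definition summation_map :: "'j set \<Rightarrow> ('r, 'y) module \<Rightarrow> ('j \<Rightarrow> 'y) \<Rightarrow> 'y" where
  "summation_map J Y y = (\<Oplus>\<^bsub>Y\<^esub>j\<in>{j \<in> J. y j \<noteq> \<zero>\<^bsub>Y\<^esub>}. y j)"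

text \<open>\<open>S\<close> is the universal sequence for the choice of bases given by the sequences \<open>E X i\<close>. As a
  push-out, it is determined up to isomorphisms that are the identity on the end terms.\<close>

definition universal_ses ::
  "('r, 'k) ring_scheme \<Rightarrow> ('r, 'x) module set \<Rightarrow> ('r, 'y) module \<Rightarrow>
    (('r, 'x) module \<Rightarrow> 'i set) \<Rightarrow> (('r, 'x) module \<Rightarrow> 'i \<Rightarrow> ('r, 'y, 'm, 'x) ses) \<Rightarrow>
    ('r, 'y, 'z, ('r, 'x) module \<times> 'i \<Rightarrow> 'x) ses \<Rightarrow> bool" where
  "universal_ses R \<X> Y I E S \<longleftrightarrow>
     (\<forall>X\<in>\<X>. (\<forall>i\<in>I X. short_exact R Y X (E X i)) \<and>
        module_basis (End_ring R X) (Ext1 R X Y) (I X) (\<lambda>i. ext_class R X Y (E X i))) \<and>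
     short_exact R Y (semibrick_sum \<X> I) S \<and>
     ses_equiv R Y
       (pushout_ses (direct_sum (Sigma \<X> I) (\<lambda>_. Y)) Y (summation_map (Sigma \<X> I) Y)
          (direct_sum_ses (Sigma \<X> I) (\<lambda>(X, i). E X i)))
       S"

end

theory Submission
  imports Defs
begin

text \<open>Expressing the classes of the second basis of \<open>Ext\<^sup>1 (X, Y)\<close> by the first one gives a row-finite
  matrix over \<open>End X\<close>, which is invertible since both families are bases. These matrices assemble to
  an automorphism \<open>g\<close> of \<open>\<Oplus>X\<^bsup>(I\<^sub>X)\<^esup>\<close>. The pull-back of the first universal sequence along a row of the
  matrix is a combination of the first basis, hence equivalent to the corresponding member of the
  second one. The resulting maps \<open>M'\<^bsub>X,i\<^esub> \<rightarrow> Z\<close> induce a map \<open>Z' \<rightarrow> Z\<close> over \<open>g\<close> by the universal property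
  of the push-out, and the short five lemma applies.
  Computations in \<open>Ext\<^sup>1\<close> are reduced to pointwise computations with cocycles of
  set-theoretic sections, on which Baer sum and pull-back are addition and composition.\<close>

section \<open>Modules and homomorphisms\<close>

lemma left_module_abelian_group: "left_module R M \<Longrightarrow> abelian_group M"
  by (simp add: left_module_def)

lemma left_module_ring: "left_module R M \<Longrightarrow> ring R"
  by (simp add: left_module_def)

lemma left_moduleI:
  assumes "ring R"
    and "\<And>x y. x \<in> carrier M \<Longrightarrow> y \<in> carrier M \<Longrightarrow> x \<oplus>\<^bsub>M\<^esub> y \<in> carrier M"
    and "\<zero>\<^bsub>M\<^esub> \<in> carrier M"
    and "\<And>x y z. x \<in> carrier M \<Longrightarrow> y \<in> carrier M \<Longrightarrow> z \<in> carrier M \<Longrightarrow>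
      (x \<oplus>\<^bsub>M\<^esub> y) \<oplus>\<^bsub>M\<^esub> z = x \<oplus>\<^bsub>M\<^esub> (y \<oplus>\<^bsub>M\<^esub> z)"
    and "\<And>x y. x \<in> carrier M \<Longrightarrow> y \<in> carrier M \<Longrightarrow> x \<oplus>\<^bsub>M\<^esub> y = y \<oplus>\<^bsub>M\<^esub> x"
    and "\<And>x. x \<in> carrier M \<Longrightarrow> \<zero>\<^bsub>M\<^esub> \<oplus>\<^bsub>M\<^esub> x = x"
    and "\<And>x. x \<in> carrier M \<Longrightarrow> \<exists>y\<in>carrier M. y \<oplus>\<^bsub>M\<^esub> x = \<zero>\<^bsub>M\<^esub>"
    and "\<And>a x. a \<in> carrier R \<Longrightarrow> x \<in> carrier M \<Longrightarrow> a \<odot>\<^bsub>M\<^esub> x \<in> carrier M"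
    and "\<And>a b x. a \<in> carrier R \<Longrightarrow> b \<in> carrier R \<Longrightarrow> x \<in> carrier M \<Longrightarrow>
      (a \<oplus>\<^bsub>R\<^esub> b) \<odot>\<^bsub>M\<^esub> x = (a \<odot>\<^bsub>M\<^esub> x) \<oplus>\<^bsub>M\<^esub> (b \<odot>\<^bsub>M\<^esub> x)"
    and "\<And>a x y. a \<in> carrier R \<Longrightarrow> x \<in> carrier M \<Longrightarrow> y \<in> carrier M \<Longrightarrow>
      a \<odot>\<^bsub>M\<^esub> (x \<oplus>\<^bsub>M\<^esub> y) = (a \<odot>\<^bsub>M\<^esub> x) \<oplus>\<^bsub>M\<^esub> (a \<odot>\<^bsub>M\<^esub> y)"
    and "\<And>a b x. a \<in> carrier R \<Longrightarrow> b \<in> carrier R \<Longrightarrow> x \<in> carrier M \<Longrightarrow>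
      (a \<otimes>\<^bsub>R\<^esub> b) \<odot>\<^bsub>M\<^esub> x = a \<odot>\<^bsub>M\<^esub> (b \<odot>\<^bsub>M\<^esub> x)"
    and "\<And>x. x \<in> carrier M \<Longrightarrow> \<one>\<^bsub>R\<^esub> \<odot>\<^bsub>M\<^esub> x = x"
  shows "left_module R M"
  by (intro left_module.intro left_module_axioms.intro abelian_groupI)
    (use assms in auto)

lemma (in abelian_group) minus_eq_zeroD:
  assumes "x \<ominus> y = \<zero>" "x \<in> carrier G" "y \<in> carrier G"
  shows "x = y"
  using assms by (metis a_inv_closed minus_eq minus_equality minus_minus)

lemma (in abelian_group) minus_zero_zero: "\<ominus> \<zero> = \<zero>"
  by (rule minus_equality) auto

lemma left_module_zero_smult:
  assumes "left_module R M" "x \<in> carrier M"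
  shows "\<zero>\<^bsub>R\<^esub> \<odot>\<^bsub>M\<^esub> x = \<zero>\<^bsub>M\<^esub>"
proof -
  interpret left_module R M by fact
  have "(\<zero>\<^bsub>R\<^esub> \<oplus>\<^bsub>R\<^esub> \<zero>\<^bsub>R\<^esub>) \<odot>\<^bsub>M\<^esub> x = \<zero>\<^bsub>R\<^esub> \<odot>\<^bsub>M\<^esub> x" by simp
  then have "\<zero>\<^bsub>R\<^esub> \<odot>\<^bsub>M\<^esub> x \<oplus>\<^bsub>M\<^esub> \<zero>\<^bsub>R\<^esub> \<odot>\<^bsub>M\<^esub> x = \<zero>\<^bsub>R\<^esub> \<odot>\<^bsub>M\<^esub> x"
    using assms(2) by (subst (asm) smult_l_distr) auto
  then show ?thesis
    using assms(2) by (metis M.add.l_cancel_one' R.zero_closed smult_closed)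
qed

lemma left_module_smult_zero:
  assumes "left_module R M" "r \<in> carrier R"
  shows "r \<odot>\<^bsub>M\<^esub> \<zero>\<^bsub>M\<^esub> = \<zero>\<^bsub>M\<^esub>"
proof -
  interpret left_module R M by fact
  have "r \<odot>\<^bsub>M\<^esub> (\<zero>\<^bsub>M\<^esub> \<oplus>\<^bsub>M\<^esub> \<zero>\<^bsub>M\<^esub>) = r \<odot>\<^bsub>M\<^esub> \<zero>\<^bsub>M\<^esub>" by simp
  then have "r \<odot>\<^bsub>M\<^esub> \<zero>\<^bsub>M\<^esub> \<oplus>\<^bsub>M\<^esub> r \<odot>\<^bsub>M\<^esub> \<zero>\<^bsub>M\<^esub> = r \<odot>\<^bsub>M\<^esub> \<zero>\<^bsub>M\<^esub>"
    using assms(2) by (subst (asm) smult_r_distr) auto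
  then show ?thesis
    using assms(2) by (metis M.add.l_cancel_one' M.zero_closed smult_closed)
qed

lemma left_module_smult_minus:
  assumes "left_module R M" "r \<in> carrier R" "x \<in> carrier M"
  shows "r \<odot>\<^bsub>M\<^esub> (\<ominus>\<^bsub>M\<^esub> x) = \<ominus>\<^bsub>M\<^esub> (r \<odot>\<^bsub>M\<^esub> x)"
proof -
  interpret left_module R M by fact
  have "r \<odot>\<^bsub>M\<^esub> (\<ominus>\<^bsub>M\<^esub> x) \<oplus>\<^bsub>M\<^esub> r \<odot>\<^bsub>M\<^esub> x = r \<odot>\<^bsub>M\<^esub> (\<ominus>\<^bsub>M\<^esub> x \<oplus>\<^bsub>M\<^esub> x)"
    using assms by (simp add: smult_r_distr)
  also have "\<dots> = \<zero>\<^bsub>M\<^esub>"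
    using assms by (simp add: M.l_neg left_module_smult_zero)
  finally show ?thesis
    using assms by (metis M.a_inv_closed M.minus_equality smult_closed)
qed

lemma left_module_finsum_smult:
  assumes "left_module R M" "r \<in> carrier R" "f \<in> F \<rightarrow> carrier M"
  shows "r \<odot>\<^bsub>M\<^esub> (\<Oplus>\<^bsub>M\<^esub>i\<in>F. f i) = (\<Oplus>\<^bsub>M\<^esub>i\<in>F. r \<odot>\<^bsub>M\<^esub> f i)"
  using assms(3)
proof (induction F rule: infinite_finite_induct)
  case (infinite F)
  interpret left_module R M by fact
  show ?case using infinite assms(2) by (simp add: left_module_smult_zero[OF assms(1)])
next
  case empty
  interpret left_module R M by fact
  show ?case using assms(2) by (simp add: left_module_smult_zero[OF assms(1)])
next
  case (insert i F)
  interpret left_module R M by fact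
  have "f i \<in> carrier M" "f \<in> F \<rightarrow> carrier M" using insert.prems by auto
  moreover from this have "(\<lambda>i. r \<odot>\<^bsub>M\<^esub> f i) \<in> F \<rightarrow> carrier M" using assms(2) by auto
  ultimately show ?case using insert assms(2) by (simp add: smult_r_distr)
qed

lemma left_module_finsum_smult_left:
  assumes "left_module R M" "x \<in> carrier M" "f \<in> F \<rightarrow> carrier R"
  shows "(\<Oplus>\<^bsub>R\<^esub>i\<in>F. f i) \<odot>\<^bsub>M\<^esub> x = (\<Oplus>\<^bsub>M\<^esub>i\<in>F. f i \<odot>\<^bsub>M\<^esub> x)"
  using assms(3)
proof (induction F rule: infinite_finite_induct)
  case (infinite F)
  interpret left_module R M by fact
  show ?case using infinite assms(2) by (simp add: left_module_zero_smult[OF assms(1)])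
next
  case empty
  interpret left_module R M by fact
  show ?case using assms(2) by (simp add: left_module_zero_smult[OF assms(1)])
next
  case (insert i F)
  interpret left_module R M by fact
  have "f i \<in> carrier R" "f \<in> F \<rightarrow> carrier R" using insert.prems by auto
  moreover from this have "(\<lambda>i. f i \<odot>\<^bsub>M\<^esub> x) \<in> F \<rightarrow> carrier M" using assms(2) by auto
  ultimately show ?case using insert assms(2) by (simp add: smult_l_distr)
qed

lemma (in abelian_monoid) finsum_swap:
  assumes "finite A" "finite B" "\<And>i j. i \<in> A \<Longrightarrow> j \<in> B \<Longrightarrow> f i j \<in> carrier G"
  shows "(\<Oplus>i\<in>A. \<Oplus>j\<in>B. f i j) = (\<Oplus>j\<in>B. \<Oplus>i\<in>A. f i j)"
  using assms(1,3)
proof (induction A rule: finite_induct)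
  case empty
  then show ?case by (simp add: finsum_zero)
next
  case (insert i A)
  have c: "(\<lambda>i. \<Oplus>j\<in>B. f i j) \<in> A \<rightarrow> carrier G" "f i \<in> B \<rightarrow> carrier G" "(\<Oplus>j\<in>B. f i j) \<in> carrier G"
    "(\<lambda>j. \<Oplus>i\<in>A. f i j) \<in> B \<rightarrow> carrier G"
    using insert.prems by (auto intro!: finsum_closed)
  have "(\<Oplus>j\<in>B. \<Oplus>i\<in>insert i A. f i j) = (\<Oplus>j\<in>B. f i j \<oplus> (\<Oplus>i\<in>A. f i j))"
    using insert c by (intro finsum_cong') (auto intro!: finsum_insert finsum_closed a_closed)
  also have "\<dots> = (\<Oplus>j\<in>B. f i j) \<oplus> (\<Oplus>j\<in>B. \<Oplus>i\<in>A. f i j)"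
    using c by (simp add: finsum_addf)
  also have "\<dots> = (\<Oplus>j\<in>B. f i j) \<oplus> (\<Oplus>i\<in>A. \<Oplus>j\<in>B. f i j)"
    using insert by auto
  finally show ?case
    using insert c by (simp add: finsum_insert)
qed

lemma mod_hom_closed: "f \<in> mod_hom R M N \<Longrightarrow> x \<in> carrier M \<Longrightarrow> f x \<in> carrier N"
  and mod_hom_add: "f \<in> mod_hom R M N \<Longrightarrow> x \<in> carrier M \<Longrightarrow> y \<in> carrier M \<Longrightarrow>
    f (x \<oplus>\<^bsub>M\<^esub> y) = f x \<oplus>\<^bsub>N\<^esub> f y"
  and mod_hom_smult: "f \<in> mod_hom R M N \<Longrightarrow> r \<in> carrier R \<Longrightarrow> x \<in> carrier M \<Longrightarrow>
    f (r \<odot>\<^bsub>M\<^esub> x) = r \<odot>\<^bsub>N\<^esub> f x"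
  by (auto simp: mod_hom_def)

lemma mod_homI:
  assumes "left_module R M" "left_module R N"
    and "\<And>x. x \<in> carrier M \<Longrightarrow> f x \<in> carrier N"
    and lin: "\<And>r x y. r \<in> carrier R \<Longrightarrow> x \<in> carrier M \<Longrightarrow> y \<in> carrier M \<Longrightarrow>
      f (r \<odot>\<^bsub>M\<^esub> x \<oplus>\<^bsub>M\<^esub> y) = r \<odot>\<^bsub>N\<^esub> f x \<oplus>\<^bsub>N\<^esub> f y"
  shows "f \<in> mod_hom R M N"
proof -
  interpret M: left_module R M by fact
  interpret N: left_module R N by fact
  have add: "f (x \<oplus>\<^bsub>M\<^esub> y) = f x \<oplus>\<^bsub>N\<^esub> f y" if "x \<in> carrier M" "y \<in> carrier M" for x y
    using lin[of "\<one>\<^bsub>R\<^esub>" x y] that assms(3) by simp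
  have "f \<zero>\<^bsub>M\<^esub> \<oplus>\<^bsub>N\<^esub> f \<zero>\<^bsub>M\<^esub> = f \<zero>\<^bsub>M\<^esub>"
    using add[of "\<zero>\<^bsub>M\<^esub>" "\<zero>\<^bsub>M\<^esub>"] by simp
  then have zero: "f \<zero>\<^bsub>M\<^esub> = \<zero>\<^bsub>N\<^esub>"
    using assms(3) by (metis M.M.zero_closed N.M.add.l_cancel_one')
  have "f (r \<odot>\<^bsub>M\<^esub> x) = r \<odot>\<^bsub>N\<^esub> f x" if "r \<in> carrier R" "x \<in> carrier M" for r x
    using lin[of r x "\<zero>\<^bsub>M\<^esub>"] that assms(3) by (simp add: zero)
  with add assms(3) show ?thesis by (auto simp: mod_hom_def)
qed

lemma mod_hom_lin:
  assumes "left_module R M" "f \<in> mod_hom R M N" "r \<in> carrier R" "x \<in> carrier M" "y \<in> carrier M"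
  shows "f (r \<odot>\<^bsub>M\<^esub> x \<oplus>\<^bsub>M\<^esub> y) = r \<odot>\<^bsub>N\<^esub> f x \<oplus>\<^bsub>N\<^esub> f y"
  using assms by (simp add: mod_hom_add mod_hom_smult left_module.smult_closed)

lemma mod_hom_zero:
  assumes "left_module R M" "left_module R N" "f \<in> mod_hom R M N"
  shows "f \<zero>\<^bsub>M\<^esub> = \<zero>\<^bsub>N\<^esub>"
proof -
  interpret M: left_module R M by fact
  interpret N: left_module R N by fact
  have "f \<zero>\<^bsub>M\<^esub> \<oplus>\<^bsub>N\<^esub> f \<zero>\<^bsub>M\<^esub> = f \<zero>\<^bsub>M\<^esub>"
    using mod_hom_add[OF assms(3), of "\<zero>\<^bsub>M\<^esub>" "\<zero>\<^bsub>M\<^esub>"] by simp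
  then show ?thesis
    using mod_hom_closed[OF assms(3)] by (metis M.M.zero_closed N.M.add.l_cancel_one')
qed

lemma mod_hom_minus:
  assumes "left_module R M" "left_module R N" "f \<in> mod_hom R M N" "x \<in> carrier M"
  shows "f (\<ominus>\<^bsub>M\<^esub> x) = \<ominus>\<^bsub>N\<^esub> f x"
proof -
  interpret M: left_module R M by fact
  interpret N: left_module R N by fact
  have "f (\<ominus>\<^bsub>M\<^esub> x) \<oplus>\<^bsub>N\<^esub> f x = \<zero>\<^bsub>N\<^esub>"
    using assms mod_hom_add[OF assms(3), of "\<ominus>\<^bsub>M\<^esub> x" x] by (simp add: M.M.l_neg mod_hom_zero)
  then show ?thesis
    using assms mod_hom_closed[OF assms(3)] by (metis M.M.a_inv_closed N.M.minus_equality)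
qed

lemma mod_hom_finsum:
  assumes "left_module R M" "left_module R N" "h \<in> mod_hom R M N" "f \<in> F \<rightarrow> carrier M"
  shows "h (\<Oplus>\<^bsub>M\<^esub>i\<in>F. f i) = (\<Oplus>\<^bsub>N\<^esub>i\<in>F. h (f i))"
proof -
  interpret M: left_module R M by fact
  interpret N: left_module R N by fact
  show ?thesis
    using assms(4)
  proof (induction F rule: infinite_finite_induct)
    case (insert i F)
    have "f i \<in> carrier M" "f \<in> F \<rightarrow> carrier M" using insert.prems by auto
    moreover from this have "(\<lambda>i. h (f i)) \<in> F \<rightarrow> carrier N" "h (f i) \<in> carrier N"
      using assms(3) by (auto intro: mod_hom_closed)
    ultimately show ?case using insert by (simp add: mod_hom_add[OF assms(3)])
  qed (use assms in \<open>auto simp: mod_hom_zero\<close>)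
qed

lemma mod_hom_comp:
  assumes "f \<in> mod_hom R M N" "g \<in> mod_hom R N P"
  shows "(\<lambda>x. g (f x)) \<in> mod_hom R M P"
  using assms by (auto simp: mod_hom_def Pi_iff)

lemma mod_hom_inj_on:
  assumes "left_module R M" "left_module R N" "f \<in> mod_hom R M N"
    and "\<And>x. x \<in> carrier M \<Longrightarrow> f x = \<zero>\<^bsub>N\<^esub> \<Longrightarrow> x = \<zero>\<^bsub>M\<^esub>"
  shows "inj_on f (carrier M)"
proof (rule inj_onI)
  fix x y assume *: "x \<in> carrier M" "y \<in> carrier M" "f x = f y"
  interpret M: left_module R M by fact
  interpret N: left_module R N by fact
  have "f (x \<ominus>\<^bsub>M\<^esub> y) = \<zero>\<^bsub>N\<^esub>"
    using * assms mod_hom_closed[OF assms(3)]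
    by (simp add: M.M.minus_eq mod_hom_add[OF assms(3)] mod_hom_minus N.M.r_neg)
  then have "x \<ominus>\<^bsub>M\<^esub> y = \<zero>\<^bsub>M\<^esub>" using * assms(4) by blast
  then show "x = y" using * by (simp add: M.M.minus_eq_zeroD)
qed

lemma mod_isoI:
  assumes "f \<in> mod_hom R M N" "g \<in> carrier N \<rightarrow> carrier M"
    and "\<And>x. x \<in> carrier M \<Longrightarrow> g (f x) = x" "\<And>y. y \<in> carrier N \<Longrightarrow> f (g y) = y"
  shows "f \<in> mod_iso R M N"
  using assms by (auto simp: mod_iso_def mod_hom_def intro: bij_betwI[of _ _ _ g])

lemma mod_hom_factor:
  assumes "left_module R A" "left_module R B" "left_module R C"
    and p: "p \<in> mod_hom R A B" "p ` carrier A = carrier B" and f: "f \<in> mod_hom R A C"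
    and ker: "\<And>x. x \<in> carrier A \<Longrightarrow> p x = \<zero>\<^bsub>B\<^esub> \<Longrightarrow> f x = \<zero>\<^bsub>C\<^esub>"
  shows "\<exists>g\<in>mod_hom R B C. \<forall>x\<in>carrier A. g (p x) = f x"
proof -
  interpret A: left_module R A by fact
  interpret B: left_module R B by fact
  interpret C: left_module R C by fact
  have eq: "f x = f y" if "x \<in> carrier A" "y \<in> carrier A" "p x = p y" for x y
  proof -
    have "p (x \<ominus>\<^bsub>A\<^esub> y) = \<zero>\<^bsub>B\<^esub>"
      using that assms mod_hom_closed[OF p(1)]
      by (simp add: A.M.minus_eq mod_hom_add[OF p(1)] mod_hom_minus B.M.r_neg)
    then have "f (x \<ominus>\<^bsub>A\<^esub> y) = \<zero>\<^bsub>C\<^esub>" using that ker by simp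
    then have "f x \<ominus>\<^bsub>C\<^esub> f y = \<zero>\<^bsub>C\<^esub>"
      using that assms by (simp add: A.M.minus_eq C.M.minus_eq mod_hom_add[OF f] mod_hom_minus)
    then show ?thesis using that mod_hom_closed[OF f] by (simp add: C.M.minus_eq_zeroD)
  qed
  define g where "g = (\<lambda>b. f (inv_into (carrier A) p b))"
  have gp: "g (p x) = f x" if "x \<in> carrier A" for x
    unfolding g_def using that by (intro eq) (auto intro: inv_into_into f_inv_into_f)
  have "g \<in> mod_hom R B C"
  proof (rule mod_homI[OF assms(2,3)])
    fix b assume "b \<in> carrier B"
    then obtain x where "x \<in> carrier A" "b = p x" using p(2) by blast
    then show "g b \<in> carrier C" by (simp add: gp mod_hom_closed[OF f])
  next
    fix r b b' assume *: "r \<in> carrier R" "b \<in> carrier B" "b' \<in> carrier B"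
    then obtain x x' where x: "x \<in> carrier A" "b = p x" "x' \<in> carrier A" "b' = p x'"
      using p(2) by blast
    have "g (r \<odot>\<^bsub>B\<^esub> b \<oplus>\<^bsub>B\<^esub> b') = g (p (r \<odot>\<^bsub>A\<^esub> x \<oplus>\<^bsub>A\<^esub> x'))"
      using x * by (simp add: mod_hom_lin[OF assms(1) p(1)])
    also have "\<dots> = f (r \<odot>\<^bsub>A\<^esub> x \<oplus>\<^bsub>A\<^esub> x')" using x * by (simp add: gp)
    also have "\<dots> = r \<odot>\<^bsub>C\<^esub> g b \<oplus>\<^bsub>C\<^esub> g b'"
      using x * by (simp add: gp mod_hom_lin[OF assms(1) f])
    finally show "g (r \<odot>\<^bsub>B\<^esub> b \<oplus>\<^bsub>B\<^esub> b') = r \<odot>\<^bsub>C\<^esub> g b \<oplus>\<^bsub>C\<^esub> g b'" .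
  qed
  with gp show ?thesis by blast
qed

lemma left_module_image:
  assumes M: "left_module R M" and surj: "j ` carrier M = carrier Q"
    and add: "\<And>x y. x \<in> carrier M \<Longrightarrow> y \<in> carrier M \<Longrightarrow> j (x \<oplus>\<^bsub>M\<^esub> y) = j x \<oplus>\<^bsub>Q\<^esub> j y"
    and smult: "\<And>r x. r \<in> carrier R \<Longrightarrow> x \<in> carrier M \<Longrightarrow> j (r \<odot>\<^bsub>M\<^esub> x) = r \<odot>\<^bsub>Q\<^esub> j x"
    and zero: "j \<zero>\<^bsub>M\<^esub> = \<zero>\<^bsub>Q\<^esub>"
  shows "left_module R Q" "j \<in> mod_hom R M Q"
proof -
  interpret left_module R M by fact
  have ex: "\<exists>x\<in>carrier M. q = j x" if "q \<in> carrier Q" for q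
    using that surj by blast
  have cl: "j x \<in> carrier Q" if "x \<in> carrier M" for x
    using that surj by blast
  show "j \<in> mod_hom R M Q"
    using add smult cl by (auto simp: mod_hom_def)
  show "left_module R Q"
  proof (rule left_moduleI)
    show "ring R" by (rule R.ring_axioms)
    show "\<zero>\<^bsub>Q\<^esub> \<in> carrier Q" using cl[of "\<zero>\<^bsub>M\<^esub>"] zero by simp
  next
    fix x assume "x \<in> carrier Q"
    then obtain a where a: "a \<in> carrier M" "x = j a" using ex by blast
    show "\<exists>y\<in>carrier Q. y \<oplus>\<^bsub>Q\<^esub> x = \<zero>\<^bsub>Q\<^esub>"
      using a cl[of "\<ominus>\<^bsub>M\<^esub> a"] add[of "\<ominus>\<^bsub>M\<^esub> a" a] zero by (auto simp: M.l_neg)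
  qed (use cl in \<open>auto dest!: ex simp: add[symmetric] smult[symmetric] zero[symmetric]
         M.a_ac smult_l_distr smult_r_distr smult_assoc\<close>)
qed

section \<open>Products, pull-backs, quotients and direct sums\<close>

lemma left_module_prod:
  assumes "left_module R M" "left_module R N"
  shows "left_module R (prod_module M N)"
proof -
  interpret M: left_module R M by fact
  interpret N: left_module R N by fact
  show ?thesis
  proof (rule left_moduleI)
    show "ring R" by (rule M.R.ring_axioms)
  next
    fix x assume "x \<in> carrier (prod_module M N)"
    then show "\<exists>y\<in>carrier (prod_module M N). y \<oplus>\<^bsub>prod_module M N\<^esub> x = \<zero>\<^bsub>prod_module M N\<^esub>"
      by (intro bexI[of _ "(\<ominus>\<^bsub>M\<^esub> fst x, \<ominus>\<^bsub>N\<^esub> snd x)"])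
        (auto simp: prod_module_def M.M.l_neg N.M.l_neg)
  qed (auto simp: prod_module_def M.M.a_ac N.M.a_ac M.smult_l_distr N.smult_l_distr
         M.smult_r_distr N.smult_r_distr M.smult_assoc N.smult_assoc)
qed

lemma prod_module_simps [simp]:
  "carrier (prod_module M N) = carrier M \<times> carrier N"
  "\<zero>\<^bsub>prod_module M N\<^esub> = (\<zero>\<^bsub>M\<^esub>, \<zero>\<^bsub>N\<^esub>)"
  "(a, b) \<oplus>\<^bsub>prod_module M N\<^esub> (a', b') = (a \<oplus>\<^bsub>M\<^esub> a', b \<oplus>\<^bsub>N\<^esub> b')"
  "r \<odot>\<^bsub>prod_module M N\<^esub> (a, b) = (r \<odot>\<^bsub>M\<^esub> a, r \<odot>\<^bsub>N\<^esub> b)"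
  by (simp_all add: prod_module_def)

lemma prod_module_minus:
  assumes "left_module R M" "left_module R N" "a \<in> carrier M" "b \<in> carrier N"
  shows "\<ominus>\<^bsub>prod_module M N\<^esub> (a, b) = (\<ominus>\<^bsub>M\<^esub> a, \<ominus>\<^bsub>N\<^esub> b)"
proof -
  interpret M: left_module R M by fact
  interpret N: left_module R N by fact
  interpret P: left_module R "prod_module M N" by (rule left_module_prod) fact+
  show ?thesis
    using assms by (intro P.M.minus_equality) (simp_all add: M.M.l_neg N.M.l_neg)
qed

lemma pullback_module_simps [simp]:
  "carrier (pullback_module A B f g) = {(a, b). a \<in> carrier A \<and> b \<in> carrier B \<and> f a = g b}"
  "\<zero>\<^bsub>pullback_module A B f g\<^esub> = (\<zero>\<^bsub>A\<^esub>, \<zero>\<^bsub>B\<^esub>)"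
  "(a, b) \<oplus>\<^bsub>pullback_module A B f g\<^esub> (a', b') = (a \<oplus>\<^bsub>A\<^esub> a', b \<oplus>\<^bsub>B\<^esub> b')"
  "r \<odot>\<^bsub>pullback_module A B f g\<^esub> (a, b) = (r \<odot>\<^bsub>A\<^esub> a, r \<odot>\<^bsub>B\<^esub> b)"
  by (simp_all add: pullback_module_def prod_module_def)

lemma left_module_pullback:
  assumes "left_module R A" "left_module R B" "left_module R C"
    and f: "f \<in> mod_hom R A C" and g: "g \<in> mod_hom R B C"
  shows "left_module R (pullback_module A B f g)"
proof -
  interpret A: left_module R A by fact
  interpret B: left_module R B by fact
  interpret C: left_module R C by fact
  note [simp] = mod_hom_zero[OF assms(1,3) f] mod_hom_zero[OF assms(2,3) g]
    mod_hom_add[OF f] mod_hom_add[OF g] mod_hom_smult[OF f] mod_hom_smult[OF g]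
    mod_hom_minus[OF assms(1,3) f] mod_hom_minus[OF assms(2,3) g]
  show ?thesis
  proof (rule left_moduleI)
    show "ring R" by (rule A.R.ring_axioms)
  next
    fix x assume "x \<in> carrier (pullback_module A B f g)"
    then show "\<exists>y\<in>carrier (pullback_module A B f g).
      y \<oplus>\<^bsub>pullback_module A B f g\<^esub> x = \<zero>\<^bsub>pullback_module A B f g\<^esub>"
      by (intro bexI[of _ "(\<ominus>\<^bsub>A\<^esub> fst x, \<ominus>\<^bsub>B\<^esub> snd x)"])
        (auto simp: A.M.l_neg B.M.l_neg)
  qed (auto simp: A.M.a_ac B.M.a_ac A.smult_l_distr B.smult_l_distr
         A.smult_r_distr B.smult_r_distr A.smult_assoc B.smult_assoc)
qed

lemma quotient_module_proj:
  assumes M: "left_module R M"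
    and N: "N \<subseteq> carrier M" "\<zero>\<^bsub>M\<^esub> \<in> N"
      "\<And>x y. x \<in> N \<Longrightarrow> y \<in> N \<Longrightarrow> x \<oplus>\<^bsub>M\<^esub> y \<in> N"
      "\<And>r x. r \<in> carrier R \<Longrightarrow> x \<in> N \<Longrightarrow> r \<odot>\<^bsub>M\<^esub> x \<in> N"
      "\<And>x. x \<in> N \<Longrightarrow> \<ominus>\<^bsub>M\<^esub> x \<in> N"
  defines "j \<equiv> \<lambda>m. N +>\<^bsub>M\<^esub> m"
  shows "left_module R (quotient_module M N)" "j \<in> mod_hom R M (quotient_module M N)"
    "j ` carrier M = carrier (quotient_module M N)"
    "\<And>m. m \<in> carrier M \<Longrightarrow> j m = \<zero>\<^bsub>quotient_module M N\<^esub> \<longleftrightarrow> m \<in> N"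
    "\<And>m. m \<in> carrier M \<Longrightarrow> j m = (\<lambda>n. n \<oplus>\<^bsub>M\<^esub> m) ` N"
proof -
  interpret M: left_module R M by fact
  have "subgroup N (add_monoid M)"
    using N by (intro M.M.add.subgroupI) (auto simp: a_inv_def[symmetric])
  then interpret N: abelian_subgroup N M
    by (intro abelian_subgroupI3 additive_subgroupI M.M.abelian_group_axioms)
  show j: "j m = (\<lambda>n. n \<oplus>\<^bsub>M\<^esub> m) ` N" for m
    by (auto simp: j_def a_r_coset_def')
  show surj: "j ` carrier M = carrier (quotient_module M N)"
    by (auto simp: j_def quotient_module_def A_RCOSETS_def')
  have j_eq: "j m = j m'" if "m' \<in> j m" "m \<in> carrier M" for m m'
    unfolding j_def using that M.M.a_repr_independence[of m' N m] \<open>subgroup N (add_monoid M)\<close>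
    by (simp add: j_def)
  have self: "m \<in> j m" if "m \<in> carrier M" for m
    using that N by (auto simp: j intro!: image_eqI[of _ _ "\<zero>\<^bsub>M\<^esub>"])
  have add: "j (x \<oplus>\<^bsub>M\<^esub> y) = j x \<oplus>\<^bsub>quotient_module M N\<^esub> j y" if "x \<in> carrier M" "y \<in> carrier M" for x y
    using that by (simp add: j_def quotient_module_def N.a_rcos_sum)
  have smult: "j (r \<odot>\<^bsub>M\<^esub> x) = r \<odot>\<^bsub>quotient_module M N\<^esub> j x" if "r \<in> carrier R" "x \<in> carrier M" for r x
  proof -
    have "j (r \<odot>\<^bsub>M\<^esub> m) = j (r \<odot>\<^bsub>M\<^esub> x)" if m: "m \<in> j x" for m
    proof -
      obtain n where n: "n \<in> N" "m = n \<oplus>\<^bsub>M\<^esub> x" using m by (auto simp: j)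
      then have "n \<in> carrier M" using N by auto
      then have "r \<odot>\<^bsub>M\<^esub> m = r \<odot>\<^bsub>M\<^esub> n \<oplus>\<^bsub>M\<^esub> r \<odot>\<^bsub>M\<^esub> x"
        using n that \<open>r \<in> _\<close> \<open>x \<in> _\<close> by (simp add: M.smult_r_distr)
      then have "r \<odot>\<^bsub>M\<^esub> m \<in> j (r \<odot>\<^bsub>M\<^esub> x)"
        using n \<open>r \<in> _\<close> by (auto simp: j N)
      then show ?thesis using j_eq \<open>r \<in> _\<close> \<open>x \<in> _\<close> by (metis M.smult_closed)
    qed
    then have "(\<Union>m\<in>j x. j (r \<odot>\<^bsub>M\<^esub> m)) = (\<Union>m\<in>j x. j (r \<odot>\<^bsub>M\<^esub> x))"
      by (intro SUP_cong refl)
    also have "\<dots> = j (r \<odot>\<^bsub>M\<^esub> x)"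
      using self[OF that(2)] by blast
    finally have "(\<Union>m\<in>j x. j (r \<odot>\<^bsub>M\<^esub> m)) = j (r \<odot>\<^bsub>M\<^esub> x)" .
    then show ?thesis by (simp add: quotient_module_def j_def)
  qed
  have zero: "j \<zero>\<^bsub>M\<^esub> = \<zero>\<^bsub>quotient_module M N\<^esub>"
    using N(1) by (auto simp: j quotient_module_def subset_iff image_iff)
  show "left_module R (quotient_module M N)" "j \<in> mod_hom R M (quotient_module M N)"
    using left_module_image[OF M surj add smult zero] by auto
  show "j m = \<zero>\<^bsub>quotient_module M N\<^esub> \<longleftrightarrow> m \<in> N" if "m \<in> carrier M" for m
  proof
    assume "j m = \<zero>\<^bsub>quotient_module M N\<^esub>"
    then show "m \<in> N" using self[OF that] by (simp add: quotient_module_def)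
  next
    assume "m \<in> N"
    moreover have "j \<zero>\<^bsub>M\<^esub> = N" using zero by (simp add: quotient_module_def)
    ultimately show "j m = \<zero>\<^bsub>quotient_module M N\<^esub>" using j_eq[of m "\<zero>\<^bsub>M\<^esub>"] zero by auto
  qed
qed

lemma direct_sum_simps [simp]:
  "carrier (direct_sum J M) = {x \<in> (\<Pi>\<^sub>E j\<in>J. carrier (M j)). finite {j \<in> J. x j \<noteq> \<zero>\<^bsub>M j\<^esub>}}"
  "\<zero>\<^bsub>direct_sum J M\<^esub> = (\<lambda>j\<in>J. \<zero>\<^bsub>M j\<^esub>)"
  "x \<oplus>\<^bsub>direct_sum J M\<^esub> y = (\<lambda>j\<in>J. x j \<oplus>\<^bsub>M j\<^esub> y j)"
  "r \<odot>\<^bsub>direct_sum J M\<^esub> x = (\<lambda>j\<in>J. r \<odot>\<^bsub>M j\<^esub> x j)"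
  by (simp_all add: direct_sum_def)

lemma left_module_direct_sum:
  assumes "ring R" "\<And>j. j \<in> J \<Longrightarrow> left_module R (M j)"
  shows "left_module R (direct_sum J M)"
proof (rule left_moduleI)
  note ag = left_module_abelian_group[OF assms(2)]
  note ag_simps = abelian_groupE(1,2,3,5)[OF ag] abelian_group.a_inv_closed[OF ag]
    abelian_group.l_neg[OF ag] left_module.smult_closed[OF assms(2)]
    left_module.smult_l_distr[OF assms(2)] left_module.smult_r_distr[OF assms(2)]
    left_module.smult_assoc[OF assms(2)] left_module.smult_one[OF assms(2)]
  have pt: "x j \<in> carrier (M j)" if "x \<in> carrier (direct_sum J M)" "j \<in> J" for x j
    using that by (auto simp: PiE_iff)
  have fin: "finite {j \<in> J. x j \<noteq> \<zero>\<^bsub>M j\<^esub>}" if "x \<in> carrier (direct_sum J M)" for x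
    using that by simp
  have ext: "restrict x J = x" if "x \<in> carrier (direct_sum J M)" for x
    using that by (auto simp: PiE_iff extensional_restrict)
  show "ring R" by fact
  show "\<zero>\<^bsub>direct_sum J M\<^esub> \<in> carrier (direct_sum J M)"
    using abelian_groupE(2)[OF ag] by auto
  fix x assume x: "x \<in> carrier (direct_sum J M)"
  show "\<zero>\<^bsub>direct_sum J M\<^esub> \<oplus>\<^bsub>direct_sum J M\<^esub> x = x"
    using ext[OF x] pt[OF x] by (simp add: ag_simps cong: restrict_cong)
  show "\<one>\<^bsub>R\<^esub> \<odot>\<^bsub>direct_sum J M\<^esub> x = x"
    using ext[OF x] pt[OF x] by (simp add: ag_simps cong: restrict_cong)
  have "{j \<in> J. (\<lambda>j\<in>J. \<ominus>\<^bsub>M j\<^esub> x j) j \<noteq> \<zero>\<^bsub>M j\<^esub>} \<subseteq> {j \<in> J. x j \<noteq> \<zero>\<^bsub>M j\<^esub>}"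
    using abelian_group.minus_zero_zero[OF ag] by auto
  then have "(\<lambda>j\<in>J. \<ominus>\<^bsub>M j\<^esub> x j) \<in> carrier (direct_sum J M)"
    using finite_subset[OF _ fin[OF x]] pt[OF x] by (simp add: PiE_iff ag_simps)
  then show "\<exists>y\<in>carrier (direct_sum J M). y \<oplus>\<^bsub>direct_sum J M\<^esub> x = \<zero>\<^bsub>direct_sum J M\<^esub>"
    by (rule bexI[rotated]) (use pt[OF x] in \<open>simp add: ag_simps cong: restrict_cong\<close>)
  show "(a \<oplus>\<^bsub>R\<^esub> b) \<odot>\<^bsub>direct_sum J M\<^esub> x =
      a \<odot>\<^bsub>direct_sum J M\<^esub> x \<oplus>\<^bsub>direct_sum J M\<^esub> b \<odot>\<^bsub>direct_sum J M\<^esub> x"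
    and "(a \<otimes>\<^bsub>R\<^esub> b) \<odot>\<^bsub>direct_sum J M\<^esub> x = a \<odot>\<^bsub>direct_sum J M\<^esub> (b \<odot>\<^bsub>direct_sum J M\<^esub> x)"
    if "a \<in> carrier R" "b \<in> carrier R" for a b
    using that pt[OF x] by (simp_all add: ag_simps cong: restrict_cong)
  show "r \<odot>\<^bsub>direct_sum J M\<^esub> x \<in> carrier (direct_sum J M)" if r: "r \<in> carrier R" for r
  proof -
    have "{j \<in> J. (\<lambda>j\<in>J. r \<odot>\<^bsub>M j\<^esub> x j) j \<noteq> \<zero>\<^bsub>M j\<^esub>} \<subseteq> {j \<in> J. x j \<noteq> \<zero>\<^bsub>M j\<^esub>}"
      using r by (auto simp: left_module_smult_zero[OF assms(2)])
    then show ?thesis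
      using finite_subset[OF _ fin[OF x]] pt[OF x] r by (simp add: PiE_iff ag_simps)
  qed
  fix y assume y: "y \<in> carrier (direct_sum J M)"
  have "{j \<in> J. (\<lambda>j\<in>J. x j \<oplus>\<^bsub>M j\<^esub> y j) j \<noteq> \<zero>\<^bsub>M j\<^esub>}
      \<subseteq> {j \<in> J. x j \<noteq> \<zero>\<^bsub>M j\<^esub>} \<union> {j \<in> J. y j \<noteq> \<zero>\<^bsub>M j\<^esub>}"
    by (auto simp: ag_simps)
  then show "x \<oplus>\<^bsub>direct_sum J M\<^esub> y \<in> carrier (direct_sum J M)"
    using finite_subset[OF _ finite_UnI[OF fin[OF x] fin[OF y]]] pt[OF x] pt[OF y]
    by (simp add: PiE_iff ag_simps)
  show "x \<oplus>\<^bsub>direct_sum J M\<^esub> y = y \<oplus>\<^bsub>direct_sum J M\<^esub> x"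
    using pt[OF x] pt[OF y] abelian_groupE(4)[OF ag] by (auto intro!: restrict_ext)
  show "r \<odot>\<^bsub>direct_sum J M\<^esub> (x \<oplus>\<^bsub>direct_sum J M\<^esub> y) =
      r \<odot>\<^bsub>direct_sum J M\<^esub> x \<oplus>\<^bsub>direct_sum J M\<^esub> r \<odot>\<^bsub>direct_sum J M\<^esub> y" if "r \<in> carrier R" for r
    using that pt[OF x] pt[OF y] by (simp add: ag_simps cong: restrict_cong)
  show "(x \<oplus>\<^bsub>direct_sum J M\<^esub> y) \<oplus>\<^bsub>direct_sum J M\<^esub> z =
      x \<oplus>\<^bsub>direct_sum J M\<^esub> (y \<oplus>\<^bsub>direct_sum J M\<^esub> z)" if z: "z \<in> carrier (direct_sum J M)" for z
    using pt[OF x] pt[OF y] pt[OF z] by (simp add: ag_simps cong: restrict_cong)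
qed

definition direct_sum_inj :: "'j set \<Rightarrow> ('j \<Rightarrow> ('r, 'a) module) \<Rightarrow> 'j \<Rightarrow> 'a \<Rightarrow> 'j \<Rightarrow> 'a" where
  "direct_sum_inj J M j x = (\<lambda>k\<in>J. if k = j then x else \<zero>\<^bsub>M k\<^esub>)"

definition direct_sum_map ::
  "'j set \<Rightarrow> ('j \<Rightarrow> ('r, 'a) module) \<Rightarrow> ('r, 'b) module \<Rightarrow> ('j \<Rightarrow> 'a \<Rightarrow> 'b) \<Rightarrow> ('j \<Rightarrow> 'a) \<Rightarrow> 'b" where
  "direct_sum_map J M N h x = (\<Oplus>\<^bsub>N\<^esub>j\<in>{j \<in> J. x j \<noteq> \<zero>\<^bsub>M j\<^esub>}. h j (x j))"

lemma direct_sum_inj_hom: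
  assumes "ring R" "\<And>j. j \<in> J \<Longrightarrow> left_module R (M j)" "j \<in> J"
  shows "direct_sum_inj J M j \<in> mod_hom R (M j) (direct_sum J M)"
proof (rule mod_homI)
  show "left_module R (M j)" using assms by auto
  show "left_module R (direct_sum J M)" by (rule left_module_direct_sum[OF assms(1,2)])
next
  fix x assume "x \<in> carrier (M j)"
  moreover have "{k \<in> J. direct_sum_inj J M j x k \<noteq> \<zero>\<^bsub>M k\<^esub>} \<subseteq> {j}"
    by (auto simp: direct_sum_inj_def)
  then have "finite {k \<in> J. direct_sum_inj J M j x k \<noteq> \<zero>\<^bsub>M k\<^esub>}"
    by (rule finite_subset) simp
  ultimately show "direct_sum_inj J M j x \<in> carrier (direct_sum J M)"
    using abelian_groupE(2)[OF left_module_abelian_group[OF assms(2)]]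
    by (simp add: PiE_iff) (auto simp: direct_sum_inj_def)
next
  fix r x y assume "r \<in> carrier R" "x \<in> carrier (M j)" "y \<in> carrier (M j)"
  then show "direct_sum_inj J M j (r \<odot>\<^bsub>M j\<^esub> x \<oplus>\<^bsub>M j\<^esub> y) =
    r \<odot>\<^bsub>direct_sum J M\<^esub> direct_sum_inj J M j x \<oplus>\<^bsub>direct_sum J M\<^esub> direct_sum_inj J M j y"
    using abelian_groupE(2,4)[OF left_module_abelian_group[OF assms(2)]]
    by (auto simp: direct_sum_inj_def left_module_smult_zero[OF assms(2)]
      abelian_groupE(5)[OF left_module_abelian_group[OF assms(2)]] intro!: restrict_ext)
qed

lemma direct_sum_map_eq:
  assumes "left_module R N" "\<And>j. j \<in> J \<Longrightarrow> left_module R (M j)"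
    and "\<And>j. j \<in> J \<Longrightarrow> h j \<in> mod_hom R (M j) N" "x \<in> (\<Pi> j\<in>J. carrier (M j))"
    and "finite F" "F \<subseteq> J" "{j \<in> J. x j \<noteq> \<zero>\<^bsub>M j\<^esub>} \<subseteq> F"
  shows "direct_sum_map J M N h x = (\<Oplus>\<^bsub>N\<^esub>j\<in>F. h j (x j))"
proof -
  interpret N: left_module R N by fact
  show ?thesis
    unfolding direct_sum_map_def
    using assms by (intro N.M.add.finprod_mono_neutral_cong_left)
      (auto simp: Pi_iff mod_hom_zero[OF assms(2,1)] intro!: mod_hom_closed[OF assms(3)])
qed

lemma direct_sum_map_hom:
  assumes "ring R" "left_module R N" "\<And>j. j \<in> J \<Longrightarrow> left_module R (M j)"
    and h: "\<And>j. j \<in> J \<Longrightarrow> h j \<in> mod_hom R (M j) N"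
  shows "direct_sum_map J M N h \<in> mod_hom R (direct_sum J M) N"
proof (rule mod_homI)
  show D: "left_module R (direct_sum J M)" by (rule left_module_direct_sum[OF assms(1,3)])
  show "left_module R N" by fact
  interpret N: left_module R N by fact
  interpret D: left_module R "direct_sum J M" by (rule D)
  show "direct_sum_map J M N h x \<in> carrier N" if "x \<in> carrier (direct_sum J M)" for x
    using that unfolding direct_sum_map_def by (intro N.M.finsum_closed) (auto intro: mod_hom_closed[OF h])
  fix r x y
  assume r: "r \<in> carrier R" and x: "x \<in> carrier (direct_sum J M)" and y: "y \<in> carrier (direct_sum J M)"
  define z where "z = r \<odot>\<^bsub>direct_sum J M\<^esub> x \<oplus>\<^bsub>direct_sum J M\<^esub> y"
  have z: "z \<in> carrier (direct_sum J M)" unfolding z_def using r x y D.smult_closed D.M.a_closed by blast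
  define F where "F = {j \<in> J. x j \<noteq> \<zero>\<^bsub>M j\<^esub>} \<union> {j \<in> J. y j \<noteq> \<zero>\<^bsub>M j\<^esub>} \<union> {j \<in> J. z j \<noteq> \<zero>\<^bsub>M j\<^esub>}"
  have eq: "direct_sum_map J M N h w = (\<Oplus>\<^bsub>N\<^esub>j\<in>F. h j (w j))"
    if "w \<in> {x, y, z}" for w
    using that x y z by (intro direct_sum_map_eq[OF assms(2,3) h]) (auto simp: F_def)
  have cl: "(\<lambda>j. h j (x j)) \<in> F \<rightarrow> carrier N" "(\<lambda>j. h j (y j)) \<in> F \<rightarrow> carrier N"
    using x y by (auto simp: F_def intro!: mod_hom_closed[OF h])
  have pt: "j \<in> J \<and> x j \<in> carrier (M j) \<and> y j \<in> carrier (M j)" if "j \<in> F" for j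
    using that x y by (auto simp: F_def PiE_iff)
  have "h j (z j) = r \<odot>\<^bsub>N\<^esub> h j (x j) \<oplus>\<^bsub>N\<^esub> h j (y j)" if "j \<in> F" for j
    using pt[OF that] r by (simp add: z_def mod_hom_lin[OF assms(3) h])
  then have "direct_sum_map J M N h z = (\<Oplus>\<^bsub>N\<^esub>j\<in>F. r \<odot>\<^bsub>N\<^esub> h j (x j) \<oplus>\<^bsub>N\<^esub> h j (y j))"
    using pt r by (subst eq, simp, intro N.M.finsum_cong') (auto intro!: mod_hom_closed[OF h])
  also have "\<dots> = r \<odot>\<^bsub>N\<^esub> (\<Oplus>\<^bsub>N\<^esub>j\<in>F. h j (x j)) \<oplus>\<^bsub>N\<^esub> (\<Oplus>\<^bsub>N\<^esub>j\<in>F. h j (y j))"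
    using cl r by (subst N.M.finsum_addf) (auto simp: left_module_finsum_smult[OF assms(2)])
  finally show "direct_sum_map J M N h (r \<odot>\<^bsub>direct_sum J M\<^esub> x \<oplus>\<^bsub>direct_sum J M\<^esub> y) =
    r \<odot>\<^bsub>N\<^esub> direct_sum_map J M N h x \<oplus>\<^bsub>N\<^esub> direct_sum_map J M N h y"
    unfolding z_def[symmetric] using eq by simp
qed

lemma direct_sum_map_inj:
  assumes "left_module R N" "\<And>j. j \<in> J \<Longrightarrow> left_module R (M j)"
    and h: "\<And>j. j \<in> J \<Longrightarrow> h j \<in> mod_hom R (M j) N" and "j \<in> J" "x \<in> carrier (M j)"
  shows "direct_sum_map J M N h (direct_sum_inj J M j x) = h j x"
proof -
  interpret N: left_module R N by fact
  have "direct_sum_map J M N h (direct_sum_inj J M j x) = (\<Oplus>\<^bsub>N\<^esub>k\<in>{j}. h k (direct_sum_inj J M j x k))"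
    using assms(4,5) abelian_groupE(2)[OF left_module_abelian_group[OF assms(2)]]
    by (intro direct_sum_map_eq[OF assms(1-2) h]) (auto simp: direct_sum_inj_def)
  then show ?thesis
    using assms(4,5) mod_hom_closed[OF h] by (simp add: direct_sum_inj_def)
qed

lemma direct_sum_finsum_apply:
  assumes "ring R" "\<And>j. j \<in> J \<Longrightarrow> left_module R (M j)" "finite F"
    and "f \<in> F \<rightarrow> carrier (direct_sum J M)" "k \<in> J"
  shows "(\<Oplus>\<^bsub>direct_sum J M\<^esub>i\<in>F. f i) k = (\<Oplus>\<^bsub>M k\<^esub>i\<in>F. f i k)"
proof -
  interpret D: left_module R "direct_sum J M" by (rule left_module_direct_sum[OF assms(1,2)])
  interpret K: left_module R "M k" using assms by auto
  show ?thesis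
    using assms(3,4)
  proof (induction F rule: finite_induct)
    case (insert i F)
    have *: "f i \<in> carrier (direct_sum J M)" "f \<in> F \<rightarrow> carrier (direct_sum J M)"
      using insert.prems by auto
    have "f i k \<in> carrier (M k)" "(\<lambda>i. f i k) \<in> F \<rightarrow> carrier (M k)"
      using * \<open>k \<in> J\<close> by (auto simp: Pi_iff)
    with * insert \<open>k \<in> J\<close> show ?case
      by (simp add: D.M.finsum_insert del: direct_sum_simps(1))
  qed (use \<open>k \<in> J\<close> in auto)
qed

lemma direct_sum_decomp:
  assumes "ring R" "\<And>j. j \<in> J \<Longrightarrow> left_module R (M j)" "x \<in> carrier (direct_sum J M)"
  shows "x = (\<Oplus>\<^bsub>direct_sum J M\<^esub>j\<in>{j \<in> J. x j \<noteq> \<zero>\<^bsub>M j\<^esub>}. direct_sum_inj J M j (x j))"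
    (is "x = ?s")
proof -
  interpret D: left_module R "direct_sum J M" by (rule left_module_direct_sum[OF assms(1,2)])
  define F where "F = {j \<in> J. x j \<noteq> \<zero>\<^bsub>M j\<^esub>}"
  have F: "finite F" "F \<subseteq> J" using assms(3) by (auto simp: F_def)
  have xc: "x j \<in> carrier (M j)" if "j \<in> J" for j using that assms(3) by (auto simp: PiE_iff)
  have cl: "(\<lambda>j. direct_sum_inj J M j (x j)) \<in> F \<rightarrow> carrier (direct_sum J M)"
    using F xc by (intro Pi_I mod_hom_closed[OF direct_sum_inj_hom[OF assms(1,2)]]) auto
  then have s: "?s \<in> carrier (direct_sum J M)"
    unfolding F_def[symmetric] by (rule D.M.finsum_closed)
  show ?thesis
  proof (rule extensionalityI)
    show "x \<in> extensional J" using assms(3) by (auto simp: PiE_iff)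
    show "?s \<in> extensional J" using s by (auto simp: PiE_iff)
    fix k assume k: "k \<in> J"
    interpret K: left_module R "M k" using assms k by auto
    have "?s k = (\<Oplus>\<^bsub>M k\<^esub>j\<in>F. direct_sum_inj J M j (x j) k)"
      using direct_sum_finsum_apply[OF assms(1,2) F(1) cl k] by (simp add: F_def)
    also have "\<dots> = (\<Oplus>\<^bsub>M k\<^esub>j\<in>F. if k = j then x k else \<zero>\<^bsub>M k\<^esub>)"
      using k xc by (intro K.M.finsum_cong') (auto simp: direct_sum_inj_def)
    also have "\<dots> = x k"
    proof (cases "k \<in> F")
      case True
      then show ?thesis
        using K.M.finsum_singleton[of k F "\<lambda>_. x k"] F xc[OF k] by auto
    next
      case False
      then have "(\<Oplus>\<^bsub>M k\<^esub>j\<in>F. if k = j then x k else \<zero>\<^bsub>M k\<^esub>) = (\<Oplus>\<^bsub>M k\<^esub>j\<in>F. \<zero>\<^bsub>M k\<^esub>)"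
        by (intro K.M.finsum_cong') auto
      then show ?thesis using False k by (simp add: F_def K.M.finsum_zero)
    qed
    finally show "x k = ?s k" by simp
  qed
qed

lemma direct_sum_hom_eqI:
  assumes "ring R" "\<And>j. j \<in> J \<Longrightarrow> left_module R (M j)" "left_module R N"
    and f: "f \<in> mod_hom R (direct_sum J M) N" and g: "g \<in> mod_hom R (direct_sum J M) N"
    and "\<And>j x. j \<in> J \<Longrightarrow> x \<in> carrier (M j) \<Longrightarrow>
      f (direct_sum_inj J M j x) = g (direct_sum_inj J M j x)"
    and x: "x \<in> carrier (direct_sum J M)"
  shows "f x = g x"
proof -
  have D: "left_module R (direct_sum J M)" by (rule left_module_direct_sum[OF assms(1,2)])
  interpret N: left_module R N by fact
  define F where "F = {j \<in> J. x j \<noteq> \<zero>\<^bsub>M j\<^esub>}"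
  have xc: "x j \<in> carrier (M j)" if "j \<in> J" for j using that x by (auto simp: PiE_iff)
  have cl: "(\<lambda>j. direct_sum_inj J M j (x j)) \<in> F \<rightarrow> carrier (direct_sum J M)"
    using xc by (intro Pi_I mod_hom_closed[OF direct_sum_inj_hom[OF assms(1,2)]]) (auto simp: F_def)
  have x_eq: "x = (\<Oplus>\<^bsub>direct_sum J M\<^esub>j\<in>F. direct_sum_inj J M j (x j))"
    unfolding F_def by (rule direct_sum_decomp[OF assms(1,2) x])
  have "f x = (\<Oplus>\<^bsub>N\<^esub>j\<in>F. f (direct_sum_inj J M j (x j)))"
    by (subst x_eq) (rule mod_hom_finsum[OF D assms(3) f cl])
  also have "\<dots> = (\<Oplus>\<^bsub>N\<^esub>j\<in>F. g (direct_sum_inj J M j (x j)))"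
    using cl by (intro N.M.finsum_cong') (auto simp: F_def xc assms(6) intro!: mod_hom_closed[OF g])
  finally have "f x = (\<Oplus>\<^bsub>N\<^esub>j\<in>F. g (direct_sum_inj J M j (x j)))" .
  moreover have "g x = (\<Oplus>\<^bsub>N\<^esub>j\<in>F. g (direct_sum_inj J M j (x j)))"
    by (subst x_eq) (rule mod_hom_finsum[OF D assms(3) g cl])
  ultimately show ?thesis by simp
qed

section \<open>Short exact sequences and their cocycles\<close>

lemma short_exactD:
  assumes "short_exact R Y X S"
  shows "left_module R Y" "left_module R (Mid S)" "left_module R X"
    "Incl S \<in> mod_hom R Y (Mid S)" "Proj S \<in> mod_hom R (Mid S) X" "inj_on (Incl S) (carrier Y)"
    "\<And>y. y \<in> carrier Y \<Longrightarrow> Proj S (Incl S y) = \<zero>\<^bsub>X\<^esub>"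
    "\<And>m. m \<in> carrier (Mid S) \<Longrightarrow> Proj S m = \<zero>\<^bsub>X\<^esub> \<Longrightarrow> \<exists>y\<in>carrier Y. m = Incl S y"
    "\<And>x. x \<in> carrier X \<Longrightarrow> \<exists>m\<in>carrier (Mid S). x = Proj S m"
proof -
  show "Proj S (Incl S y) = \<zero>\<^bsub>X\<^esub>" if "y \<in> carrier Y" for y
    using assms that unfolding short_exact_def by blast
  show "\<exists>y\<in>carrier Y. m = Incl S y" if "m \<in> carrier (Mid S)" "Proj S m = \<zero>\<^bsub>X\<^esub>" for m
    using assms that unfolding short_exact_def by blast
  show "\<exists>m\<in>carrier (Mid S). x = Proj S m" if "x \<in> carrier X" for x
    using assms that unfolding short_exact_def by blast
qed (use assms in \<open>auto simp: short_exact_def\<close>)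

lemma short_exactI:
  assumes "left_module R Y" "left_module R (Mid S)" "left_module R X"
    and i: "Incl S \<in> mod_hom R Y (Mid S)" and p: "Proj S \<in> mod_hom R (Mid S) X"
    and "\<And>y. y \<in> carrier Y \<Longrightarrow> Incl S y = \<zero>\<^bsub>Mid S\<^esub> \<Longrightarrow> y = \<zero>\<^bsub>Y\<^esub>"
    and "\<And>y. y \<in> carrier Y \<Longrightarrow> Proj S (Incl S y) = \<zero>\<^bsub>X\<^esub>"
    and "\<And>m. m \<in> carrier (Mid S) \<Longrightarrow> Proj S m = \<zero>\<^bsub>X\<^esub> \<Longrightarrow> \<exists>y\<in>carrier Y. m = Incl S y"
    and "\<And>x. x \<in> carrier X \<Longrightarrow> \<exists>m\<in>carrier (Mid S). x = Proj S m"
  shows "short_exact R Y X S"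
  unfolding short_exact_def
  using assms mod_hom_inj_on[OF assms(1,2) i assms(6)] mod_hom_closed[OF i] mod_hom_closed[OF p]
  by (auto simp: image_iff)

lemma short_five:
  assumes S: "short_exact R Y X S" and T: "short_exact R Y X' T"
    and f: "f \<in> mod_hom R (Mid S) (Mid T)" and g: "g \<in> mod_iso R X X'"
    and fi: "\<And>y. y \<in> carrier Y \<Longrightarrow> f (Incl S y) = Incl T y"
    and fp: "\<And>m. m \<in> carrier (Mid S) \<Longrightarrow> Proj T (f m) = g (Proj S m)"
  shows "f \<in> mod_iso R (Mid S) (Mid T)"
proof -
  note S' = short_exactD[OF S] and T' = short_exactD[OF T]
  interpret SM: left_module R "Mid S" by (rule S')
  interpret TM: left_module R "Mid T" by (rule T')
  interpret X': left_module R X' by (rule T')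
  have gh: "g \<in> mod_hom R X X'" and gb: "bij_betw g (carrier X) (carrier X')"
    using g by (auto simp: mod_iso_def)
  have "m = \<zero>\<^bsub>Mid S\<^esub>" if m: "m \<in> carrier (Mid S)" "f m = \<zero>\<^bsub>Mid T\<^esub>" for m
  proof -
    have "g (Proj S m) = g \<zero>\<^bsub>X\<^esub>"
      using fp[OF m(1)] m(2) mod_hom_zero[OF S'(3) T'(3) gh] mod_hom_zero[OF T'(2,3,5)] by simp
    then have "Proj S m = \<zero>\<^bsub>X\<^esub>"
      using gb m mod_hom_closed[OF S'(5)] abelian_groupE(2)[OF left_module_abelian_group[OF S'(3)]]
      by (auto simp: bij_betw_def dest: inj_onD)
    then obtain y where y: "y \<in> carrier Y" "m = Incl S y" using S'(8) m by blast
    then have "Incl T y = Incl T \<zero>\<^bsub>Y\<^esub>" using fi[of y] m mod_hom_zero[OF T'(1,2,4)] by simp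
    then have "y = \<zero>\<^bsub>Y\<^esub>"
      using T'(6) y abelian_groupE(2)[OF left_module_abelian_group[OF S'(1)]] by (auto dest: inj_onD)
    then show ?thesis using y mod_hom_zero[OF S'(1,2,4)] by simp
  qed
  then have inj: "inj_on f (carrier (Mid S))" by (rule mod_hom_inj_on[OF S'(2) T'(2) f])
  have "n \<in> f ` carrier (Mid S)" if n: "n \<in> carrier (Mid T)" for n
  proof -
    obtain x where x: "x \<in> carrier X" "Proj T n = g x"
      using gb mod_hom_closed[OF T'(5) n] by (auto simp: bij_betw_def)
    then obtain m where m: "m \<in> carrier (Mid S)" "x = Proj S m" using S'(9) by blast
    have fm: "f m \<in> carrier (Mid T)" using m mod_hom_closed[OF f] by blast
    have "Proj T (n \<ominus>\<^bsub>Mid T\<^esub> f m) = \<zero>\<^bsub>X'\<^esub>"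
      using n m x fm fp[OF m(1)] mod_hom_closed[OF T'(5) n]
      by (simp add: TM.M.minus_eq mod_hom_add[OF T'(5)] mod_hom_minus[OF T'(2,3,5)] X'.M.r_neg)
    then obtain y where y: "y \<in> carrier Y" "n \<ominus>\<^bsub>Mid T\<^esub> f m = Incl T y"
      using T'(8) n fm by (metis TM.M.minus_closed)
    have "n = (n \<ominus>\<^bsub>Mid T\<^esub> f m) \<oplus>\<^bsub>Mid T\<^esub> f m"
      using n fm by (simp add: TM.M.minus_eq TM.M.a_assoc TM.M.l_neg)
    also have "\<dots> = f (Incl S y \<oplus>\<^bsub>Mid S\<^esub> m)"
      using y m fi mod_hom_closed[OF S'(4)] by (simp add: mod_hom_add[OF f])
    finally show ?thesis using y m mod_hom_closed[OF S'(4)] by auto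
  qed
  then have "f ` carrier (Mid S) = carrier (Mid T)" using mod_hom_closed[OF f] by auto
  with inj f show ?thesis by (auto simp: mod_iso_def bij_betw_def)
qed

text \<open>A map of sets \<open>s\<close> lifting \<open>h : X \<rightarrow> X'\<close> to the middle term of a sequence ending in \<open>X'\<close>, with
  values of its defect of linearity \<open>c\<close> in \<open>Y\<close>. For \<open>h\<close> the identity, \<open>s\<close> is a set-theoretic section
  and \<open>c\<close> a cocycle describing the sequence. The single function \<open>c r x x'\<close> records the defects of
  both additivity and homogeneity.\<close>

definition cocycle_lift ::
  "('r, 'k) ring_scheme \<Rightarrow> ('r, 'y) module \<Rightarrow> ('r, 'x) module \<Rightarrow> ('r, 'y, 'm, 'w) ses \<Rightarrow>
    ('x \<Rightarrow> 'w) \<Rightarrow> ('x \<Rightarrow> 'm) \<Rightarrow> ('r \<Rightarrow> 'x \<Rightarrow> 'x \<Rightarrow> 'y) \<Rightarrow> bool" where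
  "cocycle_lift R Y X S h s c \<longleftrightarrow>
     (\<forall>x\<in>carrier X. s x \<in> carrier (Mid S) \<and> Proj S (s x) = h x) \<and>
     (\<forall>r\<in>carrier R. \<forall>x\<in>carrier X. \<forall>x'\<in>carrier X. c r x x' \<in> carrier Y \<and>
        r \<odot>\<^bsub>Mid S\<^esub> s x \<oplus>\<^bsub>Mid S\<^esub> s x' = Incl S (c r x x') \<oplus>\<^bsub>Mid S\<^esub> s (r \<odot>\<^bsub>X\<^esub> x \<oplus>\<^bsub>X\<^esub> x'))"

lemma cocycle_liftD:
  assumes "cocycle_lift R Y X S h s c"
  shows "\<And>x. x \<in> carrier X \<Longrightarrow> s x \<in> carrier (Mid S)"
    "\<And>x. x \<in> carrier X \<Longrightarrow> Proj S (s x) = h x"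
    "\<And>r x x'. r \<in> carrier R \<Longrightarrow> x \<in> carrier X \<Longrightarrow> x' \<in> carrier X \<Longrightarrow> c r x x' \<in> carrier Y"
    "\<And>r x x'. r \<in> carrier R \<Longrightarrow> x \<in> carrier X \<Longrightarrow> x' \<in> carrier X \<Longrightarrow>
      r \<odot>\<^bsub>Mid S\<^esub> s x \<oplus>\<^bsub>Mid S\<^esub> s x' = Incl S (c r x x') \<oplus>\<^bsub>Mid S\<^esub> s (r \<odot>\<^bsub>X\<^esub> x \<oplus>\<^bsub>X\<^esub> x')"
  using assms by (auto simp: cocycle_lift_def)

lemma cocycle_lift_cong:
  assumes "cocycle_lift R Y X S h s c" "left_module R X"
    and "\<And>x. x \<in> carrier X \<Longrightarrow> h x = h' x" "\<And>x. x \<in> carrier X \<Longrightarrow> s x = s' x"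
    and "\<And>r x x'. r \<in> carrier R \<Longrightarrow> x \<in> carrier X \<Longrightarrow> x' \<in> carrier X \<Longrightarrow> c r x x' = c' r x x'"
  shows "cocycle_lift R Y X S h' s' c'"
proof -
  interpret X: left_module R X by fact
  note s = cocycle_liftD[OF assms(1)]
  have "s' (r \<odot>\<^bsub>X\<^esub> x \<oplus>\<^bsub>X\<^esub> x') = s (r \<odot>\<^bsub>X\<^esub> x \<oplus>\<^bsub>X\<^esub> x')"
    if "r \<in> carrier R" "x \<in> carrier X" "x' \<in> carrier X" for r x x'
    using assms(4)[of "r \<odot>\<^bsub>X\<^esub> x \<oplus>\<^bsub>X\<^esub> x'"] that by simp
  then show ?thesis
    using s by (simp add: cocycle_lift_def assms(3-5)[symmetric])
qed

lemma cocycle_lift_exists: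
  assumes S: "short_exact R Y X S"
  shows "\<exists>s c. cocycle_lift R Y X S (\<lambda>x. x) s c"
proof -
  note S' = short_exactD[OF S]
  interpret SM: left_module R "Mid S" by (rule S')
  interpret X: left_module R X by (rule S')
  obtain s where s: "\<And>x. x \<in> carrier X \<Longrightarrow> s x \<in> carrier (Mid S)"
      "\<And>x. x \<in> carrier X \<Longrightarrow> Proj S (s x) = x"
    using S'(9) by metis
  define d where
    "d r x x' = (r \<odot>\<^bsub>Mid S\<^esub> s x \<oplus>\<^bsub>Mid S\<^esub> s x') \<ominus>\<^bsub>Mid S\<^esub> s (r \<odot>\<^bsub>X\<^esub> x \<oplus>\<^bsub>X\<^esub> x')" for r x x'
  have d: "\<exists>y\<in>carrier Y. d r x x' = Incl S y"
    "d r x x' \<oplus>\<^bsub>Mid S\<^esub> s (r \<odot>\<^bsub>X\<^esub> x \<oplus>\<^bsub>X\<^esub> x') = r \<odot>\<^bsub>Mid S\<^esub> s x \<oplus>\<^bsub>Mid S\<^esub> s x'"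
    if "r \<in> carrier R" "x \<in> carrier X" "x' \<in> carrier X" for r x x'
  proof -
    have "d r x x' \<in> carrier (Mid S)" using that s by (simp add: d_def)
    moreover have "Proj S (d r x x') = \<zero>\<^bsub>X\<^esub>"
      using that s mod_hom_closed[OF S'(5)]
      by (simp add: d_def SM.M.minus_eq mod_hom_add[OF S'(5)] mod_hom_smult[OF S'(5)]
          mod_hom_minus[OF S'(2,3,5)] X.M.r_neg)
    ultimately show "\<exists>y\<in>carrier Y. d r x x' = Incl S y" by (rule S'(8))
    show "d r x x' \<oplus>\<^bsub>Mid S\<^esub> s (r \<odot>\<^bsub>X\<^esub> x \<oplus>\<^bsub>X\<^esub> x') = r \<odot>\<^bsub>Mid S\<^esub> s x \<oplus>\<^bsub>Mid S\<^esub> s x'"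
      using that s by (simp add: d_def SM.M.minus_eq SM.M.a_assoc SM.M.l_neg)
  qed
  define c where "c r x x' = (SOME y. y \<in> carrier Y \<and> d r x x' = Incl S y)" for r x x'
  have "c r x x' \<in> carrier Y \<and> d r x x' = Incl S (c r x x')"
    if "r \<in> carrier R" "x \<in> carrier X" "x' \<in> carrier X" for r x x'
    using d(1)[OF that] unfolding c_def by (metis (mono_tags, lifting) someI_ex)
  with d(2) s have "cocycle_lift R Y X S (\<lambda>x. x) s c"
    unfolding cocycle_lift_def by metis
  then show ?thesis by blast
qed

lemma cocycle_lift_comp:
  assumes "cocycle_lift R Y X S k s c" "left_module R W" "h \<in> mod_hom R W X"
  shows "cocycle_lift R Y W S (\<lambda>x. k (h x)) (\<lambda>x. s (h x)) (\<lambda>r x x'. c r (h x) (h x'))"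
  using cocycle_liftD[OF assms(1)] mod_hom_closed[OF assms(3)]
  by (simp add: cocycle_lift_def mod_hom_lin[OF assms(2,3)])

lemma cocycle_lift_push:
  assumes "cocycle_lift R Y X S h s c" "left_module R X" "left_module R Y" "left_module R (Mid S)"
    and "Incl S \<in> mod_hom R Y (Mid S)" "f \<in> mod_hom R (Mid S) (Mid T)"
    and "\<And>y. y \<in> carrier Y \<Longrightarrow> f (Incl S y) = Incl T (k y)"
    and "\<And>y. y \<in> carrier Y \<Longrightarrow> k y \<in> carrier Y'"
    and "\<And>m. m \<in> carrier (Mid S) \<Longrightarrow> Proj T (f m) = g (Proj S m)"
  shows "cocycle_lift R Y' X T (\<lambda>x. g (h x)) (\<lambda>x. f (s x)) (\<lambda>r x x'. k (c r x x'))"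
proof -
  interpret X: left_module R X by fact
  note s = cocycle_liftD[OF assms(1)]
  have "r \<odot>\<^bsub>Mid T\<^esub> f (s x) \<oplus>\<^bsub>Mid T\<^esub> f (s x') =
      Incl T (k (c r x x')) \<oplus>\<^bsub>Mid T\<^esub> f (s (r \<odot>\<^bsub>X\<^esub> x \<oplus>\<^bsub>X\<^esub> x'))"
    if "r \<in> carrier R" "x \<in> carrier X" "x' \<in> carrier X" for r x x'
  proof -
    have "r \<odot>\<^bsub>Mid T\<^esub> f (s x) \<oplus>\<^bsub>Mid T\<^esub> f (s x') = f (r \<odot>\<^bsub>Mid S\<^esub> s x \<oplus>\<^bsub>Mid S\<^esub> s x')"
      using that s(1) by (simp add: mod_hom_lin[OF assms(4,6)])
    also have "\<dots> = f (Incl S (c r x x') \<oplus>\<^bsub>Mid S\<^esub> s (r \<odot>\<^bsub>X\<^esub> x \<oplus>\<^bsub>X\<^esub> x'))"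
      using that s by simp
    also have "\<dots> = Incl T (k (c r x x')) \<oplus>\<^bsub>Mid T\<^esub> f (s (r \<odot>\<^bsub>X\<^esub> x \<oplus>\<^bsub>X\<^esub> x'))"
      using that s mod_hom_closed[OF assms(5)] by (subst mod_hom_add[OF assms(6)]) (auto simp: assms(7))
    finally show ?thesis .
  qed
  then show ?thesis
    using s assms(8,9) mod_hom_closed[OF assms(6)] by (simp add: cocycle_lift_def)
qed

lemma cocycle_lift_zero:
  assumes "short_exact R Y P S" "left_module R X"
  shows "cocycle_lift R Y X S (\<lambda>x. \<zero>\<^bsub>P\<^esub>) (\<lambda>x. \<zero>\<^bsub>Mid S\<^esub>) (\<lambda>r x x'. \<zero>\<^bsub>Y\<^esub>)"
proof -
  note S' = short_exactD[OF assms(1)]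
  interpret SM: left_module R "Mid S" by (rule S')
  interpret Y: left_module R Y by (rule S')
  show ?thesis
    using mod_hom_zero[OF S'(2,3,5)] mod_hom_zero[OF S'(1,2,4)]
    by (simp add: cocycle_lift_def left_module_smult_zero[OF S'(2)])
qed

lemma cocycle_lift_add:
  assumes S: "short_exact R Y P S" and X: "left_module R X"
    and s: "cocycle_lift R Y X S h s c" and t: "cocycle_lift R Y X S k t d"
  shows "cocycle_lift R Y X S (\<lambda>x. h x \<oplus>\<^bsub>P\<^esub> k x) (\<lambda>x. s x \<oplus>\<^bsub>Mid S\<^esub> t x)
    (\<lambda>r x x'. c r x x' \<oplus>\<^bsub>Y\<^esub> d r x x')"
proof -
  note S' = short_exactD[OF S]
  interpret SM: left_module R "Mid S" by (rule S')
  interpret Y: left_module R Y by (rule S')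
  interpret X: left_module R X by fact
  note s' = cocycle_liftD[OF s] and t' = cocycle_liftD[OF t]
  have "r \<odot>\<^bsub>Mid S\<^esub> (s x \<oplus>\<^bsub>Mid S\<^esub> t x) \<oplus>\<^bsub>Mid S\<^esub> (s x' \<oplus>\<^bsub>Mid S\<^esub> t x') =
      Incl S (c r x x' \<oplus>\<^bsub>Y\<^esub> d r x x') \<oplus>\<^bsub>Mid S\<^esub>
      (s (r \<odot>\<^bsub>X\<^esub> x \<oplus>\<^bsub>X\<^esub> x') \<oplus>\<^bsub>Mid S\<^esub> t (r \<odot>\<^bsub>X\<^esub> x \<oplus>\<^bsub>X\<^esub> x'))"
    if r: "r \<in> carrier R" "x \<in> carrier X" "x' \<in> carrier X" for r x x'
  proof -
    have "r \<odot>\<^bsub>Mid S\<^esub> (s x \<oplus>\<^bsub>Mid S\<^esub> t x) \<oplus>\<^bsub>Mid S\<^esub> (s x' \<oplus>\<^bsub>Mid S\<^esub> t x') =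
      (r \<odot>\<^bsub>Mid S\<^esub> s x \<oplus>\<^bsub>Mid S\<^esub> s x') \<oplus>\<^bsub>Mid S\<^esub> (r \<odot>\<^bsub>Mid S\<^esub> t x \<oplus>\<^bsub>Mid S\<^esub> t x')"
      using r s'(1) t'(1) by (simp add: SM.smult_r_distr SM.M.a_ac)
    also have "\<dots> = (Incl S (c r x x') \<oplus>\<^bsub>Mid S\<^esub> s (r \<odot>\<^bsub>X\<^esub> x \<oplus>\<^bsub>X\<^esub> x')) \<oplus>\<^bsub>Mid S\<^esub>
        (Incl S (d r x x') \<oplus>\<^bsub>Mid S\<^esub> t (r \<odot>\<^bsub>X\<^esub> x \<oplus>\<^bsub>X\<^esub> x'))"
      using r s' t' by simp
    also have "\<dots> = Incl S (c r x x' \<oplus>\<^bsub>Y\<^esub> d r x x') \<oplus>\<^bsub>Mid S\<^esub>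
      (s (r \<odot>\<^bsub>X\<^esub> x \<oplus>\<^bsub>X\<^esub> x') \<oplus>\<^bsub>Mid S\<^esub> t (r \<odot>\<^bsub>X\<^esub> x \<oplus>\<^bsub>X\<^esub> x'))"
      using r s'(1,3) t'(1,3) mod_hom_closed[OF S'(4)]
      by (simp add: mod_hom_add[OF S'(4)] SM.M.a_ac)
    finally show ?thesis .
  qed
  then show ?thesis
    using s'(1-3) t'(1-3) by (simp add: cocycle_lift_def mod_hom_add[OF S'(5)])
qed

lemma cocycle_lift_finsum:
  assumes S: "short_exact R Y P S" and X: "left_module R X" and "finite F"
    and "\<And>i. i \<in> F \<Longrightarrow> cocycle_lift R Y X S (h i) (s i) (c i)"
  shows "cocycle_lift R Y X S (\<lambda>x. \<Oplus>\<^bsub>P\<^esub>i\<in>F. h i x) (\<lambda>x. \<Oplus>\<^bsub>Mid S\<^esub>i\<in>F. s i x)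
    (\<lambda>r x x'. \<Oplus>\<^bsub>Y\<^esub>i\<in>F. c i r x x')"
  using assms(3,4)
proof (induction F rule: finite_induct)
  note S' = short_exactD[OF S]
  interpret SM: left_module R "Mid S" by (rule S')
  interpret Y: left_module R Y by (rule S')
  interpret P: left_module R P by (rule S')
  case empty
  show ?case using cocycle_lift_zero[OF S X] by simp
next
  note S' = short_exactD[OF S]
  interpret SM: left_module R "Mid S" by (rule S')
  interpret Y: left_module R Y by (rule S')
  interpret P: left_module R P by (rule S')
  case (insert i F)
  have h: "h j x \<in> carrier P" if "j \<in> insert i F" "x \<in> carrier X" for j x
    using cocycle_liftD(1,2)[OF insert.prems[OF that(1)] that(2)] mod_hom_closed[OF S'(5)] by metis
  note s = cocycle_liftD(1)[OF insert.prems] and c = cocycle_liftD(3)[OF insert.prems]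
  have "cocycle_lift R Y X S (\<lambda>x. h i x \<oplus>\<^bsub>P\<^esub> (\<Oplus>\<^bsub>P\<^esub>i\<in>F. h i x))
    (\<lambda>x. s i x \<oplus>\<^bsub>Mid S\<^esub> (\<Oplus>\<^bsub>Mid S\<^esub>i\<in>F. s i x))
    (\<lambda>r x x'. c i r x x' \<oplus>\<^bsub>Y\<^esub> (\<Oplus>\<^bsub>Y\<^esub>i\<in>F. c i r x x'))"
    using insert by (intro cocycle_lift_add[OF S X]) auto
  then show ?case
    by (rule cocycle_lift_cong[OF _ X])
      (use insert.hyps h s c in \<open>auto intro!: P.M.finsum_insert[symmetric]
        SM.M.finsum_insert[symmetric] Y.M.finsum_insert[symmetric]\<close>)
qed

lemma section_decomp:
  assumes S: "short_exact R Y X S" and s: "cocycle_lift R Y X S (\<lambda>x. x) s c"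
  shows "\<And>m. m \<in> carrier (Mid S) \<Longrightarrow> \<exists>y\<in>carrier Y. m = Incl S y \<oplus>\<^bsub>Mid S\<^esub> s (Proj S m)"
    "\<And>y x. y \<in> carrier Y \<Longrightarrow> x \<in> carrier X \<Longrightarrow> Proj S (Incl S y \<oplus>\<^bsub>Mid S\<^esub> s x) = x"
    "\<And>y y' x. y \<in> carrier Y \<Longrightarrow> y' \<in> carrier Y \<Longrightarrow> x \<in> carrier X \<Longrightarrow>
      Incl S y \<oplus>\<^bsub>Mid S\<^esub> s x = Incl S y' \<oplus>\<^bsub>Mid S\<^esub> s x \<Longrightarrow> y = y'"
proof -
  note S' = short_exactD[OF S]
  interpret SM: left_module R "Mid S" by (rule S')
  interpret X: left_module R X by (rule S')
  note s' = cocycle_liftD[OF s]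
  show "\<exists>y\<in>carrier Y. m = Incl S y \<oplus>\<^bsub>Mid S\<^esub> s (Proj S m)" if m: "m \<in> carrier (Mid S)" for m
  proof -
    have p: "Proj S m \<in> carrier X" using m mod_hom_closed[OF S'(5)] by blast
    have "Proj S (m \<ominus>\<^bsub>Mid S\<^esub> s (Proj S m)) = \<zero>\<^bsub>X\<^esub>"
      using m p s' by (simp add: SM.M.minus_eq mod_hom_add[OF S'(5)] mod_hom_minus[OF S'(2,3,5)] X.M.r_neg)
    then obtain y where y: "y \<in> carrier Y" "m \<ominus>\<^bsub>Mid S\<^esub> s (Proj S m) = Incl S y"
      using S'(8) m p s' by (metis SM.M.minus_closed)
    have "m = (m \<ominus>\<^bsub>Mid S\<^esub> s (Proj S m)) \<oplus>\<^bsub>Mid S\<^esub> s (Proj S m)"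
      using m p s' by (simp add: SM.M.minus_eq SM.M.a_assoc SM.M.l_neg)
    with y show ?thesis by auto
  qed
  show "Proj S (Incl S y \<oplus>\<^bsub>Mid S\<^esub> s x) = x" if "y \<in> carrier Y" "x \<in> carrier X" for x y
    using that s' mod_hom_closed[OF S'(4)] by (simp add: mod_hom_add[OF S'(5)] S'(7))
  show "y = y'" if "y \<in> carrier Y" "y' \<in> carrier Y" "x \<in> carrier X"
      "Incl S y \<oplus>\<^bsub>Mid S\<^esub> s x = Incl S y' \<oplus>\<^bsub>Mid S\<^esub> s x" for x y y'
    using that s' mod_hom_closed[OF S'(4)] S'(6) by (auto dest: inj_onD)
qed

lemma hom_of_cocycle_lift:
  assumes S: "short_exact R Y X S" and s: "cocycle_lift R Y X S (\<lambda>x. x) s c"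
    and T: "short_exact R Y P T" and t: "cocycle_lift R Y X T h t c"
  shows "\<exists>f\<in>mod_hom R (Mid S) (Mid T). (\<forall>y\<in>carrier Y. f (Incl S y) = Incl T y) \<and>
    (\<forall>m\<in>carrier (Mid S). Proj T (f m) = h (Proj S m))"
proof -
  note S' = short_exactD[OF S] and T' = short_exactD[OF T]
  interpret SM: left_module R "Mid S" by (rule S')
  interpret TM: left_module R "Mid T" by (rule T')
  interpret X: left_module R X by (rule S')
  interpret P: left_module R P by (rule T')
  interpret Y: left_module R Y by (rule S')
  note s' = cocycle_liftD[OF s] and t' = cocycle_liftD[OF t]
  note iS = mod_hom_closed[OF S'(4)] and iT = mod_hom_closed[OF T'(4)]
  define f where "f m = Incl T (THE y. y \<in> carrier Y \<and> m = Incl S y \<oplus>\<^bsub>Mid S\<^esub> s (Proj S m))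
    \<oplus>\<^bsub>Mid T\<^esub> t (Proj S m)" for m
  have f: "f (Incl S y \<oplus>\<^bsub>Mid S\<^esub> s x) = Incl T y \<oplus>\<^bsub>Mid T\<^esub> t x"
    if "y \<in> carrier Y" "x \<in> carrier X" for x y
  proof -
    have "(THE z. z \<in> carrier Y \<and> Incl S y \<oplus>\<^bsub>Mid S\<^esub> s x = Incl S z \<oplus>\<^bsub>Mid S\<^esub> s x) = y"
      using that section_decomp(3)[OF S s] by (intro the_equality) auto
    then show ?thesis using section_decomp(2)[OF S s that] by (simp add: f_def)
  qed
  have dec: "\<exists>y x. y \<in> carrier Y \<and> x \<in> carrier X \<and> m = Incl S y \<oplus>\<^bsub>Mid S\<^esub> s x"
    if "m \<in> carrier (Mid S)" for m
    using section_decomp(1)[OF S s that] that mod_hom_closed[OF S'(5)] by blast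
  have hom: "f \<in> mod_hom R (Mid S) (Mid T)"
  proof (rule mod_homI[OF S'(2) T'(2)])
    show "f m \<in> carrier (Mid T)" if "m \<in> carrier (Mid S)" for m
      using dec[OF that] f t' iT by auto
    fix r m m' assume *: "r \<in> carrier R" "m \<in> carrier (Mid S)" "m' \<in> carrier (Mid S)"
    then obtain y x y' x' where e: "y \<in> carrier Y" "x \<in> carrier X" "m = Incl S y \<oplus>\<^bsub>Mid S\<^esub> s x"
        "y' \<in> carrier Y" "x' \<in> carrier X" "m' = Incl S y' \<oplus>\<^bsub>Mid S\<^esub> s x'"
      using dec by metis
    let ?c = "c r x x'" and ?y = "r \<odot>\<^bsub>Y\<^esub> y \<oplus>\<^bsub>Y\<^esub> y'" and ?x = "r \<odot>\<^bsub>X\<^esub> x \<oplus>\<^bsub>X\<^esub> x'"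
    have c: "?c \<in> carrier Y" using e * s' by blast
    have "r \<odot>\<^bsub>Mid S\<^esub> m \<oplus>\<^bsub>Mid S\<^esub> m' = Incl S ?y \<oplus>\<^bsub>Mid S\<^esub> (r \<odot>\<^bsub>Mid S\<^esub> s x \<oplus>\<^bsub>Mid S\<^esub> s x')"
      using e * s'(1) iS by (simp add: mod_hom_lin[OF S'(1,4)] SM.smult_r_distr SM.M.a_ac)
    also have "\<dots> = Incl S (?y \<oplus>\<^bsub>Y\<^esub> ?c) \<oplus>\<^bsub>Mid S\<^esub> s ?x"
      using e * s' iS c by (simp add: mod_hom_add[OF S'(4)] SM.M.a_assoc)
    finally have "f (r \<odot>\<^bsub>Mid S\<^esub> m \<oplus>\<^bsub>Mid S\<^esub> m') = Incl T (?y \<oplus>\<^bsub>Y\<^esub> ?c) \<oplus>\<^bsub>Mid T\<^esub> t ?x"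
      using e * c by (simp add: f)
    also have "\<dots> = Incl T ?y \<oplus>\<^bsub>Mid T\<^esub> (r \<odot>\<^bsub>Mid T\<^esub> t x \<oplus>\<^bsub>Mid T\<^esub> t x')"
      using e * t' iT c by (simp add: mod_hom_add[OF T'(4)] TM.M.a_assoc)
    also have "\<dots> = r \<odot>\<^bsub>Mid T\<^esub> f m \<oplus>\<^bsub>Mid T\<^esub> f m'"
      using e * t'(1) iT by (simp add: f mod_hom_lin[OF T'(1,4)] TM.smult_r_distr TM.M.a_ac)
    finally show "f (r \<odot>\<^bsub>Mid S\<^esub> m \<oplus>\<^bsub>Mid S\<^esub> m') = r \<odot>\<^bsub>Mid T\<^esub> f m \<oplus>\<^bsub>Mid T\<^esub> f m'" .
  qed
  have incl: "f (Incl S y) = Incl T y" if y: "y \<in> carrier Y" for y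
  proof -
    let ?c = "c \<one>\<^bsub>R\<^esub> \<zero>\<^bsub>X\<^esub> \<zero>\<^bsub>X\<^esub>"
    have c: "?c \<in> carrier Y" using s' by simp
    have "s \<zero>\<^bsub>X\<^esub> \<oplus>\<^bsub>Mid S\<^esub> s \<zero>\<^bsub>X\<^esub> = Incl S ?c \<oplus>\<^bsub>Mid S\<^esub> s \<zero>\<^bsub>X\<^esub>"
      using s'(4)[of "\<one>\<^bsub>R\<^esub>" "\<zero>\<^bsub>X\<^esub>" "\<zero>\<^bsub>X\<^esub>"] s'(1) by simp
    then have s0: "s \<zero>\<^bsub>X\<^esub> = Incl S ?c" using s'(1) iS c by simp
    have "t \<zero>\<^bsub>X\<^esub> \<oplus>\<^bsub>Mid T\<^esub> t \<zero>\<^bsub>X\<^esub> = Incl T ?c \<oplus>\<^bsub>Mid T\<^esub> t \<zero>\<^bsub>X\<^esub>"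
      using t'(4)[of "\<one>\<^bsub>R\<^esub>" "\<zero>\<^bsub>X\<^esub>" "\<zero>\<^bsub>X\<^esub>"] t'(1) by simp
    then have t0: "t \<zero>\<^bsub>X\<^esub> = Incl T ?c" using t'(1) iT c by simp
    have eq: "y = (y \<ominus>\<^bsub>Y\<^esub> ?c) \<oplus>\<^bsub>Y\<^esub> ?c" "y \<ominus>\<^bsub>Y\<^esub> ?c \<in> carrier Y"
      using y c by (simp_all add: Y.M.minus_eq Y.M.a_assoc Y.M.l_neg)
    have "Incl S y = Incl S (y \<ominus>\<^bsub>Y\<^esub> ?c) \<oplus>\<^bsub>Mid S\<^esub> s \<zero>\<^bsub>X\<^esub>"
      by (subst eq(1)) (simp add: mod_hom_add[OF S'(4)] eq(2) c s0)
    then have "f (Incl S y) = Incl T (y \<ominus>\<^bsub>Y\<^esub> ?c) \<oplus>\<^bsub>Mid T\<^esub> t \<zero>\<^bsub>X\<^esub>"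
      using f[OF eq(2)] by simp
    also have "\<dots> = Incl T y"
      by (subst (2) eq(1)) (simp add: mod_hom_add[OF T'(4)] eq(2) c t0)
    finally show ?thesis .
  qed
  have h: "h x \<in> carrier P" if "x \<in> carrier X" for x
    using t'(1,2)[OF that] mod_hom_closed[OF T'(5)] by metis
  have proj: "Proj T (f m) = h (Proj S m)" if m: "m \<in> carrier (Mid S)" for m
  proof -
    obtain y x where e: "y \<in> carrier Y" "x \<in> carrier X" "m = Incl S y \<oplus>\<^bsub>Mid S\<^esub> s x"
      using dec[OF m] by blast
    then have "Proj T (f m) = h x" using t' iT h by (simp add: f mod_hom_add[OF T'(5)] T'(7))
    with e show ?thesis using section_decomp(2)[OF S s] by simp
  qed
  show ?thesis using hom incl proj by blast
qed

lemma ses_equiv_cocycle_lift: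
  assumes "short_exact R Y X S" "ses_equiv R Y S T" "left_module R W"
    and "cocycle_lift R Y W S h s c"
  shows "\<exists>t. cocycle_lift R Y W T h t c"
proof -
  note S' = short_exactD[OF assms(1)]
  obtain f where f: "f \<in> mod_iso R (Mid S) (Mid T)" "\<And>y. y \<in> carrier Y \<Longrightarrow> f (Incl S y) = Incl T y"
      "\<And>m. m \<in> carrier (Mid S) \<Longrightarrow> Proj T (f m) = Proj S m"
    using assms(2) unfolding ses_equiv_def by blast
  have "cocycle_lift R Y W T (\<lambda>x. h x) (\<lambda>x. f (s x)) (\<lambda>r x x'. c r x x')"
    using cocycle_lift_push[of R Y W S h s c f T "\<lambda>y. y" Y "\<lambda>x. x"] assms(3,4) S' f
    by (simp add: mod_iso_def)
  then show ?thesis by blast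
qed

lemma ses_equiv_if_cocycle:
  assumes S: "short_exact R Y X S" "cocycle_lift R Y X S (\<lambda>x. x) s c"
    and T: "short_exact R Y X T" "cocycle_lift R Y X T (\<lambda>x. x) t c"
  shows "ses_equiv R Y S T"
proof -
  obtain f where f: "f \<in> mod_hom R (Mid S) (Mid T)" "\<And>y. y \<in> carrier Y \<Longrightarrow> f (Incl S y) = Incl T y"
      "\<And>m. m \<in> carrier (Mid S) \<Longrightarrow> Proj T (f m) = Proj S m"
    using hom_of_cocycle_lift[OF S T] by blast
  have "(\<lambda>x. x) \<in> mod_iso R X X"
    by (auto simp: mod_iso_def mod_hom_def bij_betw_def)
  then have "f \<in> mod_iso R (Mid S) (Mid T)"
    using f by (intro short_five[OF S(1) T(1)]) auto
  with f show ?thesis unfolding ses_equiv_def by blast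
qed

text \<open>The middle term can be transported along the bijection with \<open>Y \<times> X\<close> given by a section.\<close>

lemma short_exact_retype:
  fixes S :: "('r, 'y, 'm, 'x) ses"
  assumes S: "short_exact R Y X S"
  shows "\<exists>T :: ('r, 'y, 'y \<times> 'x, 'x) ses. short_exact R Y X T \<and> ses_equiv R Y S T"
proof -
  obtain s c where s: "cocycle_lift R Y X S (\<lambda>x. x) s c"
    using cocycle_lift_exists[OF S] by blast
  note S' = short_exactD[OF S]
  interpret SM: left_module R "Mid S" by (rule S')
  obtain q where q: "\<And>m. m \<in> carrier (Mid S) \<Longrightarrow> q m \<in> carrier Y \<and> m = Incl S (q m) \<oplus>\<^bsub>Mid S\<^esub> s (Proj S m)"
    using section_decomp(1)[OF S s] by metis
  define \<phi> where "\<phi> m = (q m, Proj S m)" for m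
  define \<psi> where "\<psi> = inv_into (carrier (Mid S)) \<phi>"
  have inj: "inj_on \<phi> (carrier (Mid S))"
    using q by (intro inj_onI) (metis \<phi>_def prod.inject)
  then have \<psi>: "\<psi> (\<phi> m) = m" if "m \<in> carrier (Mid S)" for m
    using that by (simp add: \<psi>_def)
  define N :: "('r, 'y \<times> 'x) module" where
    "N = \<lparr>carrier = \<phi> ` carrier (Mid S), mult = undefined, one = undefined, zero = \<phi> \<zero>\<^bsub>Mid S\<^esub>,
      add = (\<lambda>a b. \<phi> (\<psi> a \<oplus>\<^bsub>Mid S\<^esub> \<psi> b)), smult = (\<lambda>r a. \<phi> (r \<odot>\<^bsub>Mid S\<^esub> \<psi> a))\<rparr>"
  have N: "left_module R N" and \<phi>: "\<phi> \<in> mod_hom R (Mid S) N"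
    by (rule left_module_image[OF S'(2)]; simp add: N_def \<psi>)+
  have bij: "bij_betw \<phi> (carrier (Mid S)) (carrier N)"
    using inj by (simp add: bij_betw_def N_def)
  have \<psi>h: "\<psi> \<in> mod_hom R N (Mid S)"
    using SM.M.a_closed SM.smult_closed by (auto simp: mod_hom_def N_def \<psi>)
  define T :: "('r, 'y, 'y \<times> 'x, 'x) ses" where
    "T = \<lparr>Mid = N, Incl = (\<lambda>y. \<phi> (Incl S y)), Proj = (\<lambda>a. Proj S (\<psi> a))\<rparr>"
  have "short_exact R Y X T"
  proof (rule short_exactI)
    show "left_module R Y" "left_module R X" "left_module R (Mid T)"
      using S' N by (auto simp: T_def)
    show "Incl T \<in> mod_hom R Y (Mid T)" "Proj T \<in> mod_hom R (Mid T) X"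
      using mod_hom_comp[OF S'(4) \<phi>] mod_hom_comp[OF \<psi>h S'(5)] by (auto simp: T_def)
  next
    fix y assume y: "y \<in> carrier Y" "Incl T y = \<zero>\<^bsub>Mid T\<^esub>"
    then have "Incl S y = Incl S \<zero>\<^bsub>Y\<^esub>"
      using mod_hom_closed[OF S'(4)] inj mod_hom_zero[OF S'(1,2,4)] by (auto simp: T_def N_def dest: inj_onD)
    then show "y = \<zero>\<^bsub>Y\<^esub>"
      using S'(6) y abelian_groupE(2)[OF left_module_abelian_group[OF S'(1)]] by (auto dest: inj_onD)
  next
    fix y assume "y \<in> carrier Y"
    then show "Proj T (Incl T y) = \<zero>\<^bsub>X\<^esub>"
      using S'(7) mod_hom_closed[OF S'(4)] by (simp add: T_def \<psi>)
  next
    fix m assume "m \<in> carrier (Mid T)" "Proj T m = \<zero>\<^bsub>X\<^esub>"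
    then show "\<exists>y\<in>carrier Y. m = Incl T y" using S'(8) by (auto simp: T_def N_def \<psi>) metis
  next
    fix x assume "x \<in> carrier X"
    then show "\<exists>m\<in>carrier (Mid T). x = Proj T m" using S'(9) by (fastforce simp: T_def N_def \<psi>)
  qed
  moreover have "ses_equiv R Y S T"
    unfolding ses_equiv_def using \<phi> bij by (intro bexI[of _ \<phi>]) (auto simp: T_def \<psi> mod_iso_def)
  ultimately show ?thesis by blast
qed

section \<open>Pull-backs, push-outs and Baer sums of sequences\<close>

lemma short_exact_pullback:
  assumes S: "short_exact R Y X S" and W: "left_module R W" and h: "h \<in> mod_hom R W X"
  shows "short_exact R Y W (pullback_ses W h S)"
proof (rule short_exactI)
  note S' = short_exactD[OF S]
  interpret SM: left_module R "Mid S" by (rule S')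
  interpret W: left_module R W by fact
  interpret Y: left_module R Y by (rule S')
  show "left_module R Y" "left_module R W" by (fact S' W)+
  show Mid: "left_module R (Mid (pullback_ses W h S))"
    using left_module_pullback[OF S'(2) W S'(3,5) h] by (simp add: pullback_ses_def)
  show "Incl (pullback_ses W h S) \<in> mod_hom R Y (Mid (pullback_ses W h S))"
    using mod_hom_closed[OF S'(4)]
    by (intro mod_homI[OF S'(1) Mid])
      (auto simp: pullback_ses_def mod_hom_lin[OF S'(1,4)] S'(7) mod_hom_zero[OF W S'(3) h]
        left_module_smult_zero[OF W])
  show "Proj (pullback_ses W h S) \<in> mod_hom R (Mid (pullback_ses W h S)) W"
    by (intro mod_homI[OF Mid W]) (auto simp: pullback_ses_def)
  show "y = \<zero>\<^bsub>Y\<^esub>" if "y \<in> carrier Y" "Incl (pullback_ses W h S) y = \<zero>\<^bsub>Mid (pullback_ses W h S)\<^esub>" for y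
    using that S'(6) mod_hom_zero[OF S'(1,2,4)]
    by (auto simp: pullback_ses_def inj_on_def dest: bspec[of _ _ "\<zero>\<^bsub>Y\<^esub>"])
  show "Proj (pullback_ses W h S) (Incl (pullback_ses W h S) y) = \<zero>\<^bsub>W\<^esub>" if "y \<in> carrier Y" for y
    by (simp add: pullback_ses_def)
  show "\<exists>y\<in>carrier Y. m = Incl (pullback_ses W h S) y"
    if "m \<in> carrier (Mid (pullback_ses W h S))" "Proj (pullback_ses W h S) m = \<zero>\<^bsub>W\<^esub>" for m
    using that S'(8) mod_hom_zero[OF W S'(3) h] by (auto simp: pullback_ses_def)
  show "\<exists>m\<in>carrier (Mid (pullback_ses W h S)). x = Proj (pullback_ses W h S) m"
    if x: "x \<in> carrier W" for x
    using S'(9)[OF mod_hom_closed[OF h x]] x by (auto simp: pullback_ses_def)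
qed

lemma cocycle_lift_pullback:
  assumes S: "short_exact R Y X S" and W: "left_module R W" and h: "h \<in> mod_hom R W X"
    and s: "cocycle_lift R Y W S h s c"
  shows "cocycle_lift R Y W (pullback_ses W h S) (\<lambda>x. x) (\<lambda>x. (s x, x)) c"
proof -
  interpret W: left_module R W by fact
  show ?thesis
    using cocycle_liftD[OF s] by (simp add: cocycle_lift_def pullback_ses_def)
qed

lemma pushout_module_proj:
  fixes Y :: "('r, 'y) module" and Y' :: "('r, 'w) module" and M :: "('r, 'm) module"
  assumes "left_module R Y" "left_module R Y'" "left_module R M"
    and h: "h \<in> mod_hom R Y Y'" and i: "i \<in> mod_hom R Y M"
  defines "j \<equiv> \<lambda>p. pushout_submodule Y Y' M h i +>\<^bsub>prod_module Y' M\<^esub> p"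
  shows "left_module R (pushout_module Y Y' M h i)"
    "j \<in> mod_hom R (prod_module Y' M) (pushout_module Y Y' M h i)"
    "j ` carrier (prod_module Y' M) = carrier (pushout_module Y Y' M h i)"
    "\<And>p. p \<in> carrier (prod_module Y' M) \<Longrightarrow> j p = \<zero>\<^bsub>pushout_module Y Y' M h i\<^esub> \<longleftrightarrow>
      (\<exists>a\<in>carrier Y. p = (h a, \<ominus>\<^bsub>M\<^esub> i a))"
    "\<And>p. p \<in> carrier (prod_module Y' M) \<Longrightarrow>
      j p = (\<lambda>n. n \<oplus>\<^bsub>prod_module Y' M\<^esub> p) ` pushout_submodule Y Y' M h i"
proof -
  interpret Y: left_module R Y by fact
  interpret Y': left_module R Y' by fact
  interpret M: left_module R M by fact
  have P: "left_module R (prod_module Y' M)" by (rule left_module_prod) fact+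
  note h0 = mod_hom_zero[OF assms(1,2) h] and i0 = mod_hom_zero[OF assms(1,3) i]
  note hc = mod_hom_closed[OF h] and ic = mod_hom_closed[OF i]
  let ?N = "pushout_submodule Y Y' M h i"
  have mem: "p \<in> ?N \<longleftrightarrow> (\<exists>a\<in>carrier Y. p = (h a, \<ominus>\<^bsub>M\<^esub> i a))" for p
    by (auto simp: pushout_submodule_def)
  have "?N \<subseteq> carrier (prod_module Y' M)" using hc ic by (auto simp: pushout_submodule_def)
  moreover have "\<zero>\<^bsub>prod_module Y' M\<^esub> \<in> ?N"
    unfolding mem by (rule bexI[of _ "\<zero>\<^bsub>Y\<^esub>"]) (auto simp: h0 i0 M.M.minus_zero_zero)
  moreover have "p \<oplus>\<^bsub>prod_module Y' M\<^esub> q \<in> ?N" if "p \<in> ?N" "q \<in> ?N" for p q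
  proof -
    obtain a b where "a \<in> carrier Y" "b \<in> carrier Y" "p = (h a, \<ominus>\<^bsub>M\<^esub> i a)" "q = (h b, \<ominus>\<^bsub>M\<^esub> i b)"
      using \<open>p \<in> ?N\<close> \<open>q \<in> ?N\<close> by (auto simp: mem)
    then show ?thesis
      unfolding mem using hc ic
      by (intro bexI[of _ "a \<oplus>\<^bsub>Y\<^esub> b"]) (auto simp: mod_hom_add[OF h] mod_hom_add[OF i] M.M.minus_add)
  qed
  moreover have "r \<odot>\<^bsub>prod_module Y' M\<^esub> p \<in> ?N" if "r \<in> carrier R" "p \<in> ?N" for r p
  proof -
    obtain a where "a \<in> carrier Y" "p = (h a, \<ominus>\<^bsub>M\<^esub> i a)" using \<open>p \<in> ?N\<close> by (auto simp: mem)
    then show ?thesis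
      unfolding mem using hc ic \<open>r \<in> carrier R\<close>
      by (intro bexI[of _ "r \<odot>\<^bsub>Y\<^esub> a"])
        (auto simp: mod_hom_smult[OF h] mod_hom_smult[OF i] left_module_smult_minus[OF assms(3)])
  qed
  moreover have "\<ominus>\<^bsub>prod_module Y' M\<^esub> p \<in> ?N" if "p \<in> ?N" for p
  proof -
    obtain a where "a \<in> carrier Y" "p = (h a, \<ominus>\<^bsub>M\<^esub> i a)" using \<open>p \<in> ?N\<close> by (auto simp: mem)
    then show ?thesis
      unfolding mem using hc ic
      by (intro bexI[of _ "\<ominus>\<^bsub>Y\<^esub> a"])
        (auto simp: mod_hom_minus[OF assms(1,2) h] mod_hom_minus[OF assms(1,3) i]
          prod_module_minus[OF assms(2,3)])
  qed
  ultimately show "left_module R (pushout_module Y Y' M h i)"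
    "j \<in> mod_hom R (prod_module Y' M) (pushout_module Y Y' M h i)"
    "j ` carrier (prod_module Y' M) = carrier (pushout_module Y Y' M h i)"
    "\<And>p. p \<in> carrier (prod_module Y' M) \<Longrightarrow> j p = \<zero>\<^bsub>pushout_module Y Y' M h i\<^esub> \<longleftrightarrow>
      (\<exists>a\<in>carrier Y. p = (h a, \<ominus>\<^bsub>M\<^esub> i a))"
    "\<And>p. p \<in> carrier (prod_module Y' M) \<Longrightarrow>
      j p = (\<lambda>n. n \<oplus>\<^bsub>prod_module Y' M\<^esub> p) ` ?N"
    unfolding pushout_module_def j_def mem[symmetric]
    using quotient_module_proj[OF P, of ?N] by simp_all
qed

text \<open>Exactness of \<open>S\<close> is not assumed, so that this applies to a direct sum of sequences without
  proving the latter exact.\<close>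

lemma pushout_ses_proj:
  fixes S :: "('r, 'y, 'm, 'x) ses" and Y' :: "('r, 'w) module"
  assumes "left_module R Y" "left_module R Y'" "left_module R (Mid S)" "left_module R X"
    and h: "h \<in> mod_hom R Y Y'" and i: "Incl S \<in> mod_hom R Y (Mid S)"
    and p: "Proj S \<in> mod_hom R (Mid S) X" and pi: "\<forall>y\<in>carrier Y. Proj S (Incl S y) = \<zero>\<^bsub>X\<^esub>"
  shows "\<exists>j. left_module R (Mid (pushout_ses Y Y' h S)) \<and>
    j \<in> mod_hom R (prod_module Y' (Mid S)) (Mid (pushout_ses Y Y' h S)) \<and>
    j ` (carrier Y' \<times> carrier (Mid S)) = carrier (Mid (pushout_ses Y Y' h S)) \<and>
    (\<forall>y\<in>carrier Y'. \<forall>m\<in>carrier (Mid S). j (y, m) = \<zero>\<^bsub>Mid (pushout_ses Y Y' h S)\<^esub> \<longleftrightarrow>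
      (\<exists>a\<in>carrier Y. y = h a \<and> m = \<ominus>\<^bsub>Mid S\<^esub> Incl S a)) \<and>
    (\<forall>y\<in>carrier Y'. Incl (pushout_ses Y Y' h S) y = j (y, \<zero>\<^bsub>Mid S\<^esub>)) \<and>
    (\<forall>y\<in>carrier Y'. \<forall>m\<in>carrier (Mid S). Proj (pushout_ses Y Y' h S) (j (y, m)) = Proj S m)"
proof -
  let ?N = "pushout_submodule Y Y' (Mid S) h (Incl S)"
  let ?j = "\<lambda>p. ?N +>\<^bsub>prod_module Y' (Mid S)\<^esub> p"
  interpret Y: left_module R Y by fact
  interpret M: left_module R "Mid S" by fact
  interpret X: left_module R X by fact
  note Q = pushout_module_proj[OF assms(1-3) h i]
  have "Proj (pushout_ses Y Y' h S) (?j (y, m)) = Proj S m"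
    if "y \<in> carrier Y'" "m \<in> carrier (Mid S)" for y m
  proof -
    have "(\<lambda>(y', m). Proj S m) (n \<oplus>\<^bsub>prod_module Y' (Mid S)\<^esub> (y, m)) = Proj S m" if "n \<in> ?N" for n
      using that \<open>m \<in> _\<close> mod_hom_closed[OF i] mod_hom_closed[OF p]
      by (auto simp: pushout_submodule_def mod_hom_add[OF p] mod_hom_minus[OF assms(3,4) p] pi
          X.M.minus_zero_zero)
    moreover have "?N \<noteq> {}" using Y.M.zero_closed by (auto simp: pushout_submodule_def)
    moreover have "?j (y, m) = (\<lambda>n. n \<oplus>\<^bsub>prod_module Y' (Mid S)\<^esub> (y, m)) ` ?N"
      using Q(5) that by simp
    ultimately have "(\<lambda>(y', m). Proj S m) ` ?j (y, m) = {Proj S m}"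
      by (simp only: image_image) auto
    then show ?thesis by (simp add: pushout_ses_def)
  qed
  then show ?thesis
    using Q(1-4) by (intro exI[of _ ?j]) (auto simp: pushout_ses_def)
qed

lemma short_exact_pushout:
  fixes S :: "('r, 'y, 'm, 'x) ses" and Y' :: "('r, 'w) module"
  assumes S: "short_exact R Y X S" and Y': "left_module R Y'" and h: "h \<in> mod_hom R Y Y'"
  shows "short_exact R Y' X (pushout_ses Y Y' h S)"
    "\<And>W k s c. left_module R W \<Longrightarrow> cocycle_lift R Y W S k s c \<Longrightarrow>
      \<exists>t. cocycle_lift R Y' W (pushout_ses Y Y' h S) k t (\<lambda>r x x'. h (c r x x'))"
proof -
  note S' = short_exactD[OF S]
  interpret Y: left_module R Y by (rule S')
  interpret X: left_module R X by (rule S')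
  interpret Y': left_module R Y' by fact
  interpret M: left_module R "Mid S" by (rule S')
  let ?U = "pushout_ses Y Y' h S"
  have pi: "\<forall>y\<in>carrier Y. Proj S (Incl S y) = \<zero>\<^bsub>X\<^esub>" using S'(7) by blast
  obtain j where j': "left_module R (Mid ?U)" "j \<in> mod_hom R (prod_module Y' (Mid S)) (Mid ?U)"
    "j ` (carrier Y' \<times> carrier (Mid S)) = carrier (Mid ?U)"
    "\<forall>y\<in>carrier Y'. \<forall>m\<in>carrier (Mid S). j (y, m) = \<zero>\<^bsub>Mid ?U\<^esub> \<longleftrightarrow>
      (\<exists>a\<in>carrier Y. y = h a \<and> m = \<ominus>\<^bsub>Mid S\<^esub> Incl S a)"
    "\<forall>y\<in>carrier Y'. Incl ?U y = j (y, \<zero>\<^bsub>Mid S\<^esub>)"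
    "\<forall>y\<in>carrier Y'. \<forall>m\<in>carrier (Mid S). Proj ?U (j (y, m)) = Proj S m"
    using pushout_ses_proj[OF S'(1) Y' S'(2,3) h S'(4,5) pi] by (elim exE conjE) (rule that)
  note j = j'[rule_format]
  have P: "left_module R (prod_module Y' (Mid S))" by (rule left_module_prod[OF Y' S'(2)])
  interpret P: left_module R "prod_module Y' (Mid S)" by (rule P)
  interpret U: left_module R "Mid ?U" by (rule j)
  note ic = mod_hom_closed[OF S'(4)] and hc = mod_hom_closed[OF h]
  have jsurj: "\<exists>y\<in>carrier Y'. \<exists>m\<in>carrier (Mid S). u = j (y, m)" if "u \<in> carrier (Mid ?U)" for u
  proof -
    have "u \<in> j ` (carrier Y' \<times> carrier (Mid S))" using that j(3) by simp
    then show ?thesis by blast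
  qed
  have jlin: "j (r \<odot>\<^bsub>Y'\<^esub> y \<oplus>\<^bsub>Y'\<^esub> y', r \<odot>\<^bsub>Mid S\<^esub> m \<oplus>\<^bsub>Mid S\<^esub> m') =
      r \<odot>\<^bsub>Mid ?U\<^esub> j (y, m) \<oplus>\<^bsub>Mid ?U\<^esub> j (y', m')"
    if "r \<in> carrier R" "y \<in> carrier Y'" "y' \<in> carrier Y'" "m \<in> carrier (Mid S)" "m' \<in> carrier (Mid S)"
    for r y y' m m'
    using mod_hom_lin[OF P j(2), of r "(y, m)" "(y', m')"] that by simp
  have glue: "j (y, Incl S a \<oplus>\<^bsub>Mid S\<^esub> m) = j (y \<oplus>\<^bsub>Y'\<^esub> h a, m)"
    if "a \<in> carrier Y" "y \<in> carrier Y'" "m \<in> carrier (Mid S)" for a y m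
  proof -
    have "j (h a, \<ominus>\<^bsub>Mid S\<^esub> Incl S a) = \<zero>\<^bsub>Mid ?U\<^esub>" using j(4) that ic hc by blast
    then have "j ((y, Incl S a \<oplus>\<^bsub>Mid S\<^esub> m) \<oplus>\<^bsub>prod_module Y' (Mid S)\<^esub> (h a, \<ominus>\<^bsub>Mid S\<^esub> Incl S a)) =
        j (y, Incl S a \<oplus>\<^bsub>Mid S\<^esub> m)"
      using that ic hc mod_hom_closed[OF j(2)] by (subst mod_hom_add[OF j(2)]) auto
    moreover have "(Incl S a \<oplus>\<^bsub>Mid S\<^esub> m) \<oplus>\<^bsub>Mid S\<^esub> (\<ominus>\<^bsub>Mid S\<^esub> Incl S a) = m"
      using that ic by (simp add: M.M.a_ac M.M.r_neg1 M.M.r_neg2 M.M.r_neg)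
    ultimately show ?thesis by simp
  qed
  show "short_exact R Y' X ?U"
  proof (rule short_exactI)
    show "left_module R Y'" "left_module R (Mid ?U)" "left_module R X" by (fact Y' j S')+
    show "Incl ?U \<in> mod_hom R Y' (Mid ?U)"
    proof (rule mod_homI[OF Y' j(1)])
      show "Incl ?U y \<in> carrier (Mid ?U)" if "y \<in> carrier Y'" for y
        using that mod_hom_closed[OF j(2)] by (simp add: j(5))
      show "Incl ?U (r \<odot>\<^bsub>Y'\<^esub> y \<oplus>\<^bsub>Y'\<^esub> y') = r \<odot>\<^bsub>Mid ?U\<^esub> Incl ?U y \<oplus>\<^bsub>Mid ?U\<^esub> Incl ?U y'"
        if "r \<in> carrier R" "y \<in> carrier Y'" "y' \<in> carrier Y'" for r y y'
        using that jlin[of r y y' "\<zero>\<^bsub>Mid S\<^esub>" "\<zero>\<^bsub>Mid S\<^esub>"]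
        by (simp add: j(5) left_module_smult_zero[OF S'(2)])
    qed
    show "Proj ?U \<in> mod_hom R (Mid ?U) X"
    proof (rule mod_homI[OF j(1) S'(3)])
      show "Proj ?U u \<in> carrier X" if "u \<in> carrier (Mid ?U)" for u
        using jsurj[OF that] mod_hom_closed[OF S'(5)] by (auto simp: j(6))
      fix r u u' assume r: "r \<in> carrier R" and u: "u \<in> carrier (Mid ?U)" and u': "u' \<in> carrier (Mid ?U)"
      obtain y m where "u = j (y, m)" "y \<in> carrier Y'" "m \<in> carrier (Mid S)" using jsurj[OF u] by blast
      moreover obtain y' m' where "u' = j (y', m')" "y' \<in> carrier Y'" "m' \<in> carrier (Mid S)"
        using jsurj[OF u'] by blast
      ultimately show "Proj ?U (r \<odot>\<^bsub>Mid ?U\<^esub> u \<oplus>\<^bsub>Mid ?U\<^esub> u') = r \<odot>\<^bsub>X\<^esub> Proj ?U u \<oplus>\<^bsub>X\<^esub> Proj ?U u'"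
        using r by (simp add: jlin[symmetric] j(6) mod_hom_lin[OF S'(2,5)])
    qed
  next
    fix y assume y: "y \<in> carrier Y'" "Incl ?U y = \<zero>\<^bsub>Mid ?U\<^esub>"
    then obtain a where a: "a \<in> carrier Y" "y = h a" "\<zero>\<^bsub>Mid S\<^esub> = \<ominus>\<^bsub>Mid S\<^esub> Incl S a"
      using j(4)[of y "\<zero>\<^bsub>Mid S\<^esub>"] by (auto simp: j(5))
    then have "Incl S a = Incl S \<zero>\<^bsub>Y\<^esub>"
      using ic by (metis M.M.minus_minus M.M.minus_zero_zero mod_hom_zero[OF S'(1,2,4)])
    then have "a = \<zero>\<^bsub>Y\<^esub>" using S'(6) a by (auto dest: inj_onD)
    with a show "y = \<zero>\<^bsub>Y'\<^esub>" using mod_hom_zero[OF S'(1) Y' h] by simp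
  next
    fix y assume "y \<in> carrier Y'"
    then show "Proj ?U (Incl ?U y) = \<zero>\<^bsub>X\<^esub>" by (simp add: j(5,6) mod_hom_zero[OF S'(2,3,5)])
  next
    fix u assume u: "u \<in> carrier (Mid ?U)" "Proj ?U u = \<zero>\<^bsub>X\<^esub>"
    then obtain y m where ym: "u = j (y, m)" "y \<in> carrier Y'" "m \<in> carrier (Mid S)" using jsurj by blast
    then obtain a where a: "a \<in> carrier Y" "m = Incl S a" using u S'(8) by (auto simp: j(6))
    then have "u = j (y \<oplus>\<^bsub>Y'\<^esub> h a, \<zero>\<^bsub>Mid S\<^esub>)"
      using glue[of a y "\<zero>\<^bsub>Mid S\<^esub>"] ym ic by simp
    then show "\<exists>y\<in>carrier Y'. u = Incl ?U y"
      using ym a hc by (intro bexI[of _ "y \<oplus>\<^bsub>Y'\<^esub> h a"]) (auto simp: j(5))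
  next
    fix x assume "x \<in> carrier X"
    then obtain m where "m \<in> carrier (Mid S)" "x = Proj S m" using S'(9) by blast
    then show "\<exists>u\<in>carrier (Mid ?U). x = Proj ?U u"
      using mod_hom_closed[OF j(2)] by (intro bexI[of _ "j (\<zero>\<^bsub>Y'\<^esub>, m)"]) (auto simp: j(6))
  qed
  fix W k s c assume W: "left_module R W" and s: "cocycle_lift R Y W S k s c"
  have "(\<lambda>m. j (\<zero>\<^bsub>Y'\<^esub>, m)) \<in> mod_hom R (Mid S) (Mid ?U)"
  proof (rule mod_homI[OF S'(2) j(1)])
    show "j (\<zero>\<^bsub>Y'\<^esub>, m) \<in> carrier (Mid ?U)" if "m \<in> carrier (Mid S)" for m
      using that mod_hom_closed[OF j(2)] by simp
    show "j (\<zero>\<^bsub>Y'\<^esub>, r \<odot>\<^bsub>Mid S\<^esub> m \<oplus>\<^bsub>Mid S\<^esub> m') =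
      r \<odot>\<^bsub>Mid ?U\<^esub> j (\<zero>\<^bsub>Y'\<^esub>, m) \<oplus>\<^bsub>Mid ?U\<^esub> j (\<zero>\<^bsub>Y'\<^esub>, m')"
      if "r \<in> carrier R" "m \<in> carrier (Mid S)" "m' \<in> carrier (Mid S)" for r m m'
      using that jlin[of r "\<zero>\<^bsub>Y'\<^esub>" "\<zero>\<^bsub>Y'\<^esub>" m m'] by (simp add: left_module_smult_zero[OF Y'])
  qed
  moreover have "j (\<zero>\<^bsub>Y'\<^esub>, Incl S y) = Incl ?U (h y)" if "y \<in> carrier Y" for y
    using glue[of y "\<zero>\<^bsub>Y'\<^esub>" "\<zero>\<^bsub>Mid S\<^esub>"] that ic hc by (simp add: j(5))
  ultimately have "cocycle_lift R Y' W ?U (\<lambda>x. k x) (\<lambda>x. j (\<zero>\<^bsub>Y'\<^esub>, s x)) (\<lambda>r x x'. h (c r x x'))"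
    using cocycle_lift_push[of R Y W S k s c "\<lambda>m. j (\<zero>\<^bsub>Y'\<^esub>, m)" ?U h Y' "\<lambda>x. x"] W s S' hc
    by (simp add: j(6))
  then show "\<exists>t. cocycle_lift R Y' W ?U k t (\<lambda>r x x'. h (c r x x'))" by blast
qed

lemma short_exact_prod:
  assumes S: "short_exact R Y X S" and T: "short_exact R Y' X' T"
  shows "short_exact R (prod_module Y Y') (prod_module X X') (prod_ses S T)"
proof (rule short_exactI)
  note S' = short_exactD[OF S] and T' = short_exactD[OF T]
  show Y: "left_module R (prod_module Y Y')" and X: "left_module R (prod_module X X')"
    using S' T' left_module_prod by blast+
  show M: "left_module R (Mid (prod_ses S T))"
    using left_module_prod[OF S'(2) T'(2)] by (simp add: prod_ses_def)
  show "Incl (prod_ses S T) \<in> mod_hom R (prod_module Y Y') (Mid (prod_ses S T))"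
    using mod_hom_closed[OF S'(4)] mod_hom_closed[OF T'(4)]
    by (intro mod_homI[OF Y M]) (auto simp: prod_ses_def mod_hom_lin[OF S'(1,4)] mod_hom_lin[OF T'(1,4)])
  show "Proj (prod_ses S T) \<in> mod_hom R (Mid (prod_ses S T)) (prod_module X X')"
    using mod_hom_closed[OF S'(5)] mod_hom_closed[OF T'(5)]
    by (intro mod_homI[OF M X]) (auto simp: prod_ses_def mod_hom_lin[OF S'(2,5)] mod_hom_lin[OF T'(2,5)])
  show "y = \<zero>\<^bsub>prod_module Y Y'\<^esub>"
    if "y \<in> carrier (prod_module Y Y')" "Incl (prod_ses S T) y = \<zero>\<^bsub>Mid (prod_ses S T)\<^esub>" for y
  proof -
    have "\<zero>\<^bsub>Y\<^esub> \<in> carrier Y" "\<zero>\<^bsub>Y'\<^esub> \<in> carrier Y'"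
      using abelian_groupE(2) left_module_abelian_group S'(1) T'(1) by blast+
    then show ?thesis
      using that inj_onD[OF S'(6), of "fst y" "\<zero>\<^bsub>Y\<^esub>"] inj_onD[OF T'(6), of "snd y" "\<zero>\<^bsub>Y'\<^esub>"]
      by (auto simp: prod_ses_def mod_hom_zero[OF S'(1,2,4)] mod_hom_zero[OF T'(1,2,4)])
  qed
  show "Proj (prod_ses S T) (Incl (prod_ses S T) y) = \<zero>\<^bsub>prod_module X X'\<^esub>"
    if "y \<in> carrier (prod_module Y Y')" for y
    using that S'(7) T'(7) by (auto simp: prod_ses_def)
  show "\<exists>y\<in>carrier (prod_module Y Y'). m = Incl (prod_ses S T) y"
    if "m \<in> carrier (Mid (prod_ses S T))" "Proj (prod_ses S T) m = \<zero>\<^bsub>prod_module X X'\<^esub>" for m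
    using that S'(8)[of "fst m"] T'(8)[of "snd m"] by (fastforce simp: prod_ses_def)
  show "\<exists>m\<in>carrier (Mid (prod_ses S T)). x = Proj (prod_ses S T) m"
    if "x \<in> carrier (prod_module X X')" for x
    using that S'(9)[of "fst x"] T'(9)[of "snd x"] by (fastforce simp: prod_ses_def)
qed

lemma short_exact_baer_sum:
  assumes S: "short_exact R Y X S" and T: "short_exact R Y X T"
  shows "short_exact R Y X (baer_sum Y X S T)"
    "\<And>s t c d. cocycle_lift R Y X S (\<lambda>x. x) s c \<Longrightarrow> cocycle_lift R Y X T (\<lambda>x. x) t d \<Longrightarrow>
      \<exists>u. cocycle_lift R Y X (baer_sum Y X S T) (\<lambda>x. x) u (\<lambda>r x x'. c r x x' \<oplus>\<^bsub>Y\<^esub> d r x x')"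
proof -
  note S' = short_exactD[OF S] and T' = short_exactD[OF T]
  interpret Y: left_module R Y by (rule S')
  interpret X: left_module R X by (rule S')
  have YY: "left_module R (prod_module Y Y)" by (rule left_module_prod[OF S'(1) S'(1)])
  have diag: "(\<lambda>x. (x, x)) \<in> mod_hom R X (prod_module X X)"
    by (auto simp: mod_hom_def)
  have codiag: "(\<lambda>(y, y'). y \<oplus>\<^bsub>Y\<^esub> y') \<in> mod_hom R (prod_module Y Y) Y"
    by (auto simp: mod_hom_def Y.M.a_ac Y.smult_r_distr)
  let ?P = "pullback_ses X (\<lambda>x. (x, x)) (prod_ses S T)"
  have P: "short_exact R (prod_module Y Y) X ?P"
    by (rule short_exact_pullback[OF short_exact_prod[OF S T] S'(3) diag])
  show "short_exact R Y X (baer_sum Y X S T)"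
    unfolding baer_sum_def by (rule short_exact_pushout[OF P S'(1) codiag])
  fix s t c d assume s: "cocycle_lift R Y X S (\<lambda>x. x) s c" and t: "cocycle_lift R Y X T (\<lambda>x. x) t d"
  have "cocycle_lift R (prod_module Y Y) X (prod_ses S T) (\<lambda>x. (x, x)) (\<lambda>x. (s x, t x))
      (\<lambda>r x x'. (c r x x', d r x x'))"
    using cocycle_liftD[OF s] cocycle_liftD[OF t] by (simp add: cocycle_lift_def prod_ses_def)
  then have "cocycle_lift R (prod_module Y Y) X ?P (\<lambda>x. x) (\<lambda>x. ((s x, t x), x))
      (\<lambda>r x x'. (c r x x', d r x x'))"
    by (rule cocycle_lift_pullback[OF short_exact_prod[OF S T] S'(3) diag])
  from short_exact_pushout(2)[OF P S'(1) codiag S'(3) this]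
  show "\<exists>u. cocycle_lift R Y X (baer_sum Y X S T) (\<lambda>x. x) u (\<lambda>r x x'. c r x x' \<oplus>\<^bsub>Y\<^esub> d r x x')"
    by (simp add: baer_sum_def)
qed

lemma short_exact_split:
  assumes "left_module R Y" "left_module R X"
  shows "short_exact R Y X (split_ses Y X)"
    "cocycle_lift R Y X (split_ses Y X) (\<lambda>x. x) (\<lambda>x. (\<zero>\<^bsub>Y\<^esub>, x)) (\<lambda>r x x'. \<zero>\<^bsub>Y\<^esub>)"
proof -
  interpret Y: left_module R Y by fact
  interpret X: left_module R X by fact
  show "short_exact R Y X (split_ses Y X)"
  proof (rule short_exactI)
    show M: "left_module R (Mid (split_ses Y X))"
      using left_module_prod[OF assms] by (simp add: split_ses_def)
    show "Incl (split_ses Y X) \<in> mod_hom R Y (Mid (split_ses Y X))"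
      by (intro mod_homI[OF assms(1) M]) (auto simp: split_ses_def left_module_smult_zero[OF assms(2)])
    show "Proj (split_ses Y X) \<in> mod_hom R (Mid (split_ses Y X)) X"
      by (intro mod_homI[OF M assms(2)]) (auto simp: split_ses_def)
  qed (use assms in \<open>auto simp: split_ses_def\<close>)
  show "cocycle_lift R Y X (split_ses Y X) (\<lambda>x. x) (\<lambda>x. (\<zero>\<^bsub>Y\<^esub>, x)) (\<lambda>r x x'. \<zero>\<^bsub>Y\<^esub>)"
    by (simp add: cocycle_lift_def split_ses_def left_module_smult_zero[OF assms(1)])
qed

section \<open>The first extension group in terms of cocycles\<close>

definition ext_cocycle ::
  "('r, 'k) ring_scheme \<Rightarrow> ('r, 'y) module \<Rightarrow> ('r, 'x) module \<Rightarrow> ('r \<Rightarrow> 'x \<Rightarrow> 'x \<Rightarrow> 'y) \<Rightarrow> bool" where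
  "ext_cocycle R Y X c \<longleftrightarrow> (\<exists>(S :: ('r, 'y, 'y \<times> 'x, 'x) ses) s.
     short_exact R Y X S \<and> cocycle_lift R Y X S (\<lambda>x. x) s c)"

definition cocycle_class ::
  "('r, 'k) ring_scheme \<Rightarrow> ('r, 'y) module \<Rightarrow> ('r, 'x) module \<Rightarrow> ('r \<Rightarrow> 'x \<Rightarrow> 'x \<Rightarrow> 'y) \<Rightarrow>
    ('r, 'y, 'y \<times> 'x, 'x) ses set" where
  "cocycle_class R Y X c = {T. short_exact R Y X T \<and> (\<exists>s. cocycle_lift R Y X T (\<lambda>x. x) s c)}"

lemma ext_cocycleI:
  assumes S: "short_exact R Y X S" and s: "cocycle_lift R Y X S (\<lambda>x. x) s c"
  shows "ext_cocycle R Y X c"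
  using short_exact_retype[OF S] ses_equiv_cocycle_lift[OF S _ short_exactD(3)[OF S] s]
  unfolding ext_cocycle_def by blast

lemma ext_class_eq:
  assumes S: "short_exact R Y X S" and s: "cocycle_lift R Y X S (\<lambda>x. x) s c"
  shows "ext_class R X Y S = cocycle_class R Y X c"
  using ses_equiv_cocycle_lift[OF S _ short_exactD(3)[OF S] s] ses_equiv_if_cocycle[OF S s]
  unfolding ext_class_def cocycle_class_def by blast

lemma cocycle_class_eq:
  assumes "short_exact R Y X S" "cocycle_lift R Y X S (\<lambda>x. x) s c" "cocycle_lift R Y X S (\<lambda>x. x) t d"
  shows "cocycle_class R Y X c = cocycle_class R Y X d"
  using ext_class_eq[OF assms(1,2)] ext_class_eq[OF assms(1,3)] by simp

lemma cocycle_class_cong: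
  fixes R :: "('r, 'k) ring_scheme" and X :: "('r, 'x) module" and Y :: "('r, 'y) module"
  assumes X: "left_module R X" and "\<And>r x x'. r \<in> carrier R \<Longrightarrow> x \<in> carrier X \<Longrightarrow> x' \<in> carrier X \<Longrightarrow> c r x x' = d r x x'"
  shows "cocycle_class R Y X c = cocycle_class R Y X d"
proof -
  have "cocycle_lift R Y X T (\<lambda>x. x) s c \<longleftrightarrow> cocycle_lift R Y X T (\<lambda>x. x) s d"
    for T :: "('r, 'y, 'y \<times> 'x, 'x) ses" and s
    using cocycle_lift_cong[OF _ X, of Y T "\<lambda>x. x" s c "\<lambda>x. x" s d]
      cocycle_lift_cong[OF _ X, of Y T "\<lambda>x. x" s d "\<lambda>x. x" s c] assms(2) by force
  then show ?thesis by (simp add: cocycle_class_def)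
qed

lemma Ext1_carrier:
  fixes R :: "('r, 'k) ring_scheme" and X :: "('r, 'x) module" and Y :: "('r, 'y) module"
  shows "carrier (Ext1 R X Y) = cocycle_class R Y X ` {c. ext_cocycle R Y X c}"
proof -
  have 1: "\<exists>c. ext_cocycle R Y X c \<and> ext_class R X Y S = cocycle_class R Y X c"
    if "short_exact R Y X S" for S :: "('r, 'y, 'y \<times> 'x, 'x) ses"
    using cocycle_lift_exists[OF that] ext_cocycleI[OF that] ext_class_eq[OF that] by blast
  have 2: "\<exists>S :: ('r, 'y, 'y \<times> 'x, 'x) ses. short_exact R Y X S \<and> cocycle_class R Y X c = ext_class R X Y S"
    if "ext_cocycle R Y X c" for c
    using that ext_class_eq unfolding ext_cocycle_def by metis
  show ?thesis
  proof (intro equalityI subsetI)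
    fix A assume "A \<in> carrier (Ext1 R X Y)"
    then obtain S :: "('r, 'y, 'y \<times> 'x, 'x) ses"
      where "short_exact R Y X S" "A = ext_class R X Y S" by (auto simp: Ext1_def)
    with 1[of S] show "A \<in> cocycle_class R Y X ` {c. ext_cocycle R Y X c}" by auto
  next
    fix A assume "A \<in> cocycle_class R Y X ` {c. ext_cocycle R Y X c}"
    with 2 show "A \<in> carrier (Ext1 R X Y)" by (auto simp: Ext1_def)
  qed
qed

lemma Ext1_zero:
  assumes "left_module R Y" "left_module R X"
  shows "\<zero>\<^bsub>Ext1 R X Y\<^esub> = cocycle_class R Y X (\<lambda>r x x'. \<zero>\<^bsub>Y\<^esub>)" "ext_cocycle R Y X (\<lambda>r x x'. \<zero>\<^bsub>Y\<^esub>)"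
  using ext_class_eq[OF short_exact_split[OF assms]] ext_cocycleI[OF short_exact_split[OF assms]]
  by (auto simp: Ext1_def)

lemma Ext1_add:
  assumes c: "ext_cocycle R Y X c" and d: "ext_cocycle R Y X d"
  shows "cocycle_class R Y X c \<oplus>\<^bsub>Ext1 R X Y\<^esub> cocycle_class R Y X d =
      cocycle_class R Y X (\<lambda>r x x'. c r x x' \<oplus>\<^bsub>Y\<^esub> d r x x')"
    "ext_cocycle R Y X (\<lambda>r x x'. c r x x' \<oplus>\<^bsub>Y\<^esub> d r x x')"
proof -
  have *: "ext_class R X Y (baer_sum Y X S T) = cocycle_class R Y X (\<lambda>r x x'. c r x x' \<oplus>\<^bsub>Y\<^esub> d r x x')"
      "ext_cocycle R Y X (\<lambda>r x x'. c r x x' \<oplus>\<^bsub>Y\<^esub> d r x x')"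
    if "S \<in> cocycle_class R Y X c" "T \<in> cocycle_class R Y X d" for S T
  proof -
    obtain s t where S: "short_exact R Y X S" "cocycle_lift R Y X S (\<lambda>x. x) s c"
      and T: "short_exact R Y X T" "cocycle_lift R Y X T (\<lambda>x. x) t d"
      using \<open>S \<in> _\<close> \<open>T \<in> _\<close> unfolding cocycle_class_def by blast
    obtain u where u: "cocycle_lift R Y X (baer_sum Y X S T) (\<lambda>x. x) u (\<lambda>r x x'. c r x x' \<oplus>\<^bsub>Y\<^esub> d r x x')"
      using short_exact_baer_sum(2)[OF S(1) T(1) S(2) T(2)] by blast
    show "ext_class R X Y (baer_sum Y X S T) = cocycle_class R Y X (\<lambda>r x x'. c r x x' \<oplus>\<^bsub>Y\<^esub> d r x x')"
      "ext_cocycle R Y X (\<lambda>r x x'. c r x x' \<oplus>\<^bsub>Y\<^esub> d r x x')"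
      using ext_class_eq[OF short_exact_baer_sum(1)[OF S(1) T(1)] u]
        ext_cocycleI[OF short_exact_baer_sum(1)[OF S(1) T(1)] u] by auto
  qed
  obtain S0 T0 where ne: "S0 \<in> cocycle_class R Y X c" "T0 \<in> cocycle_class R Y X d"
    using c d unfolding ext_cocycle_def cocycle_class_def by blast
  show "ext_cocycle R Y X (\<lambda>r x x'. c r x x' \<oplus>\<^bsub>Y\<^esub> d r x x')" by (rule *(2)[OF ne])
  have "cocycle_class R Y X c \<oplus>\<^bsub>Ext1 R X Y\<^esub> cocycle_class R Y X d =
    (\<Union>S\<in>cocycle_class R Y X c. \<Union>T\<in>cocycle_class R Y X d.
      cocycle_class R Y X (\<lambda>r x x'. c r x x' \<oplus>\<^bsub>Y\<^esub> d r x x'))"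
    unfolding Ext1_def ring.simps using *(1) by (intro SUP_cong) auto
  then show "cocycle_class R Y X c \<oplus>\<^bsub>Ext1 R X Y\<^esub> cocycle_class R Y X d =
      cocycle_class R Y X (\<lambda>r x x'. c r x x' \<oplus>\<^bsub>Y\<^esub> d r x x')"
    using ne by auto
qed

text \<open>The cocycle of the pull-back may be computed from any lift of \<open>h\<close>, not only from a section
  composed with \<open>h\<close>. This freedom makes the action distribute over sums in \<open>End X\<close>.\<close>

lemma Ext1_smult:
  assumes S: "short_exact R Y X S" and s: "cocycle_lift R Y X S (\<lambda>x. x) s c"
    and h: "h \<in> mod_hom R X X" and t: "cocycle_lift R Y X S h t d"
  shows "h \<odot>\<^bsub>Ext1 R X Y\<^esub> cocycle_class R Y X c = cocycle_class R Y X d" "ext_cocycle R Y X d"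
proof -
  note X = short_exactD(3)[OF S]
  let ?d = "\<lambda>r x x'. c r (h x) (h x')"
  have pb: "short_exact R Y X (pullback_ses X h S)" by (rule short_exact_pullback[OF S X h])
  note pbt = cocycle_lift_pullback[OF S X h t]
  show "ext_cocycle R Y X d" by (rule ext_cocycleI[OF pb pbt])
  have d: "cocycle_class R Y X ?d = cocycle_class R Y X d"
    by (rule cocycle_class_eq[OF pb cocycle_lift_pullback[OF S X h cocycle_lift_comp[OF s X h]] pbt])
  have "ext_class R X Y (pullback_ses X h T) = cocycle_class R Y X d"
    if T': "T \<in> cocycle_class R Y X c" for T
  proof -
    obtain u where T: "short_exact R Y X T" "cocycle_lift R Y X T (\<lambda>x. x) u c"
      using T' unfolding cocycle_class_def by blast
    show ?thesis
      using ext_class_eq[OF short_exact_pullback[OF T(1) X h]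
          cocycle_lift_pullback[OF T(1) X h cocycle_lift_comp[OF T(2) X h]]] d by simp
  qed
  then have "h \<odot>\<^bsub>Ext1 R X Y\<^esub> cocycle_class R Y X c = (\<Union>S\<in>cocycle_class R Y X c. cocycle_class R Y X d)"
    by (simp add: Ext1_def)
  moreover have "cocycle_class R Y X c \<noteq> {}"
    using ext_cocycleI[OF S s] unfolding ext_cocycle_def cocycle_class_def by blast
  ultimately show "h \<odot>\<^bsub>Ext1 R X Y\<^esub> cocycle_class R Y X c = cocycle_class R Y X d" by auto
qed

lemma Ext1_smult_comp:
  fixes R :: "('r, 'k) ring_scheme" and X :: "('r, 'x) module" and Y :: "('r, 'y) module"
  assumes "left_module R X" "ext_cocycle R Y X c" "h \<in> mod_hom R X X"
  shows "h \<odot>\<^bsub>Ext1 R X Y\<^esub> cocycle_class R Y X c = cocycle_class R Y X (\<lambda>r x x'. c r (h x) (h x'))"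
    "ext_cocycle R Y X (\<lambda>r x x'. c r (h x) (h x'))"
proof -
  obtain S :: "('r, 'y, 'y \<times> 'x, 'x) ses" and s where "short_exact R Y X S" "cocycle_lift R Y X S (\<lambda>x. x) s c"
    using assms(2) unfolding ext_cocycle_def by blast
  from Ext1_smult[OF this assms(3) cocycle_lift_comp[OF this(2) assms(1,3)]]
  show "h \<odot>\<^bsub>Ext1 R X Y\<^esub> cocycle_class R Y X c = cocycle_class R Y X (\<lambda>r x x'. c r (h x) (h x'))"
    "ext_cocycle R Y X (\<lambda>r x x'. c r (h x) (h x'))" .
qed

lemma End_ring_simps [simp]:
  "carrier (End_ring R M) = mod_hom R M M \<inter> extensional (carrier M)"
  "f \<otimes>\<^bsub>End_ring R M\<^esub> g = compose (carrier M) g f"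
  "\<one>\<^bsub>End_ring R M\<^esub> = (\<lambda>x\<in>carrier M. x)"
  "\<zero>\<^bsub>End_ring R M\<^esub> = (\<lambda>x\<in>carrier M. \<zero>\<^bsub>M\<^esub>)"
  "f \<oplus>\<^bsub>End_ring R M\<^esub> g = (\<lambda>x\<in>carrier M. f x \<oplus>\<^bsub>M\<^esub> g x)"
  by (simp_all add: End_ring_def)

lemma left_module_Ext1:
  fixes R :: "('r, 'k) ring_scheme" and X :: "('r, 'x) module" and Y :: "('r, 'y) module"
  assumes X: "left_module R X" and Y: "left_module R Y" and K: "ring (End_ring R X)"
  shows "left_module (End_ring R X) (Ext1 R X Y)"
proof -
  let ?K = "End_ring R X" and ?E = "Ext1 R X Y" and ?c = "cocycle_class R Y X"
  interpret X: left_module R X by fact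
  interpret Y: left_module R Y by fact
  interpret K: ring ?K by fact
  have ex: "\<exists>(S :: ('r, 'y, 'y \<times> 'x, 'x) ses) s c. short_exact R Y X S \<and>
      cocycle_lift R Y X S (\<lambda>x. x) s c \<and> A = ?c c" if "A \<in> carrier ?E" for A
    using that unfolding Ext1_carrier ext_cocycle_def by blast
  have ec: "\<exists>c. ext_cocycle R Y X c \<and> A = ?c c" if "A \<in> carrier ?E" for A
    using that unfolding Ext1_carrier by blast
  have cl: "c r x x' \<in> carrier Y"
    if "ext_cocycle R Y X c" "r \<in> carrier R" "x \<in> carrier X" "x' \<in> carrier X" for c r x x'
    using that cocycle_liftD(3) unfolding ext_cocycle_def by metis
  have carr: "?c c \<in> carrier ?E" if "ext_cocycle R Y X c" for c
    using that unfolding Ext1_carrier by blast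
  note sm = Ext1_smult_comp[OF X] and z = Ext1_zero[OF Y X]
  have ldistr: "(f \<oplus>\<^bsub>?K\<^esub> g) \<odot>\<^bsub>?E\<^esub> A = (f \<odot>\<^bsub>?E\<^esub> A) \<oplus>\<^bsub>?E\<^esub> (g \<odot>\<^bsub>?E\<^esub> A)"
    if f: "f \<in> carrier ?K" and g: "g \<in> carrier ?K" and A: "A \<in> carrier ?E" for f g A
  proof -
    obtain S :: "('r, 'y, 'y \<times> 'x, 'x) ses" and s c where
      S: "short_exact R Y X S" "cocycle_lift R Y X S (\<lambda>x. x) s c" "A = ?c c"
      using ex[OF A] by blast
    have fg: "f \<in> mod_hom R X X" "g \<in> mod_hom R X X" using f g by auto
    have "f \<oplus>\<^bsub>?K\<^esub> g \<in> carrier ?K" using f g by (rule K.a_closed)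
    then have "f \<oplus>\<^bsub>?K\<^esub> g \<in> mod_hom R X X" by simp
    moreover have "cocycle_lift R Y X S (f \<oplus>\<^bsub>?K\<^esub> g) (\<lambda>x. s (f x) \<oplus>\<^bsub>Mid S\<^esub> s (g x))
        (\<lambda>r x x'. c r (f x) (f x') \<oplus>\<^bsub>Y\<^esub> c r (g x) (g x'))"
      by (rule cocycle_lift_cong[OF cocycle_lift_add[OF S(1) X cocycle_lift_comp[OF S(2) X fg(1)]
        cocycle_lift_comp[OF S(2) X fg(2)]] X]) auto
    ultimately have "(f \<oplus>\<^bsub>?K\<^esub> g) \<odot>\<^bsub>?E\<^esub> A = ?c (\<lambda>r x x'. c r (f x) (f x') \<oplus>\<^bsub>Y\<^esub> c r (g x) (g x'))"
      unfolding S(3) by (rule Ext1_smult(1)[OF S(1,2)])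
    also have "\<dots> = (f \<odot>\<^bsub>?E\<^esub> A) \<oplus>\<^bsub>?E\<^esub> (g \<odot>\<^bsub>?E\<^esub> A)"
      using sm[OF ext_cocycleI[OF S(1,2)]] fg by (simp add: S(3) Ext1_add)
    finally show ?thesis .
  qed
  have one: "\<one>\<^bsub>?K\<^esub> \<odot>\<^bsub>?E\<^esub> A = A" if A: "A \<in> carrier ?E" for A
  proof -
    obtain c where c: "ext_cocycle R Y X c" "A = ?c c" using ec[OF A] by blast
    have "\<one>\<^bsub>?K\<^esub> \<in> mod_hom R X X" using K.one_closed by simp
    then have "\<one>\<^bsub>?K\<^esub> \<odot>\<^bsub>?E\<^esub> A = ?c (\<lambda>r x x'. c r (\<one>\<^bsub>?K\<^esub> x) (\<one>\<^bsub>?K\<^esub> x'))"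
      unfolding c(2) by (rule sm(1)[OF c(1)])
    also have "\<dots> = ?c c" by (rule cocycle_class_cong[OF X]) auto
    finally show ?thesis using c by simp
  qed
  have zero: "\<zero>\<^bsub>?K\<^esub> \<odot>\<^bsub>?E\<^esub> A = \<zero>\<^bsub>?E\<^esub>" if A: "A \<in> carrier ?E" for A
  proof -
    obtain S :: "('r, 'y, 'y \<times> 'x, 'x) ses" and s c where
      S: "short_exact R Y X S" "cocycle_lift R Y X S (\<lambda>x. x) s c" "A = ?c c"
      using ex[OF A] by blast
    have "\<zero>\<^bsub>?K\<^esub> \<in> mod_hom R X X" using K.zero_closed by simp
    moreover have "cocycle_lift R Y X S \<zero>\<^bsub>?K\<^esub> (\<lambda>x. \<zero>\<^bsub>Mid S\<^esub>) (\<lambda>r x x'. \<zero>\<^bsub>Y\<^esub>)"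
      by (rule cocycle_lift_cong[OF cocycle_lift_zero[OF S(1) X] X]) auto
    ultimately show ?thesis unfolding S(3) z(1) by (rule Ext1_smult(1)[OF S(1,2)])
  qed
  have closed: "f \<odot>\<^bsub>?E\<^esub> A \<in> carrier ?E" if "f \<in> carrier ?K" "A \<in> carrier ?E" for f A
  proof -
    obtain c where "ext_cocycle R Y X c" "A = ?c c" using ec[OF \<open>A \<in> _\<close>] by blast
    moreover have "f \<in> mod_hom R X X" using \<open>f \<in> _\<close> by simp
    ultimately show ?thesis using sm carr by metis
  qed
  show ?thesis
  proof (rule left_moduleI)
    show "ring ?K" by fact
    show "\<zero>\<^bsub>?E\<^esub> \<in> carrier ?E" using z carr by simp
    show "A \<oplus>\<^bsub>?E\<^esub> B \<in> carrier ?E" if "A \<in> carrier ?E" "B \<in> carrier ?E" for A B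
      using ec[OF that(1)] ec[OF that(2)] carr by (auto simp: Ext1_add)
    show "(A \<oplus>\<^bsub>?E\<^esub> B) \<oplus>\<^bsub>?E\<^esub> C = A \<oplus>\<^bsub>?E\<^esub> (B \<oplus>\<^bsub>?E\<^esub> C)"
      if A: "A \<in> carrier ?E" and B: "B \<in> carrier ?E" and C: "C \<in> carrier ?E" for A B C
    proof -
      obtain a b c where "ext_cocycle R Y X a" "A = ?c a" "ext_cocycle R Y X b" "B = ?c b"
          "ext_cocycle R Y X c" "C = ?c c"
        using ec[OF A] ec[OF B] ec[OF C] by blast
      then show ?thesis
        by (simp add: Ext1_add) (intro cocycle_class_cong[OF X], simp add: Y.M.a_assoc cl)
    qed
    show "A \<oplus>\<^bsub>?E\<^esub> B = B \<oplus>\<^bsub>?E\<^esub> A" if A: "A \<in> carrier ?E" and B: "B \<in> carrier ?E" for A B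
    proof -
      obtain a b where "ext_cocycle R Y X a" "A = ?c a" "ext_cocycle R Y X b" "B = ?c b"
        using ec[OF A] ec[OF B] by blast
      then show ?thesis
        by (simp add: Ext1_add) (intro cocycle_class_cong[OF X], simp add: Y.M.a_comm cl)
    qed
    show "\<zero>\<^bsub>?E\<^esub> \<oplus>\<^bsub>?E\<^esub> A = A" if A: "A \<in> carrier ?E" for A
    proof -
      obtain a where "ext_cocycle R Y X a" "A = ?c a" using ec[OF A] by blast
      then show ?thesis
        unfolding z(1) by (simp add: Ext1_add z(2)) (intro cocycle_class_cong[OF X], simp add: cl)
    qed
    show "\<exists>B\<in>carrier ?E. B \<oplus>\<^bsub>?E\<^esub> A = \<zero>\<^bsub>?E\<^esub>" if A: "A \<in> carrier ?E" for A
    proof (rule bexI)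
      have "(\<ominus>\<^bsub>?K\<^esub> \<one>\<^bsub>?K\<^esub>) \<odot>\<^bsub>?E\<^esub> A \<oplus>\<^bsub>?E\<^esub> A =
          (\<ominus>\<^bsub>?K\<^esub> \<one>\<^bsub>?K\<^esub>) \<odot>\<^bsub>?E\<^esub> A \<oplus>\<^bsub>?E\<^esub> \<one>\<^bsub>?K\<^esub> \<odot>\<^bsub>?E\<^esub> A"
        by (simp only: one[OF A])
      also have "\<dots> = (\<ominus>\<^bsub>?K\<^esub> \<one>\<^bsub>?K\<^esub> \<oplus>\<^bsub>?K\<^esub> \<one>\<^bsub>?K\<^esub>) \<odot>\<^bsub>?E\<^esub> A"
        by (rule ldistr[symmetric]) (fact K.a_inv_closed[OF K.one_closed] K.one_closed A)+
      also have "\<dots> = \<zero>\<^bsub>?E\<^esub>"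
        by (simp only: K.l_neg[OF K.one_closed] zero[OF A])
      finally show "(\<ominus>\<^bsub>?K\<^esub> \<one>\<^bsub>?K\<^esub>) \<odot>\<^bsub>?E\<^esub> A \<oplus>\<^bsub>?E\<^esub> A = \<zero>\<^bsub>?E\<^esub>" .
      show "(\<ominus>\<^bsub>?K\<^esub> \<one>\<^bsub>?K\<^esub>) \<odot>\<^bsub>?E\<^esub> A \<in> carrier ?E"
        by (rule closed) (fact K.a_inv_closed[OF K.one_closed] A)+
    qed
    show "f \<odot>\<^bsub>?E\<^esub> (A \<oplus>\<^bsub>?E\<^esub> B) = f \<odot>\<^bsub>?E\<^esub> A \<oplus>\<^bsub>?E\<^esub> f \<odot>\<^bsub>?E\<^esub> B"
      if f: "f \<in> carrier ?K" and A: "A \<in> carrier ?E" and B: "B \<in> carrier ?E" for f A B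
    proof -
      obtain a b where "ext_cocycle R Y X a" "A = ?c a" "ext_cocycle R Y X b" "B = ?c b"
        using ec[OF A] ec[OF B] by blast
      then show ?thesis using f by (simp add: Ext1_add sm)
    qed
    show "(f \<otimes>\<^bsub>?K\<^esub> g) \<odot>\<^bsub>?E\<^esub> A = f \<odot>\<^bsub>?E\<^esub> (g \<odot>\<^bsub>?E\<^esub> A)"
      if f: "f \<in> carrier ?K" and g: "g \<in> carrier ?K" and A: "A \<in> carrier ?E" for f g A
    proof -
      obtain c where c: "ext_cocycle R Y X c" "A = ?c c" using ec[OF A] by blast
      have "f \<otimes>\<^bsub>?K\<^esub> g \<in> mod_hom R X X" using K.m_closed[OF f g] by simp
      then have "(f \<otimes>\<^bsub>?K\<^esub> g) \<odot>\<^bsub>?E\<^esub> A = ?c (\<lambda>r x x'. c r ((f \<otimes>\<^bsub>?K\<^esub> g) x) ((f \<otimes>\<^bsub>?K\<^esub> g) x'))"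
        unfolding c(2) by (rule sm(1)[OF c(1)])
      also have "\<dots> = ?c (\<lambda>r x x'. c r (g (f x)) (g (f x')))"
        by (rule cocycle_class_cong[OF X]) (simp add: compose_def)
      also have "\<dots> = f \<odot>\<^bsub>?E\<^esub> (g \<odot>\<^bsub>?E\<^esub> A)" using f g by (simp add: c sm)
      finally show ?thesis .
    qed
  qed (fact ldistr one closed)+
qed

lemma Ext1_finsum:
  fixes R :: "('r, 'k) ring_scheme" and X :: "('r, 'x) module" and Y :: "('r, 'y) module"
  assumes X: "left_module R X" and Y: "left_module R Y" and K: "ring (End_ring R X)"
    and "finite F" "\<And>i. i \<in> F \<Longrightarrow> ext_cocycle R Y X (c i)"
  shows "(\<Oplus>\<^bsub>Ext1 R X Y\<^esub>i\<in>F. cocycle_class R Y X (c i)) = cocycle_class R Y X (\<lambda>r x x'. \<Oplus>\<^bsub>Y\<^esub>i\<in>F. c i r x x')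
    \<and> ext_cocycle R Y X (\<lambda>r x x'. \<Oplus>\<^bsub>Y\<^esub>i\<in>F. c i r x x')"
  using assms(4,5)
proof (induction F rule: finite_induct)
  interpret Y: left_module R Y by fact
  interpret E: left_module "End_ring R X" "Ext1 R X Y" by (rule left_module_Ext1[OF X Y K])
  case empty
  show ?case using Ext1_zero[OF Y X] by simp
next
  interpret Y: left_module R Y by fact
  interpret E: left_module "End_ring R X" "Ext1 R X Y" by (rule left_module_Ext1[OF X Y K])
  case (insert i F)
  let ?s = "\<lambda>r x x'. \<Oplus>\<^bsub>Y\<^esub>i\<in>F. c i r x x'"
  have IH: "(\<Oplus>\<^bsub>Ext1 R X Y\<^esub>i\<in>F. cocycle_class R Y X (c i)) = cocycle_class R Y X ?s" "ext_cocycle R Y X ?s"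
    using insert by auto
  have cl: "c j r x x' \<in> carrier Y"
    if "j \<in> insert i F" "r \<in> carrier R" "x \<in> carrier X" "x' \<in> carrier X" for j r x x'
    using insert.prems[OF that(1)] that cocycle_liftD(3) unfolding ext_cocycle_def by metis
  have carr: "cocycle_class R Y X (c j) \<in> carrier (Ext1 R X Y)" if "j \<in> insert i F" for j
    using insert.prems[OF that] unfolding Ext1_carrier by blast
  have ci: "ext_cocycle R Y X (c i)" using insert.prems by simp
  have eq: "c i r x x' \<oplus>\<^bsub>Y\<^esub> ?s r x x' = (\<Oplus>\<^bsub>Y\<^esub>i\<in>insert i F. c i r x x')"
    if "r \<in> carrier R" "x \<in> carrier X" "x' \<in> carrier X" for r x x'
    using cl that insert.hyps by (intro Y.M.finsum_insert[symmetric]) auto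
  have "(\<Oplus>\<^bsub>Ext1 R X Y\<^esub>i\<in>insert i F. cocycle_class R Y X (c i)) =
      cocycle_class R Y X (c i) \<oplus>\<^bsub>Ext1 R X Y\<^esub> cocycle_class R Y X ?s"
    unfolding IH(1)[symmetric] using insert.hyps carr by (intro E.M.finsum_insert) auto
  also have "\<dots> = cocycle_class R Y X (\<lambda>r x x'. c i r x x' \<oplus>\<^bsub>Y\<^esub> ?s r x x')"
    by (rule Ext1_add(1)[OF ci IH(2)])
  also have "\<dots> = cocycle_class R Y X (\<lambda>r x x'. \<Oplus>\<^bsub>Y\<^esub>i\<in>insert i F. c i r x x')"
    by (rule cocycle_class_cong[OF X eq])
  finally have 1: "(\<Oplus>\<^bsub>Ext1 R X Y\<^esub>i\<in>insert i F. cocycle_class R Y X (c i)) = \<dots>" .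
  obtain S :: "('r, 'y, 'y \<times> 'x, 'x) ses" and s where S: "short_exact R Y X S"
      "cocycle_lift R Y X S (\<lambda>x. x) s (\<lambda>r x x'. c i r x x' \<oplus>\<^bsub>Y\<^esub> ?s r x x')"
    using Ext1_add(2)[OF ci IH(2)] unfolding ext_cocycle_def by blast
  have "cocycle_lift R Y X S (\<lambda>x. x) s (\<lambda>r x x'. \<Oplus>\<^bsub>Y\<^esub>i\<in>insert i F. c i r x x')"
    by (rule cocycle_lift_cong[OF S(2) X]) (simp_all add: eq)
  with 1 S(1) show ?case using ext_cocycleI by blast
qed

section \<open>Change of basis\<close>

definition coordinates ::
  "('k, 'l) ring_scheme \<Rightarrow> ('k, 'v) module \<Rightarrow> 'i set \<Rightarrow> ('i \<Rightarrow> 'v) \<Rightarrow> 'v \<Rightarrow> 'i set \<Rightarrow> ('i \<Rightarrow> 'k) \<Rightarrow> bool" where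
  "coordinates K V I b v F c \<longleftrightarrow> finite F \<and> F \<subseteq> I \<and> (\<forall>j. c j \<in> carrier K) \<and>
     (\<forall>j. j \<notin> F \<longrightarrow> c j = \<zero>\<^bsub>K\<^esub>) \<and> v = (\<Oplus>\<^bsub>V\<^esub>j\<in>F. c j \<odot>\<^bsub>V\<^esub> b j)"

lemma module_basis_closed: "module_basis K V I b \<Longrightarrow> i \<in> I \<Longrightarrow> b i \<in> carrier V"
  by (auto simp: module_basis_def)

lemma module_basis_independent:
  assumes "module_basis K V I b" "finite F" "F \<subseteq> I" "c \<in> F \<rightarrow> carrier K"
    and "(\<Oplus>\<^bsub>V\<^esub>i\<in>F. c i \<odot>\<^bsub>V\<^esub> b i) = \<zero>\<^bsub>V\<^esub>" "i \<in> F"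
  shows "c i = \<zero>\<^bsub>K\<^esub>"
  using assms(1)[unfolded module_basis_def, THEN conjunct2, THEN conjunct1, rule_format, of F c i] assms(2-6)
  by simp

lemma coordinates_exist:
  assumes V: "left_module K V" and b: "module_basis K V I b" and v: "v \<in> carrier V"
  shows "\<exists>F c. coordinates K V I b v F c"
proof -
  interpret V: left_module K V by fact
  obtain F c where F: "finite F" "F \<subseteq> I" "c \<in> F \<rightarrow> carrier K" "v = (\<Oplus>\<^bsub>V\<^esub>i\<in>F. c i \<odot>\<^bsub>V\<^esub> b i)"
    using b[unfolded module_basis_def, THEN conjunct2, THEN conjunct2, rule_format, OF v] by (elim exE conjE)
  have "b i \<in> carrier V" if "i \<in> F" for i using that F module_basis_closed[OF b] by blast
  then have "v = (\<Oplus>\<^bsub>V\<^esub>j\<in>F. (if j \<in> F then c j else \<zero>\<^bsub>K\<^esub>) \<odot>\<^bsub>V\<^esub> b j)"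
    using F(1-3) unfolding F(4) by (intro V.M.finsum_cong') (auto simp: Pi_iff)
  then have "coordinates K V I b v F (\<lambda>j. if j \<in> F then c j else \<zero>\<^bsub>K\<^esub>)"
    using F by (auto simp: coordinates_def)
  then show ?thesis by blast
qed

lemma module_basis_unique:
  assumes V: "left_module K V" and b: "module_basis K V I b" and F: "finite F" "F \<subseteq> I"
    and c: "\<And>i. i \<in> F \<Longrightarrow> c i \<in> carrier K" and d: "\<And>i. i \<in> F \<Longrightarrow> d i \<in> carrier K"
    and eq: "(\<Oplus>\<^bsub>V\<^esub>i\<in>F. c i \<odot>\<^bsub>V\<^esub> b i) = (\<Oplus>\<^bsub>V\<^esub>i\<in>F. d i \<odot>\<^bsub>V\<^esub> b i)" and i: "i \<in> F"
  shows "c i = d i"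
proof -
  interpret V: left_module K V by fact
  have bc: "b i \<in> carrier V" if "i \<in> F" for i using that F module_basis_closed[OF b] by blast
  let ?e = "\<lambda>i. c i \<ominus>\<^bsub>K\<^esub> d i"
  have e: "?e i \<in> carrier K" "?e i \<oplus>\<^bsub>K\<^esub> d i = c i" if "i \<in> F" for i
    using c[OF that] d[OF that] by (simp_all add: V.R.minus_eq V.R.a_assoc V.R.l_neg)
  have cl: "(\<lambda>i. ?e i \<odot>\<^bsub>V\<^esub> b i) \<in> F \<rightarrow> carrier V" "(\<lambda>i. d i \<odot>\<^bsub>V\<^esub> b i) \<in> F \<rightarrow> carrier V"
      "(\<lambda>i. c i \<odot>\<^bsub>V\<^esub> b i) \<in> F \<rightarrow> carrier V"
    using e bc c d by auto
  have "(\<Oplus>\<^bsub>V\<^esub>i\<in>F. ?e i \<odot>\<^bsub>V\<^esub> b i) \<oplus>\<^bsub>V\<^esub> (\<Oplus>\<^bsub>V\<^esub>i\<in>F. d i \<odot>\<^bsub>V\<^esub> b i) =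
      (\<Oplus>\<^bsub>V\<^esub>i\<in>F. ?e i \<odot>\<^bsub>V\<^esub> b i \<oplus>\<^bsub>V\<^esub> d i \<odot>\<^bsub>V\<^esub> b i)"
    using cl by (intro V.M.finsum_addf[symmetric])
  also have "\<dots> = (\<Oplus>\<^bsub>V\<^esub>i\<in>F. c i \<odot>\<^bsub>V\<^esub> b i)"
    using cl e bc d by (intro V.M.finsum_cong') (auto simp: V.smult_l_distr[symmetric])
  finally have "(\<Oplus>\<^bsub>V\<^esub>i\<in>F. ?e i \<odot>\<^bsub>V\<^esub> b i) \<oplus>\<^bsub>V\<^esub> (\<Oplus>\<^bsub>V\<^esub>i\<in>F. d i \<odot>\<^bsub>V\<^esub> b i) = (\<Oplus>\<^bsub>V\<^esub>i\<in>F. d i \<odot>\<^bsub>V\<^esub> b i)"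
    using eq by simp
  then have "(\<Oplus>\<^bsub>V\<^esub>i\<in>F. ?e i \<odot>\<^bsub>V\<^esub> b i) = \<zero>\<^bsub>V\<^esub>"
    using V.M.finsum_closed[OF cl(1)] V.M.finsum_closed[OF cl(2)] by simp
  then have "?e i = \<zero>\<^bsub>K\<^esub>"
    using e i by (intro module_basis_independent[OF b F]) auto
  then show ?thesis using c[OF i] d[OF i] by (simp add: V.R.minus_eq_zeroD)
qed

lemma basis_change_inverse:
  assumes V: "left_module K V" and b: "module_basis K V I b" and b': "module_basis K V I b'"
    and c: "\<And>i. i \<in> I \<Longrightarrow> coordinates K V I b (b' i) (F i) (c i)"
    and d: "\<And>i. i \<in> I \<Longrightarrow> coordinates K V I b' (b i) (G i) (d i)"
    and i: "i \<in> I" and k: "k \<in> I"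
  shows "(\<Oplus>\<^bsub>K\<^esub>j\<in>F i. c i j \<otimes>\<^bsub>K\<^esub> d j k) = (if k = i then \<one>\<^bsub>K\<^esub> else \<zero>\<^bsub>K\<^esub>)"
proof -
  interpret V: left_module K V by fact
  have bc: "b j \<in> carrier V" "b' j \<in> carrier V" if "j \<in> I" for j
    using that module_basis_closed[OF b] module_basis_closed[OF b'] by blast+
  have F: "finite (F i)" "F i \<subseteq> I" "\<And>j. c i j \<in> carrier K" "b' i = (\<Oplus>\<^bsub>V\<^esub>j\<in>F i. c i j \<odot>\<^bsub>V\<^esub> b j)"
    using c[OF i] by (auto simp: coordinates_def)
  have G: "finite (G j)" "G j \<subseteq> I" "\<And>l. d j l \<in> carrier K" "\<And>l. l \<notin> G j \<Longrightarrow> d j l = \<zero>\<^bsub>K\<^esub>"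
      "b j = (\<Oplus>\<^bsub>V\<^esub>l\<in>G j. d j l \<odot>\<^bsub>V\<^esub> b' l)" if "j \<in> F i" for j
    using d[of j] that F(2) by (auto simp: coordinates_def)
  define T where "T = insert i (insert k (\<Union>j\<in>F i. G j))"
  have T: "finite T" "T \<subseteq> I" "i \<in> T" "k \<in> T" "\<And>j. j \<in> F i \<Longrightarrow> G j \<subseteq> T"
    using F(1) G(1,2) i k by (auto simp: T_def)
  have bT: "b' l \<in> carrier V" if "l \<in> T" for l using that T(2) bc(2) by auto
  have bj: "b j = (\<Oplus>\<^bsub>V\<^esub>l\<in>T. d j l \<odot>\<^bsub>V\<^esub> b' l)" if j: "j \<in> F i" for j
    unfolding G(5)[OF j] using T G[OF j] bT
    by (intro V.M.add.finprod_mono_neutral_cong_left)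
      (auto simp: left_module_zero_smult[OF V] dest: T(5)[OF j, THEN subsetD])
  let ?e = "\<lambda>l. \<Oplus>\<^bsub>K\<^esub>j\<in>F i. c i j \<otimes>\<^bsub>K\<^esub> d j l"
  have cd: "(\<lambda>j. c i j \<otimes>\<^bsub>K\<^esub> d j l) \<in> F i \<rightarrow> carrier K" for l using F(3) G(3) by auto
  have "b' i = (\<Oplus>\<^bsub>V\<^esub>j\<in>F i. \<Oplus>\<^bsub>V\<^esub>l\<in>T. (c i j \<otimes>\<^bsub>K\<^esub> d j l) \<odot>\<^bsub>V\<^esub> b' l)"
    unfolding F(4)
  proof (rule V.M.finsum_cong'[OF refl])
    show "(\<lambda>j. \<Oplus>\<^bsub>V\<^esub>l\<in>T. (c i j \<otimes>\<^bsub>K\<^esub> d j l) \<odot>\<^bsub>V\<^esub> b' l) \<in> F i \<rightarrow> carrier V"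
      using F(3) G(3) bT by (auto intro!: V.M.finsum_closed)
    fix j assume j: "j \<in> F i"
    have "c i j \<odot>\<^bsub>V\<^esub> b j = (\<Oplus>\<^bsub>V\<^esub>l\<in>T. c i j \<odot>\<^bsub>V\<^esub> (d j l \<odot>\<^bsub>V\<^esub> b' l))"
      unfolding bj[OF j] using G(3)[OF j] bT by (intro left_module_finsum_smult[OF V F(3)]) auto
    also have "\<dots> = (\<Oplus>\<^bsub>V\<^esub>l\<in>T. (c i j \<otimes>\<^bsub>K\<^esub> d j l) \<odot>\<^bsub>V\<^esub> b' l)"
      using F(3) G(3)[OF j] bT by (intro V.M.finsum_cong') (auto simp: V.smult_assoc)
    finally show "c i j \<odot>\<^bsub>V\<^esub> b j = \<dots>" .
  qed
  also have "\<dots> = (\<Oplus>\<^bsub>V\<^esub>l\<in>T. \<Oplus>\<^bsub>V\<^esub>j\<in>F i. (c i j \<otimes>\<^bsub>K\<^esub> d j l) \<odot>\<^bsub>V\<^esub> b' l)"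
    using F G(3) T(1) bT by (intro V.M.finsum_swap) auto
  also have "\<dots> = (\<Oplus>\<^bsub>V\<^esub>l\<in>T. ?e l \<odot>\<^bsub>V\<^esub> b' l)"
    using cd bT by (intro V.M.finsum_cong')
      (auto simp: left_module_finsum_smult_left[OF V] intro!: V.smult_closed V.R.finsum_closed)
  finally have 1: "b' i = (\<Oplus>\<^bsub>V\<^esub>l\<in>T. ?e l \<odot>\<^bsub>V\<^esub> b' l)" .
  have "(\<Oplus>\<^bsub>V\<^esub>l\<in>T. (if l = i then \<one>\<^bsub>K\<^esub> else \<zero>\<^bsub>K\<^esub>) \<odot>\<^bsub>V\<^esub> b' l) = (\<Oplus>\<^bsub>V\<^esub>l\<in>T. if i = l then b' l else \<zero>\<^bsub>V\<^esub>)"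
    using bT by (intro V.M.finsum_cong') (auto simp: left_module_zero_smult[OF V])
  also have "\<dots> = b' i"
    using T bT by (intro V.M.finsum_singleton) auto
  finally have 2: "(\<Oplus>\<^bsub>V\<^esub>l\<in>T. (if l = i then \<one>\<^bsub>K\<^esub> else \<zero>\<^bsub>K\<^esub>) \<odot>\<^bsub>V\<^esub> b' l) = b' i" .
  have "?e l \<in> carrier K" for l using cd by (rule V.R.finsum_closed)
  then show ?thesis
    using 1 2 by (intro module_basis_unique[OF V b' T(1,2) _ _ _ T(4)]) auto
qed

section \<open>Push-outs of direct sums along the summation map\<close>

lemma direct_sum_componentwise_hom:
  assumes "ring R" "\<And>j. j \<in> J \<Longrightarrow> left_module R (M j)" "\<And>j. j \<in> J \<Longrightarrow> left_module R (N j)"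
    and f: "\<And>j. j \<in> J \<Longrightarrow> f j \<in> mod_hom R (M j) (N j)"
  shows "(\<lambda>x. \<lambda>j\<in>J. f j (x j)) \<in> mod_hom R (direct_sum J M) (direct_sum J N)"
proof (rule mod_homI)
  show "left_module R (direct_sum J M)" "left_module R (direct_sum J N)"
    using left_module_direct_sum assms(1-3) by blast+
  fix x assume x: "x \<in> carrier (direct_sum J M)"
  then have pt: "x j \<in> carrier (M j)" if "j \<in> J" for j using that by (auto simp: PiE_iff)
  have "{j \<in> J. (\<lambda>j\<in>J. f j (x j)) j \<noteq> \<zero>\<^bsub>N j\<^esub>} \<subseteq> {j \<in> J. x j \<noteq> \<zero>\<^bsub>M j\<^esub>}"
    using mod_hom_zero[OF assms(2,3) f] by auto
  moreover have "finite {j \<in> J. x j \<noteq> \<zero>\<^bsub>M j\<^esub>}" using x by simp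
  ultimately have "finite {j \<in> J. (\<lambda>j\<in>J. f j (x j)) j \<noteq> \<zero>\<^bsub>N j\<^esub>}" by (rule finite_subset)
  then show "(\<lambda>j\<in>J. f j (x j)) \<in> carrier (direct_sum J N)"
    using pt mod_hom_closed[OF f] by (simp add: PiE_iff)
  fix r y assume r: "r \<in> carrier R" and y: "y \<in> carrier (direct_sum J M)"
  then have pty: "y j \<in> carrier (M j)" if "j \<in> J" for j using that by (auto simp: PiE_iff)
  show "(\<lambda>j\<in>J. f j ((r \<odot>\<^bsub>direct_sum J M\<^esub> x \<oplus>\<^bsub>direct_sum J M\<^esub> y) j)) =
      r \<odot>\<^bsub>direct_sum J N\<^esub> (\<lambda>j\<in>J. f j (x j)) \<oplus>\<^bsub>direct_sum J N\<^esub> (\<lambda>j\<in>J. f j (y j))"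
    using r pt pty by (simp add: mod_hom_lin[OF assms(2) f] cong: restrict_cong)
qed

lemma direct_sum_componentwise_inj:
  assumes "\<And>k. k \<in> J \<Longrightarrow> f k \<zero>\<^bsub>M k\<^esub> = \<zero>\<^bsub>N k\<^esub>"
  shows "(\<lambda>k\<in>J. f k (direct_sum_inj J M j x k)) = direct_sum_inj J N j (f j x)"
  using assms by (auto simp: direct_sum_inj_def intro!: restrict_ext)

lemma summation_map_eq: "summation_map J Y = direct_sum_map J (\<lambda>_. Y) Y (\<lambda>_ y. y)"
  by (rule ext) (simp add: summation_map_def direct_sum_map_def)

lemma summation_map_hom:
  assumes "left_module R Y"
  shows "summation_map J Y \<in> mod_hom R (direct_sum J (\<lambda>_. Y)) Y"
  unfolding summation_map_eq
  by (rule direct_sum_map_hom) (use assms left_module_ring in \<open>auto simp: mod_hom_def\<close>)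

context
  fixes R :: "('r, 'k) ring_scheme" and Y :: "('r, 'y) module" and J :: "'j set"
    and X :: "'j \<Rightarrow> ('r, 'x) module" and e :: "'j \<Rightarrow> ('r, 'y, 'm, 'x) ses"
    and S :: "('r, 'y, 'z, 'j \<Rightarrow> 'x) ses"
  assumes Y: "left_module R Y"
    and e: "\<And>j. j \<in> J \<Longrightarrow> short_exact R Y (X j) (e j)"
    and S: "short_exact R Y (direct_sum J X) S"
    and equiv: "ses_equiv R Y
      (pushout_ses (direct_sum J (\<lambda>_. Y)) Y (summation_map J Y) (direct_sum_ses J e)) S"
begin

private abbreviation (input) "M \<equiv> direct_sum J (\<lambda>j. Mid (e j))"

private abbreviation (input) "\<iota> \<equiv> \<lambda>y. \<lambda>j\<in>J. Incl (e j) (y j)"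

private abbreviation (input) "\<rho> \<equiv> \<lambda>m. \<lambda>j\<in>J. Proj (e j) (m j)"

private lemmas ringR = left_module_ring[OF Y]

private lemma modules:
  shows "left_module R (direct_sum J (\<lambda>_. Y))" "left_module R M" "left_module R (direct_sum J X)"
  by (rule left_module_direct_sum[OF ringR Y], rule left_module_direct_sum[OF ringR short_exactD(2)[OF e]],
      assumption, rule left_module_direct_sum[OF ringR short_exactD(3)[OF e]])

private lemma \<iota>: "\<iota> \<in> mod_hom R (direct_sum J (\<lambda>_. Y)) M"
  by (rule direct_sum_componentwise_hom[OF ringR]) (use Y short_exactD[OF e] in auto)

private lemma \<rho>: "\<rho> \<in> mod_hom R M (direct_sum J X)"
  by (rule direct_sum_componentwise_hom[OF ringR]) (use short_exactD[OF e] in auto)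

private lemma inj_M: "j \<in> J \<Longrightarrow> direct_sum_inj J (\<lambda>j. Mid (e j)) j \<in> mod_hom R (Mid (e j)) M"
  by (rule direct_sum_inj_hom[OF ringR, of J "\<lambda>j. Mid (e j)" j]) (use short_exactD(2)[OF e] in auto)

private lemma presentation:
  "\<exists>\<pi>. \<pi> \<in> mod_hom R (prod_module Y M) (Mid S) \<and> \<pi> ` (carrier Y \<times> carrier M) = carrier (Mid S) \<and>
     (\<forall>y\<in>carrier Y. \<forall>m\<in>carrier M. \<pi> (y, m) = \<zero>\<^bsub>Mid S\<^esub> \<longleftrightarrow>
       (\<exists>a\<in>carrier (direct_sum J (\<lambda>_. Y)). y = summation_map J Y a \<and> m = \<ominus>\<^bsub>M\<^esub> \<iota> a)) \<and>
     (\<forall>y\<in>carrier Y. \<pi> (y, \<zero>\<^bsub>M\<^esub>) = Incl S y) \<and>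
     (\<forall>y\<in>carrier Y. \<forall>m\<in>carrier M. Proj S (\<pi> (y, m)) = \<rho> m)"
proof -
  let ?D = "direct_sum_ses J e" and ?U = "pushout_ses (direct_sum J (\<lambda>_. Y)) Y (summation_map J Y) (direct_sum_ses J e)"
  have D: "Mid ?D = M" "Incl ?D = \<iota>" "Proj ?D = \<rho>" by (simp_all add: direct_sum_ses_def)
  have zero: "\<forall>y\<in>carrier (direct_sum J (\<lambda>_. Y)). Proj ?D (Incl ?D y) = \<zero>\<^bsub>direct_sum J X\<^esub>"
    using short_exactD(7)[OF e] by (auto simp: D PiE_iff intro!: restrict_ext)
  have "left_module R (Mid ?D)" "Incl ?D \<in> mod_hom R (direct_sum J (\<lambda>_. Y)) (Mid ?D)"
      "Proj ?D \<in> mod_hom R (Mid ?D) (direct_sum J X)"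
    unfolding D by (fact modules(2) \<iota> \<rho>)+
  from pushout_ses_proj[OF modules(1) Y this(1) modules(3) summation_map_hom[OF Y] this(2,3) zero]
  obtain j where j: "left_module R (Mid ?U)" "j \<in> mod_hom R (prod_module Y M) (Mid ?U)"
    "j ` (carrier Y \<times> carrier M) = carrier (Mid ?U)"
    "\<forall>y\<in>carrier Y. \<forall>m\<in>carrier M. j (y, m) = \<zero>\<^bsub>Mid ?U\<^esub> \<longleftrightarrow>
      (\<exists>a\<in>carrier (direct_sum J (\<lambda>_. Y)). y = summation_map J Y a \<and> m = \<ominus>\<^bsub>M\<^esub> \<iota> a)"
    "\<forall>y\<in>carrier Y. Incl ?U y = j (y, \<zero>\<^bsub>M\<^esub>)"
    "\<forall>y\<in>carrier Y. \<forall>m\<in>carrier M. Proj ?U (j (y, m)) = \<rho> m"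
    unfolding D by (elim exE conjE) (rule that)
  obtain f where f: "f \<in> mod_hom R (Mid ?U) (Mid S)" "bij_betw f (carrier (Mid ?U)) (carrier (Mid S))"
    "\<forall>y\<in>carrier Y. f (Incl ?U y) = Incl S y" "\<forall>m\<in>carrier (Mid ?U). Proj S (f m) = Proj ?U m"
    using equiv unfolding ses_equiv_def mod_iso_def by blast
  have jc: "j (y, m) \<in> carrier (Mid ?U)" if "y \<in> carrier Y" "m \<in> carrier M" for y m
    using that j(3) by blast
  have M0: "\<zero>\<^bsub>M\<^esub> \<in> carrier M"
    by (rule abelian_groupE(2)[OF left_module_abelian_group[OF modules(2)]])
  show ?thesis
  proof (intro exI[of _ "\<lambda>p. f (j p)"] conjI ballI)
    show "(\<lambda>p. f (j p)) \<in> mod_hom R (prod_module Y M) (Mid S)" by (rule mod_hom_comp[OF j(2) f(1)])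
    show "(\<lambda>p. f (j p)) ` (carrier Y \<times> carrier M) = carrier (Mid S)"
      using f(2) j(3) by (simp only: image_image[symmetric] bij_betw_def)
    fix y assume y: "y \<in> carrier Y"
    show "f (j (y, \<zero>\<^bsub>M\<^esub>)) = Incl S y" by (rule trans[OF arg_cong[where f = f, OF bspec[OF j(5) y, symmetric]] bspec[OF f(3) y]])
    fix m assume m: "m \<in> carrier M"
    show "Proj S (f (j (y, m))) = \<rho> m" by (rule trans[OF bspec[OF f(4) jc[OF y m]] bspec[OF bspec[OF j(6) y] m]])
    have "f (j (y, m)) = \<zero>\<^bsub>Mid S\<^esub> \<longleftrightarrow> j (y, m) = \<zero>\<^bsub>Mid ?U\<^esub>"
      using f(2) jc[OF y m] mod_hom_zero[OF j(1) short_exactD(2)[OF S] f(1)]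
        abelian_groupE(2)[OF left_module_abelian_group[OF j(1)]]
      unfolding bij_betw_def by (metis inj_onD)
    then show "f (j (y, m)) = \<zero>\<^bsub>Mid S\<^esub> \<longleftrightarrow>
       (\<exists>a\<in>carrier (direct_sum J (\<lambda>_. Y)). y = summation_map J Y a \<and> m = \<ominus>\<^bsub>M\<^esub> \<iota> a)"
      by (rule trans[OF _ bspec[OF bspec[OF j(4) y] m]])
  qed
qed

lemma pushout_direct_sum_component:
  assumes j: "j \<in> J"
  shows "\<exists>l\<in>mod_hom R (Mid (e j)) (Mid S). (\<forall>y\<in>carrier Y. l (Incl (e j) y) = Incl S y) \<and>
    (\<forall>m\<in>carrier (Mid (e j)). Proj S (l m) = direct_sum_inj J X j (Proj (e j) m))"
proof -
  obtain \<pi> where \<pi>: "\<pi> \<in> mod_hom R (prod_module Y M) (Mid S)"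
    "\<forall>y\<in>carrier Y. \<forall>m\<in>carrier M. \<pi> (y, m) = \<zero>\<^bsub>Mid S\<^esub> \<longleftrightarrow>
       (\<exists>a\<in>carrier (direct_sum J (\<lambda>_. Y)). y = summation_map J Y a \<and> m = \<ominus>\<^bsub>M\<^esub> \<iota> a)"
    "\<forall>y\<in>carrier Y. \<pi> (y, \<zero>\<^bsub>M\<^esub>) = Incl S y"
    "\<forall>y\<in>carrier Y. \<forall>m\<in>carrier M. Proj S (\<pi> (y, m)) = \<rho> m"
    using presentation by (elim exE conjE) (rule that)
  note ej = short_exactD[OF e[OF j]]
  interpret Y: left_module R Y by (rule Y)
  interpret M: left_module R M by (rule modules)
  interpret SM: left_module R "Mid S" by (rule short_exactD(2)[OF S])
  let ?i = "direct_sum_inj J (\<lambda>j. Mid (e j)) j" and ?iY = "direct_sum_inj J (\<lambda>_. Y) j"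
  note ic = mod_hom_closed[OF inj_M[OF j]]
  have \<pi>c: "\<pi> (y, m) \<in> carrier (Mid S)" if "y \<in> carrier Y" "m \<in> carrier M" for y m
    using mod_hom_closed[OF \<pi>(1), of "(y, m)"] that unfolding prod_module_simps by blast
  have add: "\<pi> (y \<oplus>\<^bsub>Y\<^esub> y', m \<oplus>\<^bsub>M\<^esub> m') = \<pi> (y, m) \<oplus>\<^bsub>Mid S\<^esub> \<pi> (y', m')"
    if "y \<in> carrier Y" "y' \<in> carrier Y" "m \<in> carrier M" "m' \<in> carrier M" for y y' m m'
    using mod_hom_add[OF \<pi>(1), of "(y, m)" "(y', m')"] that unfolding prod_module_simps by blast
  have hom: "(\<lambda>m. \<pi> (\<zero>\<^bsub>Y\<^esub>, ?i m)) \<in> mod_hom R (Mid (e j)) (Mid S)"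
  proof (rule mod_hom_comp[OF inj_M[OF j]], rule mod_homI[OF modules(2) short_exactD(2)[OF S]])
    show "\<pi> (\<zero>\<^bsub>Y\<^esub>, m) \<in> carrier (Mid S)" if "m \<in> carrier M" for m using \<pi>c that by blast
    fix r m m' assume *: "r \<in> carrier R" "m \<in> carrier M" "m' \<in> carrier M"
    have "(r \<odot>\<^bsub>prod_module Y M\<^esub> (\<zero>\<^bsub>Y\<^esub>, m)) \<oplus>\<^bsub>prod_module Y M\<^esub> (\<zero>\<^bsub>Y\<^esub>, m') =
        (\<zero>\<^bsub>Y\<^esub>, r \<odot>\<^bsub>M\<^esub> m \<oplus>\<^bsub>M\<^esub> m')"
      unfolding prod_module_simps left_module_smult_zero[OF Y *(1)] by simp
    then show "\<pi> (\<zero>\<^bsub>Y\<^esub>, r \<odot>\<^bsub>M\<^esub> m \<oplus>\<^bsub>M\<^esub> m') = r \<odot>\<^bsub>Mid S\<^esub> \<pi> (\<zero>\<^bsub>Y\<^esub>, m) \<oplus>\<^bsub>Mid S\<^esub> \<pi> (\<zero>\<^bsub>Y\<^esub>, m')"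
      using mod_hom_lin[OF left_module_prod[OF Y modules(2)] \<pi>(1) *(1), of "(\<zero>\<^bsub>Y\<^esub>, m)" "(\<zero>\<^bsub>Y\<^esub>, m')"] *(2,3)
      unfolding prod_module_simps(1) by simp
  qed
  have incl: "\<pi> (\<zero>\<^bsub>Y\<^esub>, ?i (Incl (e j) y)) = Incl S y" if y: "y \<in> carrier Y" for y
  proof -
    have iy: "?i (Incl (e j) y) \<in> carrier M" using ic mod_hom_closed[OF ej(4) y] .
    have a: "?iY y \<in> carrier (direct_sum J (\<lambda>_. Y))"
      using mod_hom_closed[OF direct_sum_inj_hom[OF ringR Y j] y] .
    have "\<iota> (?iY y) = ?i (Incl (e j) y)"
      by (rule direct_sum_componentwise_inj) (rule mod_hom_zero[OF Y short_exactD(2,4)[OF e]])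
    moreover have "summation_map J Y (?iY y) = y"
      unfolding summation_map_eq by (rule direct_sum_map_inj[OF Y Y _ j y]) (simp add: mod_hom_def)
    ultimately have "\<pi> (y, \<ominus>\<^bsub>M\<^esub> ?i (Incl (e j) y)) = \<zero>\<^bsub>Mid S\<^esub>"
      by (intro iffD2[OF bspec[OF bspec[OF \<pi>(2) y] M.M.a_inv_closed[OF iy]]] bexI[OF _ a]) (simp only:)
    then have "\<pi> (\<zero>\<^bsub>Y\<^esub>, ?i (Incl (e j) y)) =
        \<pi> (\<zero>\<^bsub>Y\<^esub>, ?i (Incl (e j) y)) \<oplus>\<^bsub>Mid S\<^esub> \<pi> (y, \<ominus>\<^bsub>M\<^esub> ?i (Incl (e j) y))"
      using \<pi>c[OF Y.M.zero_closed iy] by simp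
    also have "\<dots> = \<pi> (y, \<zero>\<^bsub>M\<^esub>)"
      using add[OF Y.M.zero_closed y iy M.M.a_inv_closed[OF iy]] y
      unfolding M.M.r_neg[OF iy] by simp
    also have "\<dots> = Incl S y" by (rule bspec[OF \<pi>(3) y])
    finally show ?thesis .
  qed
  have proj: "Proj S (\<pi> (\<zero>\<^bsub>Y\<^esub>, ?i m)) = direct_sum_inj J X j (Proj (e j) m)"
    if m: "m \<in> carrier (Mid (e j))" for m
  proof -
    have "Proj S (\<pi> (\<zero>\<^bsub>Y\<^esub>, ?i m)) = \<rho> (?i m)" by (rule bspec[OF bspec[OF \<pi>(4) Y.M.zero_closed] ic[OF m]])
    also have "\<dots> = direct_sum_inj J X j (Proj (e j) m)"
      by (rule direct_sum_componentwise_inj) (rule mod_hom_zero[OF short_exactD(2,3,5)[OF e]])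
    finally show ?thesis .
  qed
  show ?thesis by (intro bexI[OF _ hom] conjI ballI incl proj)
qed

lemma pushout_direct_sum_universal:
  fixes P :: "('r, 'p) module" and T :: "('r, 'y, 't, 'p) ses"
  assumes T: "short_exact R Y P T" and g: "g \<in> mod_hom R (direct_sum J X) P"
    and h: "\<And>j. j \<in> J \<Longrightarrow> h j \<in> mod_hom R (Mid (e j)) (Mid T)"
    and hi: "\<And>j y. j \<in> J \<Longrightarrow> y \<in> carrier Y \<Longrightarrow> h j (Incl (e j) y) = Incl T y"
    and hp: "\<And>j m. j \<in> J \<Longrightarrow> m \<in> carrier (Mid (e j)) \<Longrightarrow>
      Proj T (h j m) = g (direct_sum_inj J X j (Proj (e j) m))"
  shows "\<exists>f\<in>mod_hom R (Mid S) (Mid T). (\<forall>y\<in>carrier Y. f (Incl S y) = Incl T y) \<and>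
    (\<forall>z\<in>carrier (Mid S). Proj T (f z) = g (Proj S z))"
proof -
  obtain \<pi> where \<pi>: "\<pi> \<in> mod_hom R (prod_module Y M) (Mid S)"
    "\<pi> ` (carrier Y \<times> carrier M) = carrier (Mid S)"
    "\<forall>y\<in>carrier Y. \<forall>m\<in>carrier M. \<pi> (y, m) = \<zero>\<^bsub>Mid S\<^esub> \<longleftrightarrow>
       (\<exists>a\<in>carrier (direct_sum J (\<lambda>_. Y)). y = summation_map J Y a \<and> m = \<ominus>\<^bsub>M\<^esub> \<iota> a)"
    "\<forall>y\<in>carrier Y. \<pi> (y, \<zero>\<^bsub>M\<^esub>) = Incl S y"
    "\<forall>y\<in>carrier Y. \<forall>m\<in>carrier M. Proj S (\<pi> (y, m)) = \<rho> m"
    using presentation by (elim exE conjE) (rule that)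
  note T' = short_exactD[OF T] and e' = short_exactD[OF e]
  interpret Y: left_module R Y by (rule Y)
  interpret M: left_module R M by (rule modules)
  interpret TM: left_module R "Mid T" by (rule T')
  interpret P: left_module R P by (rule T')
  define H where "H = direct_sum_map J (\<lambda>j. Mid (e j)) (Mid T) h"
  have H: "H \<in> mod_hom R M (Mid T)"
    unfolding H_def by (rule direct_sum_map_hom[OF ringR T'(2) e'(2) h])
  have H_inj: "H (direct_sum_inj J (\<lambda>j. Mid (e j)) j m) = h j m" if "j \<in> J" "m \<in> carrier (Mid (e j))" for j m
    unfolding H_def by (rule direct_sum_map_inj[of R "Mid T" J "\<lambda>j. Mid (e j)" h, OF T'(2) e'(2) h that])
  define q where "q = (\<lambda>(y, m). Incl T y \<oplus>\<^bsub>Mid T\<^esub> H m)"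
  note Hc = mod_hom_closed[OF H] and iT = mod_hom_closed[OF T'(4)]
  have PY: "left_module R (prod_module Y M)" by (rule left_module_prod[OF Y modules(2)])
  have q: "q \<in> mod_hom R (prod_module Y M) (Mid T)"
  proof (rule mod_homI[OF PY T'(2)])
    fix a assume "a \<in> carrier (prod_module Y M)"
    then obtain y m where "a = (y, m)" "y \<in> carrier Y" "m \<in> carrier M"
      unfolding prod_module_simps by blast
    then show "q a \<in> carrier (Mid T)" using Hc iT unfolding q_def by auto
  next
    fix r a b assume r: "r \<in> carrier R" and "a \<in> carrier (prod_module Y M)" "b \<in> carrier (prod_module Y M)"
    then obtain y m y' m' where *: "a = (y, m)" "y \<in> carrier Y" "m \<in> carrier M"
        "b = (y', m')" "y' \<in> carrier Y" "m' \<in> carrier M"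
      unfolding prod_module_simps by blast
    have "q (r \<odot>\<^bsub>prod_module Y M\<^esub> a \<oplus>\<^bsub>prod_module Y M\<^esub> b) =
        Incl T (r \<odot>\<^bsub>Y\<^esub> y \<oplus>\<^bsub>Y\<^esub> y') \<oplus>\<^bsub>Mid T\<^esub> H (r \<odot>\<^bsub>M\<^esub> m \<oplus>\<^bsub>M\<^esub> m')"
      unfolding * prod_module_simps q_def by simp
    also have "\<dots> = (r \<odot>\<^bsub>Mid T\<^esub> Incl T y \<oplus>\<^bsub>Mid T\<^esub> Incl T y') \<oplus>\<^bsub>Mid T\<^esub> (r \<odot>\<^bsub>Mid T\<^esub> H m \<oplus>\<^bsub>Mid T\<^esub> H m')"
      using mod_hom_lin[OF modules(2) H r *(3,6)] mod_hom_lin[OF Y T'(4) r *(2,5)] by simp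
    also have "\<dots> = r \<odot>\<^bsub>Mid T\<^esub> q a \<oplus>\<^bsub>Mid T\<^esub> q b"
      using r iT[OF *(2)] iT[OF *(5)] Hc[OF *(3)] Hc[OF *(6)] unfolding q_def *(1,4)
      by (simp add: TM.smult_r_distr TM.M.a_ac)
    finally show "q (r \<odot>\<^bsub>prod_module Y M\<^esub> a \<oplus>\<^bsub>prod_module Y M\<^esub> b) = r \<odot>\<^bsub>Mid T\<^esub> q a \<oplus>\<^bsub>Mid T\<^esub> q b" .
  qed
  have H\<iota>: "H (\<iota> a) = Incl T (summation_map J Y a)" if a: "a \<in> carrier (direct_sum J (\<lambda>_. Y))" for a
  proof (rule direct_sum_hom_eqI[OF ringR Y T'(2) mod_hom_comp[OF \<iota> H]
        mod_hom_comp[OF summation_map_hom[OF Y] T'(4)] _ a])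
    fix j y assume j: "j \<in> J" and y: "y \<in> carrier Y"
    have "\<iota> (direct_sum_inj J (\<lambda>_. Y) j y) = direct_sum_inj J (\<lambda>j. Mid (e j)) j (Incl (e j) y)"
      by (rule direct_sum_componentwise_inj) (rule mod_hom_zero[OF Y e'(2,4)])
    moreover have "summation_map J Y (direct_sum_inj J (\<lambda>_. Y) j y) = y"
      unfolding summation_map_eq by (rule direct_sum_map_inj[OF Y Y _ j y]) (simp add: mod_hom_def)
    ultimately show "H (\<iota> (direct_sum_inj J (\<lambda>_. Y) j y)) =
        Incl T (summation_map J Y (direct_sum_inj J (\<lambda>_. Y) j y))"
      using H_inj[OF j mod_hom_closed[OF e'(4)[OF j] y]] hi[OF j y] by simp
  qed
  have ex_f: "\<exists>f\<in>mod_hom R (Mid S) (Mid T). \<forall>a\<in>carrier (prod_module Y M). f (\<pi> a) = q a"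
  proof (rule mod_hom_factor[OF PY short_exactD(2)[OF S] T'(2) \<pi>(1) _ q])
    show "\<pi> ` carrier (prod_module Y M) = carrier (Mid S)"
      unfolding prod_module_simps by (rule \<pi>(2))
    fix p assume "p \<in> carrier (prod_module Y M)" and p0: "\<pi> p = \<zero>\<^bsub>Mid S\<^esub>"
    then obtain y m where p: "p = (y, m)" "y \<in> carrier Y" "m \<in> carrier M"
      unfolding prod_module_simps by blast
    then obtain a where a: "a \<in> carrier (direct_sum J (\<lambda>_. Y))" "y = summation_map J Y a" "m = \<ominus>\<^bsub>M\<^esub> \<iota> a"
      using iffD1[OF bspec[OF bspec[OF \<pi>(3) p(2)] p(3)] p0[unfolded p(1)]] by (elim bexE conjE)
    have "H m = \<ominus>\<^bsub>Mid T\<^esub> Incl T y"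
      using mod_hom_minus[OF modules(2) T'(2) H mod_hom_closed[OF \<iota> a(1)]] H\<iota>[OF a(1)]
      unfolding a(2,3) by (simp only:)
    then show "q p = \<zero>\<^bsub>Mid T\<^esub>"
      using TM.M.r_neg[OF iT[OF p(2)]] unfolding p(1) q_def by simp
  qed
  obtain f where f_hom: "f \<in> mod_hom R (Mid S) (Mid T)"
      and f_eq: "\<forall>a\<in>carrier (prod_module Y M). f (\<pi> a) = q a"
    using ex_f by (elim bexE)
  have "f (\<pi> (y, m)) = Incl T y \<oplus>\<^bsub>Mid T\<^esub> H m" if "y \<in> carrier Y" "m \<in> carrier M" for y m
  proof -
    have "(y, m) \<in> carrier (prod_module Y M)" unfolding prod_module_simps using that by (rule SigmaI)
    then show ?thesis using f_eq by (simp only: q_def prod.case)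
  qed
  note f = f_hom this
  have incl: "f (Incl S y) = Incl T y" if y: "y \<in> carrier Y" for y
    using f(2)[OF y M.M.zero_closed] iT[OF y]
    unfolding bspec[OF \<pi>(4) y] mod_hom_zero[OF modules(2) T'(2) H] by simp
  have proj: "Proj T (f z) = g (Proj S z)" if z: "z \<in> carrier (Mid S)" for z
  proof -
    obtain y m where ym: "z = \<pi> (y, m)" "y \<in> carrier Y" "m \<in> carrier M"
      using z unfolding \<pi>(2)[symmetric] by blast
    have "Proj T (H m) = g (\<rho> m)"
    proof (rule direct_sum_hom_eqI[OF ringR e'(2) T'(3) mod_hom_comp[OF H T'(5)] mod_hom_comp[OF \<rho> g] _ ym(3)])
      fix j n assume j: "j \<in> J" and n: "n \<in> carrier (Mid (e j))"
      have "\<rho> (direct_sum_inj J (\<lambda>j. Mid (e j)) j n) = direct_sum_inj J X j (Proj (e j) n)"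
        by (rule direct_sum_componentwise_inj) (rule mod_hom_zero[OF e'(2,3,5)])
      then show "Proj T (H (direct_sum_inj J (\<lambda>j. Mid (e j)) j n)) =
          g (\<rho> (direct_sum_inj J (\<lambda>j. Mid (e j)) j n))"
        using H_inj[OF j n] hp[OF j n] by simp
    qed
    moreover have "Proj T (f z) = Proj T (H m)"
      using f(2)[OF ym(2,3)] mod_hom_add[OF T'(5) iT[OF ym(2)] Hc[OF ym(3)]] T'(7)[OF ym(2)]
        mod_hom_closed[OF T'(5) Hc[OF ym(3)]] ym(1) by simp
    moreover have "Proj S z = \<rho> m" unfolding ym(1) by (rule bspec[OF bspec[OF \<pi>(5) ym(2)] ym(3)])
    ultimately show ?thesis by simp
  qed
  show ?thesis by (intro bexI[OF _ f(1)] conjI ballI incl proj)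
qed

end

section \<open>Row-finite matrices of endomorphisms\<close>

lemma End_ring_finsum_apply:
  assumes M: "left_module R M" and K: "ring (End_ring R M)" and "finite F"
    and "\<And>i. i \<in> F \<Longrightarrow> f i \<in> carrier (End_ring R M)" and x: "x \<in> carrier M"
  shows "(\<Oplus>\<^bsub>End_ring R M\<^esub>i\<in>F. f i) x = (\<Oplus>\<^bsub>M\<^esub>i\<in>F. f i x)"
  using assms(3,4)
proof (induction F rule: finite_induct)
  interpret M: left_module R M by (rule M)
  interpret K: ring "End_ring R M" by (rule K)
  case empty
  then show ?case using x by simp
next
  interpret M: left_module R M by (rule M)
  interpret K: ring "End_ring R M" by (rule K)
  case (insert i F)
  have *: "f i \<in> carrier (End_ring R M)" "f \<in> F \<rightarrow> carrier (End_ring R M)"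
    using insert.prems by blast+
  have cl: "f j x \<in> carrier M" if "j \<in> insert i F" for j
    using insert.prems[OF that] mod_hom_closed[OF _ x] by auto
  have "(\<Oplus>\<^bsub>End_ring R M\<^esub>i\<in>insert i F. f i) x = f i x \<oplus>\<^bsub>M\<^esub> (\<Oplus>\<^bsub>End_ring R M\<^esub>i\<in>F. f i) x"
    unfolding K.finsum_insert[OF insert.hyps *(2,1)] using x by simp
  also have "\<dots> = f i x \<oplus>\<^bsub>M\<^esub> (\<Oplus>\<^bsub>M\<^esub>i\<in>F. f i x)"
    using insert.IH insert.prems by simp
  also have "\<dots> = (\<Oplus>\<^bsub>M\<^esub>i\<in>insert i F. f i x)"
    using insert.hyps cl by (intro M.M.finsum_insert[symmetric]) auto
  finally show ?case .
qed

definition matrix_row ::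
  "('r, 'x) module set \<Rightarrow> (('r, 'x) module \<Rightarrow> 'i set) \<Rightarrow> ('r, 'x) module \<Rightarrow> 'i set \<Rightarrow> ('i \<Rightarrow> 'x \<Rightarrow> 'x) \<Rightarrow>
    'x \<Rightarrow> ('r, 'x) module \<times> 'i \<Rightarrow> 'x" where
  "matrix_row \<X> I X F c x = (\<Oplus>\<^bsub>semibrick_sum \<X> I\<^esub>j\<in>F. direct_sum_inj (Sigma \<X> I) fst (X, j) (c j x))"

definition matrix_map ::
  "('r, 'x) module set \<Rightarrow> (('r, 'x) module \<Rightarrow> 'i set) \<Rightarrow>
    (('r, 'x) module \<Rightarrow> 'i \<Rightarrow> 'i set) \<Rightarrow> (('r, 'x) module \<Rightarrow> 'i \<Rightarrow> 'i \<Rightarrow> 'x \<Rightarrow> 'x) \<Rightarrow>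
    (('r, 'x) module \<times> 'i \<Rightarrow> 'x) \<Rightarrow> ('r, 'x) module \<times> 'i \<Rightarrow> 'x" where
  "matrix_map \<X> I F c = direct_sum_map (Sigma \<X> I) fst (semibrick_sum \<X> I)
     (\<lambda>(X, i). matrix_row \<X> I X (F X i) (c X i))"

definition matrix_on ::
  "('r, 'k) ring_scheme \<Rightarrow> ('r, 'x) module set \<Rightarrow> (('r, 'x) module \<Rightarrow> 'i set) \<Rightarrow>
    (('r, 'x) module \<Rightarrow> 'i \<Rightarrow> 'i set) \<Rightarrow> (('r, 'x) module \<Rightarrow> 'i \<Rightarrow> 'i \<Rightarrow> 'x \<Rightarrow> 'x) \<Rightarrow> bool" where
  "matrix_on R \<X> I F c \<longleftrightarrow> (\<forall>X\<in>\<X>. \<forall>i\<in>I X. finite (F X i) \<and> F X i \<subseteq> I X \<and>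
     (\<forall>j. c X i j \<in> carrier (End_ring R X)) \<and> (\<forall>j. j \<notin> F X i \<longrightarrow> c X i j = \<zero>\<^bsub>End_ring R X\<^esub>))"

context
  fixes R :: "('r, 'k) ring_scheme" and \<X> :: "('r, 'x) module set" and I :: "('r, 'x) module \<Rightarrow> 'i set"
  assumes R: "ring R" and \<X>: "\<And>X. X \<in> \<X> \<Longrightarrow> left_module R X"
begin

private abbreviation (input) "J \<equiv> Sigma \<X> I"

private abbreviation (input) "P \<equiv> semibrick_sum \<X> I"

private lemma fst_module: "p \<in> J \<Longrightarrow> left_module R (fst p)"
  using \<X> by auto

lemma left_module_semibrick_sum: "left_module R P"
  unfolding semibrick_sum_def by (rule left_module_direct_sum[OF R fst_module])

private lemma inj_P: "X \<in> \<X> \<Longrightarrow> i \<in> I X \<Longrightarrow> direct_sum_inj J fst (X, i) \<in> mod_hom R X P"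
  using direct_sum_inj_hom[of R J fst "(X, i)", OF R fst_module] unfolding semibrick_sum_def by simp

lemma matrix_row_hom:
  assumes "matrix_on R \<X> I F c" "X \<in> \<X>" "i \<in> I X"
  shows "matrix_row \<X> I X (F X i) (c X i) \<in> mod_hom R X P"
proof (rule mod_homI[OF \<X>[OF assms(2)] left_module_semibrick_sum])
  interpret P: left_module R P by (rule left_module_semibrick_sum)
  have F: "finite (F X i)" "F X i \<subseteq> I X" "\<And>j. c X i j \<in> mod_hom R X X"
    using assms unfolding matrix_on_def by auto
  have hom: "(\<lambda>x. direct_sum_inj J fst (X, j) (c X i j x)) \<in> mod_hom R X P" if "j \<in> F X i" for j
    using F that by (intro mod_hom_comp[OF F(3)] inj_P[OF assms(2)]) auto
  note cl = mod_hom_closed[OF hom]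
  show "matrix_row \<X> I X (F X i) (c X i) x \<in> carrier P" if "x \<in> carrier X" for x
    unfolding matrix_row_def using cl that by (intro P.M.finsum_closed) auto
  fix r x y assume r: "r \<in> carrier R" "x \<in> carrier X" "y \<in> carrier X"
  let ?t = "\<lambda>x j. direct_sum_inj J fst (X, j) (c X i j x)"
  have "matrix_row \<X> I X (F X i) (c X i) (r \<odot>\<^bsub>X\<^esub> x \<oplus>\<^bsub>X\<^esub> y) = (\<Oplus>\<^bsub>P\<^esub>j\<in>F X i. r \<odot>\<^bsub>P\<^esub> ?t x j \<oplus>\<^bsub>P\<^esub> ?t y j)"
    unfolding matrix_row_def using r cl
    by (intro P.M.finsum_cong') (auto simp: mod_hom_lin[OF \<X>[OF assms(2)] hom])
  also have "\<dots> = (\<Oplus>\<^bsub>P\<^esub>j\<in>F X i. r \<odot>\<^bsub>P\<^esub> ?t x j) \<oplus>\<^bsub>P\<^esub> (\<Oplus>\<^bsub>P\<^esub>j\<in>F X i. ?t y j)"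
    using r cl by (intro P.M.finsum_addf) auto
  also have "(\<Oplus>\<^bsub>P\<^esub>j\<in>F X i. r \<odot>\<^bsub>P\<^esub> ?t x j) = r \<odot>\<^bsub>P\<^esub> (\<Oplus>\<^bsub>P\<^esub>j\<in>F X i. ?t x j)"
    using r cl by (intro left_module_finsum_smult[OF left_module_semibrick_sum, symmetric]) auto
  finally show "matrix_row \<X> I X (F X i) (c X i) (r \<odot>\<^bsub>X\<^esub> x \<oplus>\<^bsub>X\<^esub> y) =
      r \<odot>\<^bsub>P\<^esub> matrix_row \<X> I X (F X i) (c X i) x \<oplus>\<^bsub>P\<^esub> matrix_row \<X> I X (F X i) (c X i) y"
    by (simp only: matrix_row_def)
qed

lemma matrix_map_hom:
  assumes "matrix_on R \<X> I F c"
  shows "matrix_map \<X> I F c \<in> mod_hom R P P"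
  unfolding matrix_map_def
  using direct_sum_map_hom[of R P J fst "\<lambda>(X, i). matrix_row \<X> I X (F X i) (c X i)",
      OF R left_module_semibrick_sum fst_module]
    matrix_row_hom[OF assms]
  unfolding semibrick_sum_def by (auto simp: split_beta)

lemma matrix_map_inj:
  assumes "matrix_on R \<X> I F c" "X \<in> \<X>" "i \<in> I X" "x \<in> carrier X"
  shows "matrix_map \<X> I F c (direct_sum_inj J fst (X, i) x) = matrix_row \<X> I X (F X i) (c X i) x"
  unfolding matrix_map_def
  using direct_sum_map_inj[of R P J fst "\<lambda>(X, i). matrix_row \<X> I X (F X i) (c X i)" "(X, i)" x,
      OF left_module_semibrick_sum fst_module]
    matrix_row_hom[OF assms(1)] assms(2-4)
  by (auto simp: split_beta)

lemma matrix_map_inverse: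
  assumes C: "matrix_on R \<X> I F c" and D: "matrix_on R \<X> I G d"
    and K: "\<And>X. X \<in> \<X> \<Longrightarrow> ring (End_ring R X)"
    and CD: "\<And>X i k. X \<in> \<X> \<Longrightarrow> i \<in> I X \<Longrightarrow> k \<in> I X \<Longrightarrow>
      (\<Oplus>\<^bsub>End_ring R X\<^esub>j\<in>F X i. c X i j \<otimes>\<^bsub>End_ring R X\<^esub> d X j k) =
      (if k = i then \<one>\<^bsub>End_ring R X\<^esub> else \<zero>\<^bsub>End_ring R X\<^esub>)"
    and z: "z \<in> carrier P"
  shows "matrix_map \<X> I G d (matrix_map \<X> I F c z) = z"
proof -
  note P = left_module_semibrick_sum
  interpret P: left_module R P by (rule P)
  note CH = matrix_map_hom[OF C] and DH = matrix_map_hom[OF D]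
  have gen: "matrix_map \<X> I G d (matrix_map \<X> I F c (direct_sum_inj J fst (X, i) x)) = direct_sum_inj J fst (X, i) x"
    if X: "X \<in> \<X>" and i: "i \<in> I X" and x: "x \<in> carrier X" for X i x
  proof -
    interpret X: left_module R X by (rule \<X>[OF X])
    interpret K: ring "End_ring R X" by (rule K[OF X])
    let ?in = "\<lambda>k. direct_sum_inj J fst (X, k)"
    note inj = inj_P[OF X]
    have F: "finite (F X i)" "F X i \<subseteq> I X" "\<And>j. c X i j \<in> carrier (End_ring R X)"
      using C X i unfolding matrix_on_def by blast+
    have G: "finite (G X j)" "G X j \<subseteq> I X" "\<And>k. d X j k \<in> carrier (End_ring R X)"
        "\<And>k. k \<notin> G X j \<Longrightarrow> d X j k = \<zero>\<^bsub>End_ring R X\<^esub>" if "j \<in> F X i" for j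
      using D X F(2) that unfolding matrix_on_def by blast+
    have cx: "c X i j x \<in> carrier X" for j
      using F(3) x by (auto intro: mod_hom_closed)
    have dx: "d X j k y \<in> carrier X" if "j \<in> F X i" "y \<in> carrier X" for j k y
      using G(3)[OF that(1)] that(2) by (auto intro: mod_hom_closed)
    define T where "T = insert i (\<Union>j\<in>F X i. G X j)"
    have T: "finite T" "T \<subseteq> I X" "i \<in> T" "\<And>j. j \<in> F X i \<Longrightarrow> G X j \<subseteq> T"
      using F(1) G(1,2) i by (auto simp: T_def)
    have inT: "?in k y \<in> carrier P" if "k \<in> T" "y \<in> carrier X" for k y
      using mod_hom_closed[OF inj] T(2) that by blast
    have row: "matrix_row \<X> I X (G X j) (d X j) y = (\<Oplus>\<^bsub>P\<^esub>k\<in>T. ?in k (d X j k y))"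
      if j: "j \<in> F X i" and y: "y \<in> carrier X" for j y
      unfolding matrix_row_def
    proof (rule P.M.add.finprod_mono_neutral_cong_left[OF T(1) T(4)[OF j]])
      show "?in k (d X j k y) = \<zero>\<^bsub>P\<^esub>" if "k \<in> T - G X j" for k
        using that G(4)[OF j, of k] y T(2) mod_hom_zero[OF \<X>[OF X] P inj] by auto
      show "(\<lambda>k. ?in k (d X j k y)) \<in> T \<rightarrow> carrier P"
        using inT dx[OF j y] by blast
    qed simp_all
    have cd: "(\<Oplus>\<^bsub>X\<^esub>j\<in>F X i. d X j k (c X i j x)) = (if k = i then x else \<zero>\<^bsub>X\<^esub>)" if k: "k \<in> T" for k
    proof -
      have "(\<Oplus>\<^bsub>X\<^esub>j\<in>F X i. d X j k (c X i j x)) = (\<Oplus>\<^bsub>X\<^esub>j\<in>F X i. (c X i j \<otimes>\<^bsub>End_ring R X\<^esub> d X j k) x)"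
        using x cx dx by (intro X.M.finsum_cong') (auto simp: compose_def)
      also have "\<dots> = (\<Oplus>\<^bsub>End_ring R X\<^esub>j\<in>F X i. c X i j \<otimes>\<^bsub>End_ring R X\<^esub> d X j k) x"
        by (rule End_ring_finsum_apply[OF \<X>[OF X] K[OF X] F(1) K.m_closed[OF F(3) G(3)] x, symmetric])
      also have "\<dots> = (if k = i then x else \<zero>\<^bsub>X\<^esub>)"
        using CD[OF X i, of k] T(2) k x by (subst CD[OF X i]) auto
      finally show ?thesis .
    qed
    have "matrix_map \<X> I G d (matrix_map \<X> I F c (?in i x)) =
        matrix_map \<X> I G d (\<Oplus>\<^bsub>P\<^esub>j\<in>F X i. ?in j (c X i j x))"
      unfolding matrix_map_inj[OF C X i x] matrix_row_def ..
    also have "\<dots> = (\<Oplus>\<^bsub>P\<^esub>j\<in>F X i. matrix_map \<X> I G d (?in j (c X i j x)))"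
      using F(2) cx by (intro mod_hom_finsum[OF P P DH]) (auto intro!: mod_hom_closed[OF inj])
    also have "\<dots> = (\<Oplus>\<^bsub>P\<^esub>j\<in>F X i. \<Oplus>\<^bsub>P\<^esub>k\<in>T. ?in k (d X j k (c X i j x)))"
    proof (rule P.M.finsum_cong'[OF refl])
      show "(\<lambda>j. \<Oplus>\<^bsub>P\<^esub>k\<in>T. ?in k (d X j k (c X i j x))) \<in> F X i \<rightarrow> carrier P"
        using inT dx cx by (intro Pi_I P.M.finsum_closed) blast
      show "matrix_map \<X> I G d (?in j (c X i j x)) = (\<Oplus>\<^bsub>P\<^esub>k\<in>T. ?in k (d X j k (c X i j x)))"
        if j: "j \<in> F X i" for j
        using matrix_map_inj[OF D X _ cx] row[OF j cx] F(2) j by auto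
    qed
    also have "\<dots> = (\<Oplus>\<^bsub>P\<^esub>k\<in>T. \<Oplus>\<^bsub>P\<^esub>j\<in>F X i. ?in k (d X j k (c X i j x)))"
      using inT dx cx by (intro P.M.finsum_swap[OF F(1) T(1)]) blast
    also have "\<dots> = (\<Oplus>\<^bsub>P\<^esub>k\<in>T. if i = k then ?in k x else \<zero>\<^bsub>P\<^esub>)"
    proof (rule P.M.finsum_cong'[OF refl])
      show "(\<lambda>k. if i = k then ?in k x else \<zero>\<^bsub>P\<^esub>) \<in> T \<rightarrow> carrier P"
        using inT x by auto
      fix k assume k: "k \<in> T"
      then have kI: "k \<in> I X" using T(2) by blast
      have "(\<Oplus>\<^bsub>P\<^esub>j\<in>F X i. ?in k (d X j k (c X i j x))) = ?in k (\<Oplus>\<^bsub>X\<^esub>j\<in>F X i. d X j k (c X i j x))"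
        using dx cx by (intro mod_hom_finsum[OF \<X>[OF X] P inj[OF kI], symmetric]) blast
      also have "\<dots> = (if i = k then ?in k x else \<zero>\<^bsub>P\<^esub>)"
        unfolding cd[OF k] using mod_hom_zero[OF \<X>[OF X] P inj[OF kI]] by auto
      finally show "(\<Oplus>\<^bsub>P\<^esub>j\<in>F X i. ?in k (d X j k (c X i j x))) = (if i = k then ?in k x else \<zero>\<^bsub>P\<^esub>)" .
    qed
    also have "\<dots> = ?in i x"
      using inT x by (intro P.M.finsum_singleton[OF T(3,1)]) blast
    finally show ?thesis .
  qed
  have id: "(\<lambda>z. z) \<in> mod_hom R (direct_sum J fst) P"
    by (auto simp: mod_hom_def semibrick_sum_def)
  show ?thesis
  proof (rule direct_sum_hom_eqI[of R J fst P "\<lambda>z. matrix_map \<X> I G d (matrix_map \<X> I F c z)" "\<lambda>z. z"])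
    show "(\<lambda>z. matrix_map \<X> I G d (matrix_map \<X> I F c z)) \<in> mod_hom R (direct_sum J fst) P"
      using mod_hom_comp[OF CH DH] by (simp only: semibrick_sum_def)
    show "z \<in> carrier (direct_sum J fst)" using z by (simp only: semibrick_sum_def)
    fix p x assume "p \<in> J" "x \<in> carrier (fst p)"
    then show "matrix_map \<X> I G d (matrix_map \<X> I F c (direct_sum_inj J fst p x)) = direct_sum_inj J fst p x"
      using gen[of "fst p" "snd p" x] by auto
  qed (fact R fst_module P id)+
qed

end

lemma cocycle_lift_ext_class:
  assumes S: "short_exact R Y X S" and eq: "ext_class R X Y S = cocycle_class R Y X c"
    and c: "ext_cocycle R Y X c"
  shows "\<exists>s. cocycle_lift R Y X S (\<lambda>x. x) s c"
proof -
  obtain t d where t: "cocycle_lift R Y X S (\<lambda>x. x) t d" using cocycle_lift_exists[OF S] by blast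
  obtain T where T: "T \<in> cocycle_class R Y X c"
    using c unfolding ext_cocycle_def cocycle_class_def by blast
  then obtain u where u: "short_exact R Y X T" "cocycle_lift R Y X T (\<lambda>x. x) u c"
    unfolding cocycle_class_def by blast
  have "T \<in> cocycle_class R Y X d" using T eq ext_class_eq[OF S t] by simp
  then obtain v where v: "cocycle_lift R Y X T (\<lambda>x. x) v d" unfolding cocycle_class_def by blast
  have "ses_equiv R Y T S" by (rule ses_equiv_if_cocycle[OF u(1) v S t])
  then show ?thesis using ses_equiv_cocycle_lift[OF u(1) _ short_exactD(3)[OF S] u(2)] by blast
qed

theorem proposition4p3:
  fixes R :: "('r, 'k) ring_scheme"
    and \<X> :: "('r, 'x) module set"
    and Y :: "('r, 'y) module"
    and I :: "('r, 'x) module \<Rightarrow> 'i set"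
    and E :: "('r, 'x) module \<Rightarrow> 'i \<Rightarrow> ('r, 'y, 'm, 'x) ses"
    and E' :: "('r, 'x) module \<Rightarrow> 'i \<Rightarrow> ('r, 'y, 'n, 'x) ses"
    and Z :: "('r, 'z) module" and Z' :: "('r, 'w) module"
    and \<alpha> :: "'y \<Rightarrow> 'z" and \<beta> :: "'z \<Rightarrow> ('r, 'x) module \<times> 'i \<Rightarrow> 'x"
    and \<alpha>' :: "'y \<Rightarrow> 'w" and \<beta>' :: "'w \<Rightarrow> ('r, 'x) module \<times> 'i \<Rightarrow> 'x"
  assumes "ring R"
    and "semibrick R \<X>"
    and "left_module R Y"
    and "universal_ses R \<X> Y I E \<lparr>Mid = Z, Incl = \<alpha>, Proj = \<beta>\<rparr>"
    and "universal_ses R \<X> Y I E' \<lparr>Mid = Z', Incl = \<alpha>', Proj = \<beta>'\<rparr>"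
  shows "\<exists>f \<in> mod_iso R Z' Z. \<exists>g \<in> mod_iso R (semibrick_sum \<X> I) (semibrick_sum \<X> I).
           (\<forall>y\<in>carrier Y. f (\<alpha>' y) = \<alpha> y) \<and>
           (\<forall>z\<in>carrier Z'. \<beta> (f z) = g (\<beta>' z))"
proof -
  let ?S = "\<lparr>Mid = Z, Incl = \<alpha>, Proj = \<beta>\<rparr>" and ?S' = "\<lparr>Mid = Z', Incl = \<alpha>', Proj = \<beta>'\<rparr>"
  let ?J = "Sigma \<X> I" and ?P = "semibrick_sum \<X> I"
  have modX: "left_module R X" and ringK: "ring (End_ring R X)" if "X \<in> \<X>" for X
    using assms(2) that unfolding semibrick_def brick_def finitely_presented_def skew_field_def by blast+
  have E: "short_exact R Y X (E X i)" "short_exact R Y X (E' X i)" if "X \<in> \<X>" "i \<in> I X" for X i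
    using assms(4,5) that unfolding universal_ses_def by blast+
  have basis: "module_basis (End_ring R X) (Ext1 R X Y) (I X) (\<lambda>i. ext_class R X Y (E X i))"
      "module_basis (End_ring R X) (Ext1 R X Y) (I X) (\<lambda>i. ext_class R X Y (E' X i))" if "X \<in> \<X>" for X
    using assms(4,5) that unfolding universal_ses_def by blast+
  have S: "short_exact R Y ?P ?S" and S': "short_exact R Y ?P ?S'"
    using assms(4,5) unfolding universal_ses_def by blast+
  have equiv: "ses_equiv R Y (pushout_ses (direct_sum ?J (\<lambda>_. Y)) Y (summation_map ?J Y)
        (direct_sum_ses ?J (\<lambda>(X, i). E X i))) ?S"
      "ses_equiv R Y (pushout_ses (direct_sum ?J (\<lambda>_. Y)) Y (summation_map ?J Y)
        (direct_sum_ses ?J (\<lambda>(X, i). E' X i))) ?S'"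
    using assms(4,5) unfolding universal_ses_def by blast+
  have modE: "left_module (End_ring R X) (Ext1 R X Y)" if "X \<in> \<X>" for X
    by (rule left_module_Ext1[OF modX[OF that] assms(3) ringK[OF that]])
  have "\<exists>F c. coordinates (End_ring R X) (Ext1 R X Y) (I X) (\<lambda>i. ext_class R X Y (E X i))
      (ext_class R X Y (E' X i)) F c" if "X \<in> \<X>" "i \<in> I X" for X i
    by (rule coordinates_exist[OF modE[OF that(1)] basis(1)[OF that(1)]
      module_basis_closed[OF basis(2)[OF that(1)] that(2)]])
  then obtain F c where c: "\<And>X i. X \<in> \<X> \<Longrightarrow> i \<in> I X \<Longrightarrow>
      coordinates (End_ring R X) (Ext1 R X Y) (I X) (\<lambda>i. ext_class R X Y (E X i))
        (ext_class R X Y (E' X i)) (F X i) (c X i)"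
    by metis
  have "\<exists>F c. coordinates (End_ring R X) (Ext1 R X Y) (I X) (\<lambda>i. ext_class R X Y (E' X i))
      (ext_class R X Y (E X i)) F c" if "X \<in> \<X>" "i \<in> I X" for X i
    by (rule coordinates_exist[OF modE[OF that(1)] basis(2)[OF that(1)]
      module_basis_closed[OF basis(1)[OF that(1)] that(2)]])
  then obtain G d where d: "\<And>X i. X \<in> \<X> \<Longrightarrow> i \<in> I X \<Longrightarrow>
      coordinates (End_ring R X) (Ext1 R X Y) (I X) (\<lambda>i. ext_class R X Y (E' X i))
        (ext_class R X Y (E X i)) (G X i) (d X i)"
    by metis
  have C: "matrix_on R \<X> I F c" and D: "matrix_on R \<X> I G d"
    using c d unfolding matrix_on_def coordinates_def by blast+
  note CD = basis_change_inverse[OF modE basis c d] and DC = basis_change_inverse[OF modE basis(2,1) d c]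
  let ?g = "matrix_map \<X> I F c"
  have g: "?g \<in> mod_iso R ?P ?P"
  proof (rule mod_isoI[of _ _ _ _ "matrix_map \<X> I G d"])
    show gh: "?g \<in> mod_hom R ?P ?P" by (rule matrix_map_hom[OF assms(1) modX C])
    show "matrix_map \<X> I G d \<in> carrier ?P \<rightarrow> carrier ?P"
      using mod_hom_closed[OF matrix_map_hom[OF assms(1) modX D]] by blast
    show "matrix_map \<X> I G d (?g z) = z" if "z \<in> carrier ?P" for z
      by (rule matrix_map_inverse[OF assms(1) modX C D ringK CD that])
    show "?g (matrix_map \<X> I G d z) = z" if "z \<in> carrier ?P" for z
      by (rule matrix_map_inverse[OF assms(1) modX D C ringK DC that])
  qed
  have comp: "\<exists>l\<in>mod_hom R (Mid (E X i)) Z. (\<forall>y\<in>carrier Y. l (Incl (E X i) y) = \<alpha> y) \<and>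
      (\<forall>m\<in>carrier (Mid (E X i)). \<beta> (l m) = direct_sum_inj ?J fst (X, i) (Proj (E X i) m))"
    if "X \<in> \<X>" "i \<in> I X" for X i
    using pushout_direct_sum_component[of R Y ?J fst "\<lambda>(X, i). E X i" ?S "(X, i)"]
      assms(3) E(1) S equiv(1) that unfolding semibrick_sum_def by auto
  have lift: "\<exists>h\<in>mod_hom R (Mid (E' X i)) Z. (\<forall>y\<in>carrier Y. h (Incl (E' X i) y) = \<alpha> y) \<and>
      (\<forall>m\<in>carrier (Mid (E' X i)). \<beta> (h m) = matrix_row \<X> I X (F X i) (c X i) (Proj (E' X i) m))"
    if X: "X \<in> \<X>" and i: "i \<in> I X" for X i
  proof -
    have F: "finite (F X i)" "F X i \<subseteq> I X" "\<And>j. c X i j \<in> mod_hom R X X"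
      using C X i unfolding matrix_on_def by auto
    have "\<exists>s \<gamma>. cocycle_lift R Y X (E X j) (\<lambda>x. x) s \<gamma>" if "j \<in> F X i" for j
      using cocycle_lift_exists[OF E(1)[OF X]] F(2) that by blast
    then obtain s \<gamma> where s: "\<And>j. j \<in> F X i \<Longrightarrow> cocycle_lift R Y X (E X j) (\<lambda>x. x) (s j) (\<gamma> j)"
      by metis
    let ?\<gamma> = "\<lambda>j r x x'. \<gamma> j r (c X i j x) (c X i j x')"
    have \<gamma>: "c X i j \<odot>\<^bsub>Ext1 R X Y\<^esub> ext_class R X Y (E X j) = cocycle_class R Y X (?\<gamma> j)"
        "ext_cocycle R Y X (?\<gamma> j)" if j: "j \<in> F X i" for j
    proof -
      note Ej = E(1)[OF X subsetD[OF F(2) j]]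
      show "c X i j \<odot>\<^bsub>Ext1 R X Y\<^esub> ext_class R X Y (E X j) = cocycle_class R Y X (?\<gamma> j)"
          "ext_cocycle R Y X (?\<gamma> j)"
        unfolding ext_class_eq[OF Ej s[OF j]]
        by (rule Ext1_smult_comp[OF modX[OF X] ext_cocycleI[OF Ej s[OF j]] F(3)])+
    qed
    interpret Ext: left_module "End_ring R X" "Ext1 R X Y" by (rule modE[OF X])
    have "ext_class R X Y (E' X i) =
        (\<Oplus>\<^bsub>Ext1 R X Y\<^esub>j\<in>F X i. c X i j \<odot>\<^bsub>Ext1 R X Y\<^esub> ext_class R X Y (E X j))"
      using c[OF X i] unfolding coordinates_def by blast
    also have "\<dots> = (\<Oplus>\<^bsub>Ext1 R X Y\<^esub>j\<in>F X i. cocycle_class R Y X (?\<gamma> j))"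
      using \<gamma> unfolding Ext1_carrier by (intro Ext.M.finsum_cong') (auto simp: Ext1_carrier)
    also have "\<dots> = cocycle_class R Y X (\<lambda>r x x'. \<Oplus>\<^bsub>Y\<^esub>j\<in>F X i. ?\<gamma> j r x x')"
      using Ext1_finsum[OF modX[OF X] assms(3) ringK[OF X] F(1) \<gamma>(2)] by simp
    finally have cls: "ext_class R X Y (E' X i) = cocycle_class R Y X (\<lambda>r x x'. \<Oplus>\<^bsub>Y\<^esub>j\<in>F X i. ?\<gamma> j r x x')" .
    have "ext_cocycle R Y X (\<lambda>r x x'. \<Oplus>\<^bsub>Y\<^esub>j\<in>F X i. ?\<gamma> j r x x')"
      using Ext1_finsum[OF modX[OF X] assms(3) ringK[OF X] F(1) \<gamma>(2)] by simp
    then obtain s' where s': "cocycle_lift R Y X (E' X i) (\<lambda>x. x) s' (\<lambda>r x x'. \<Oplus>\<^bsub>Y\<^esub>j\<in>F X i. ?\<gamma> j r x x')"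
      using cocycle_lift_ext_class[OF E(2)[OF X i] cls] by blast
    have "\<exists>t. cocycle_lift R Y X ?S (\<lambda>x. direct_sum_inj ?J fst (X, j) (c X i j x)) t (?\<gamma> j)"
      if j: "j \<in> F X i" for j
    proof -
      note jI = subsetD[OF F(2) j]
      note Ej = short_exactD[OF E(1)[OF X jI]]
      obtain l where l: "l \<in> mod_hom R (Mid (E X j)) Z" "\<And>y. y \<in> carrier Y \<Longrightarrow> l (Incl (E X j) y) = \<alpha> y"
        "\<And>m. m \<in> carrier (Mid (E X j)) \<Longrightarrow> \<beta> (l m) = direct_sum_inj ?J fst (X, j) (Proj (E X j) m)"
        using comp[OF X jI] by blast
      from cocycle_lift_push[OF cocycle_lift_comp[OF s[OF j] modX[OF X] F(3)] modX[OF X] assms(3) Ej(2,4),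
          of l ?S "\<lambda>y. y" Y "direct_sum_inj ?J fst (X, j)"] l
      show ?thesis by auto
    qed
    then obtain t where "\<And>j. j \<in> F X i \<Longrightarrow>
        cocycle_lift R Y X ?S (\<lambda>x. direct_sum_inj ?J fst (X, j) (c X i j x)) (t j) (?\<gamma> j)"
      by metis
    from cocycle_lift_finsum[OF S modX[OF X] F(1) this]
    have "cocycle_lift R Y X ?S (matrix_row \<X> I X (F X i) (c X i)) (\<lambda>x. \<Oplus>\<^bsub>Z\<^esub>j\<in>F X i. t j x)
        (\<lambda>r x x'. \<Oplus>\<^bsub>Y\<^esub>j\<in>F X i. ?\<gamma> j r x x')"
      by (simp add: matrix_row_def[abs_def])
    from hom_of_cocycle_lift[OF E(2)[OF X i] s' S this]
    show ?thesis by simp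
  qed
  have "\<exists>h. h \<in> mod_hom R (Mid (E' (fst p) (snd p))) Z \<and>
      (\<forall>y\<in>carrier Y. h (Incl (E' (fst p) (snd p)) y) = \<alpha> y) \<and>
      (\<forall>m\<in>carrier (Mid (E' (fst p) (snd p))).
        \<beta> (h m) = ?g (direct_sum_inj ?J fst p (Proj (E' (fst p) (snd p)) m)))" if "p \<in> ?J" for p
  proof -
    obtain X i where p: "p = (X, i)" "X \<in> \<X>" "i \<in> I X" using \<open>p \<in> ?J\<close> by blast
    show ?thesis
      using lift[OF p(2,3)] matrix_map_inj[OF assms(1) modX C p(2,3)]
        mod_hom_closed[OF short_exactD(5)[OF E(2)[OF p(2,3)]]]
      unfolding p(1) by fastforce
  qed
  then obtain h where h: "\<And>p. p \<in> ?J \<Longrightarrow> h p \<in> mod_hom R (Mid (E' (fst p) (snd p))) Z"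
      "\<And>p y. p \<in> ?J \<Longrightarrow> y \<in> carrier Y \<Longrightarrow> h p (Incl (E' (fst p) (snd p)) y) = \<alpha> y"
      "\<And>p m. p \<in> ?J \<Longrightarrow> m \<in> carrier (Mid (E' (fst p) (snd p))) \<Longrightarrow>
        \<beta> (h p m) = ?g (direct_sum_inj ?J fst p (Proj (E' (fst p) (snd p)) m))"
    by metis
  have "\<exists>f\<in>mod_hom R (Mid ?S') (Mid ?S). (\<forall>y\<in>carrier Y. f (Incl ?S' y) = Incl ?S y) \<and>
    (\<forall>z\<in>carrier (Mid ?S'). Proj ?S (f z) = ?g (Proj ?S' z))"
  proof (rule pushout_direct_sum_universal[OF assms(3), of ?J fst "\<lambda>(X, i). E' X i" ?S' ?P ?S ?g h])
    show "short_exact R Y (fst j) (case j of (X, i) \<Rightarrow> E' X i)" if "j \<in> ?J" for j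
      using that E(2) by auto
    show "short_exact R Y (direct_sum ?J fst) ?S'" using S' by (simp only: semibrick_sum_def)
    show "?g \<in> mod_hom R (direct_sum ?J fst) ?P"
      using matrix_map_hom[OF assms(1) modX C] by (simp only: semibrick_sum_def)
  qed (use equiv(2) S h in \<open>simp_all add: split_beta\<close>)
  then obtain f where f: "f \<in> mod_hom R Z' Z" "\<forall>y\<in>carrier Y. f (\<alpha>' y) = \<alpha> y"
      "\<forall>z\<in>carrier Z'. \<beta> (f z) = ?g (\<beta>' z)"
    by auto
  have "f \<in> mod_iso R Z' Z"
    using short_five[OF S' S _ g, of f] f by simp
  with f g show ?thesis by blast
qed

end
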